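(* Let $(L,\mathfrak m)$ be a (Noetherian) local ring with infinite residue field, let $\mathfrak a=(a_1,\ldots,a_m)$ be an ideal of $L$, and let $\mathfrak q_u\subseteq\mathfrak a_u$ be the associated generic minimal reduction of $\mathfrak a$. Then $$r(\mathfrak a)=r_{\mathfrak q_u}(\mathfrak a_u).$$
   Context: For an ideal $\mathfrak b$ of a local ring, an ideal $\mathfrak q\subseteq\mathfrak b$ is a reduction of $\mathfrak b$ if $\mathfrak b^{n+1}=\mathfrak q\mathfrak b^n$ for some $n\ge0$; the least such $n$ is denoted $r_{\mathfrak q}(\mathfrak b)$. Minimal reductions are reductions minimal with respect to inclusion. The reduction number $r(\mathfrak b)$ is the minimum of $r_{\mathfrak q}(\mathfrak b)$ over all minimal reductions $\mathfrak q$ of $\mathfrak b$. Let $d=\dim F(\mathfrak a)$ be the analytic spread of $\mathfrak a$, where $F(\mathfrak a)=\bigoplus_{n\ge0}\mathfrak a^n/\mathfrak m\mathfrak a^n$. Let $u=\{u_{ij}\mid i=1,\ldots,d,\ j=1,\ldots,m\}$ be indeterminates and $L(u)=L[u]_{\mathfrak mL[u]}$. Put $b_i=\sum_{j=1}^m u_{ij}a_j$ ($i=1,\ldots,d$), $\mathfrak a_u=\mathfrak aL(u)$ and $\mathfrak q_u=(b_1,\ldots,b_d)L(u)$. Then $\mathfrak q_u$ is a minimal reduction of $\mathfrak a_u$, called a generic minimal reduction of $\mathfrak a$. *)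

theory Defs
  imports "HOL-Algebra.Algebra" "HOL-Library.Extended_Nat"
begin

section \<open>Local rings and Krull dimension\<close>

locale local_ring = cring R + maximalideal M R for R (structure) and M +
  assumes maximal_unique: "maximalideal N R \<Longrightarrow> N = M"

text \<open>
  The supremum of the lengths \<open>n\<close> of strictly ascending chains
  \<open>P 0 \<subset> P 1 \<subset> \<dots> \<subset> P n\<close> of prime ideals.
\<close>
definition krull_dim :: "('a, 'b) ring_scheme \<Rightarrow> enat" where
  "krull_dim R = Sup {enat n | n. \<exists>P :: nat \<Rightarrow> 'a set.
     (\<forall>i\<le>n. primeideal (P i) R) \<and> (\<forall>i<n. P i \<subset> P (Suc i))}"


section \<open>Reductions of ideals\<close>

text \<open>The zeroth power of an ideal is the unit ideal.\<close>
definition ideal_pow :: "('a, 'b) ring_scheme \<Rightarrow> 'a set \<Rightarrow> nat \<Rightarrow> 'a set" where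
  "ideal_pow R I n = I [^]\<^bsub>ideals_set R\<^esub> n"

definition reduction :: "('a, 'b) ring_scheme \<Rightarrow> 'a set \<Rightarrow> 'a set \<Rightarrow> bool" where
  "reduction R Q I \<longleftrightarrow> ideal Q R \<and> ideal I R \<and> Q \<subseteq> I \<and>
     (\<exists>n. ideal_pow R I (Suc n) = Q \<cdot>\<^bsub>R\<^esub> ideal_pow R I n)"

definition minimal_reduction :: "('a, 'b) ring_scheme \<Rightarrow> 'a set \<Rightarrow> 'a set \<Rightarrow> bool" where
  "minimal_reduction R Q I \<longleftrightarrow> reduction R Q I \<and>
     (\<forall>Q'. reduction R Q' I \<and> Q' \<subseteq> Q \<longrightarrow> Q' = Q)"

text \<open>
  In \<^typ>\<open>enat\<close>, the infimum of a nonempty set is its least element, and the infimum of the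
  empty set is \<open>\<infinity>\<close>.  So the value is \<open>\<infinity>\<close> exactly if no \<open>n\<close> as required exists.
\<close>
definition reduction_number_wrt :: "('a, 'b) ring_scheme \<Rightarrow> 'a set \<Rightarrow> 'a set \<Rightarrow> enat" where
  "reduction_number_wrt R Q I =
     Inf {enat n | n. ideal_pow R I (Suc n) = Q \<cdot>\<^bsub>R\<^esub> ideal_pow R I n}"

definition reduction_number :: "('a, 'b) ring_scheme \<Rightarrow> 'a set \<Rightarrow> enat" where
  "reduction_number R I = Inf {reduction_number_wrt R Q I | Q. minimal_reduction R Q I}"


section \<open>The fiber cone and the analytic spread\<close>

text \<open>
  An element of the direct sum of the \<open>I^n/MI^n\<close> is a finitely supported family \<open>f\<close> whose
  \<open>n\<close>-th component is a coset \<open>MI^n + x\<close> with \<open>x \<in> I^n\<close>.  The product of \<open>MI^i + x\<close> and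
  \<open>MI^j + y\<close> is \<open>MI^(i+j) + xy\<close>; the components of degree \<open>n\<close> are summed in \<open>R/MI^n\<close>, which
  contains \<open>I^n/MI^n\<close>.
\<close>
definition fiber_cone ::
    "('a, 'b) ring_scheme \<Rightarrow> 'a set \<Rightarrow> 'a set \<Rightarrow> (nat \<Rightarrow> 'a set) ring" where
  "fiber_cone R M I = (let J = (\<lambda>n. M \<cdot>\<^bsub>R\<^esub> ideal_pow R I n) in
     \<lparr>carrier = {f. (\<forall>n. \<exists>x\<in>ideal_pow R I n. f n = J n +>\<^bsub>R\<^esub> x) \<and> finite {n. f n \<noteq> J n}},
      monoid.mult = (\<lambda>f g n. \<Oplus>\<^bsub>R Quot J n\<^esub>i\<in>{..n}. [mod J n:] f i \<Otimes>\<^bsub>R\<^esub> g (n - i)),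
      one = (\<lambda>n. if n = 0 then J 0 +>\<^bsub>R\<^esub> \<one>\<^bsub>R\<^esub> else J n),
      ring.zero = J,
      ring.add = (\<lambda>f g n. f n <+>\<^bsub>R\<^esub> g n)\<rparr>)"

text \<open>
  The fiber cone of an ideal of a Noetherian local ring is a finitely generated algebra over the
  residue field, so its dimension is finite.
\<close>
definition analytic_spread :: "('a, 'b) ring_scheme \<Rightarrow> 'a set \<Rightarrow> 'a set \<Rightarrow> nat" where
  "analytic_spread R M I = the_enat (krull_dim (fiber_cone R M I))"


section \<open>Polynomial rings in several indeterminates and localization\<close>

text \<open>
  The polynomial ring over \<open>R\<close> with the elements of \<open>V\<close> as indeterminates.  As in
  \<^theory>\<open>HOL-Algebra.Indexed_Polynomials\<close>, a polynomial maps every monomial, a multiset of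
  indeterminates, to its coefficient.
\<close>
definition mpoly_ring :: "('a, 'b) ring_scheme \<Rightarrow> 'v set \<Rightarrow> ('v multiset \<Rightarrow> 'a) ring" where
  "mpoly_ring R V =
     \<lparr>carrier = ring.indexed_pset R V (carrier R),
      monoid.mult = (\<lambda>p q k. \<Oplus>\<^bsub>R\<^esub>l\<in>{l. l \<subseteq># k}. p l \<otimes>\<^bsub>R\<^esub> q (k - l)),
      one = ring.indexed_const R \<one>\<^bsub>R\<^esub>,
      ring.zero = ring.indexed_const R \<zero>\<^bsub>R\<^esub>,
      ring.add = ring.indexed_padd R\<rparr>"

text \<open>The fraction \<open>r/s\<close>, as the set of all pairs of a numerator and a denominator in \<open>S\<close>
  that represent it.\<close>
definition fraction :: "('a, 'b) ring_scheme \<Rightarrow> 'a set \<Rightarrow> 'a \<Rightarrow> 'a \<Rightarrow> ('a \<times> 'a) set" where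
  "fraction R S r s = {(r', s'). r' \<in> carrier R \<and> s' \<in> S \<and>
     (\<exists>t\<in>S. t \<otimes>\<^bsub>R\<^esub> (s' \<otimes>\<^bsub>R\<^esub> r) = t \<otimes>\<^bsub>R\<^esub> (s \<otimes>\<^bsub>R\<^esub> r'))}"

definition localization :: "('a, 'b) ring_scheme \<Rightarrow> 'a set \<Rightarrow> ('a \<times> 'a) set ring" where
  "localization R S =
     \<lparr>carrier = {fraction R S r s | r s. r \<in> carrier R \<and> s \<in> S},
      monoid.mult = (\<lambda>A B. \<Union>(r, s)\<in>A. \<Union>(r', s')\<in>B.
        fraction R S (r \<otimes>\<^bsub>R\<^esub> r') (s \<otimes>\<^bsub>R\<^esub> s')),
      one = fraction R S \<one>\<^bsub>R\<^esub> \<one>\<^bsub>R\<^esub>,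
      ring.zero = fraction R S \<zero>\<^bsub>R\<^esub> \<one>\<^bsub>R\<^esub>,
      ring.add = (\<lambda>A B. \<Union>(r, s)\<in>A. \<Union>(r', s')\<in>B.
        fraction R S (s' \<otimes>\<^bsub>R\<^esub> r \<oplus>\<^bsub>R\<^esub> s \<otimes>\<^bsub>R\<^esub> r') (s \<otimes>\<^bsub>R\<^esub> s'))\<rparr>"


section \<open>The generic minimal reduction\<close>

text \<open>
  The indeterminate \<open>u\<^sub>i\<^sub>j\<close> is indexed by the pair \<open>(i, j)\<close>, where \<open>1 \<le> i \<le> d\<close> and
  \<open>1 \<le> j \<le> m\<close>.
\<close>
definition generic_poly_ring ::
    "('a, 'b) ring_scheme \<Rightarrow> nat \<Rightarrow> nat \<Rightarrow> ((nat \<times> nat) multiset \<Rightarrow> 'a) ring" where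
  "generic_poly_ring R d m = mpoly_ring R ({1..d} \<times> {1..m})"

text \<open>The complement of the prime ideal generated by \<open>M\<close> in the polynomial ring.\<close>
definition generic_denominators ::
    "('a, 'b) ring_scheme \<Rightarrow> 'a set \<Rightarrow> nat \<Rightarrow> nat \<Rightarrow> ((nat \<times> nat) multiset \<Rightarrow> 'a) set" where
  "generic_denominators R M d m = carrier (generic_poly_ring R d m) -
     Idl\<^bsub>generic_poly_ring R d m\<^esub> (ring.indexed_const R ` M)"

definition generic_ring :: "('a, 'b) ring_scheme \<Rightarrow> 'a set \<Rightarrow> nat \<Rightarrow> nat \<Rightarrow>
    (((nat \<times> nat) multiset \<Rightarrow> 'a) \<times> ((nat \<times> nat) multiset \<Rightarrow> 'a)) set ring" where
  "generic_ring R M d m = localization (generic_poly_ring R d m) (generic_denominators R M d m)"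

definition to_generic_ring :: "('a, 'b) ring_scheme \<Rightarrow> 'a set \<Rightarrow> nat \<Rightarrow> nat \<Rightarrow>
    ((nat \<times> nat) multiset \<Rightarrow> 'a) \<Rightarrow>
    (((nat \<times> nat) multiset \<Rightarrow> 'a) \<times> ((nat \<times> nat) multiset \<Rightarrow> 'a)) set" where
  "to_generic_ring R M d m p = fraction (generic_poly_ring R d m) (generic_denominators R M d m)
     p \<one>\<^bsub>generic_poly_ring R d m\<^esub>"

definition generic_extension :: "('a, 'b) ring_scheme \<Rightarrow> 'a set \<Rightarrow> nat \<Rightarrow> nat \<Rightarrow> 'a set \<Rightarrow>
    (((nat \<times> nat) multiset \<Rightarrow> 'a) \<times> ((nat \<times> nat) multiset \<Rightarrow> 'a)) set set" where
  "generic_extension R M d m I =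
     Idl\<^bsub>generic_ring R M d m\<^esub> ((\<lambda>x. to_generic_ring R M d m (ring.indexed_const R x)) ` I)"

definition generic_combination ::
    "('a, 'b) ring_scheme \<Rightarrow> nat \<Rightarrow> nat \<Rightarrow> (nat \<Rightarrow> 'a) \<Rightarrow> nat \<Rightarrow> (nat \<times> nat) multiset \<Rightarrow> 'a" where
  "generic_combination R d m a i =
     (\<Oplus>\<^bsub>generic_poly_ring R d m\<^esub>j\<in>{1..m}.
        ring.indexed_var R (i, j) \<otimes>\<^bsub>generic_poly_ring R d m\<^esub> ring.indexed_const R (a j))"

definition generic_minimal_reduction :: "('a, 'b) ring_scheme \<Rightarrow> 'a set \<Rightarrow> nat \<Rightarrow> nat \<Rightarrow>
    (nat \<Rightarrow> 'a) \<Rightarrow>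
    (((nat \<times> nat) multiset \<Rightarrow> 'a) \<times> ((nat \<times> nat) multiset \<Rightarrow> 'a)) set set" where
  "generic_minimal_reduction R M d m a = Idl\<^bsub>generic_ring R M d m\<^esub>
     ((\<lambda>i. to_generic_ring R M d m (generic_combination R d m a i)) ` {1..d})"

end

theory Submission
  imports Defs
begin

text \<open>
  Let \<open>k\<close> be the residue field, \<open>F\<close> the fiber cone and \<open>d\<close> its dimension.  A matrix \<open>\<alpha>\<close>
  over \<open>L\<close> specializes the generic combinations \<open>b\<^sub>1, \<dots>, b\<^sub>d\<close> to elements of \<open>\<aa>\<close>,
  which generate an ideal \<open>q\<^sub>\<alpha>\<close>.  The theorem follows from two facts, each of which describes the
  numbers \<open>n\<close> that compete for the minimum on one side of the equation.

  First, the generic equation \<open>\<aa>\<^sub>u\<^sup>n\<^sup>+\<^sup>1 = q\<^sub>u \<aa>\<^sub>u\<^sup>n\<close> holds if and only if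
  \<open>\<aa>\<^sup>n\<^sup>+\<^sup>1 = q\<^sub>\<alpha> \<aa>\<^sup>n\<close> for some \<open>\<alpha>\<close> (\<open>generic_reduction_iff\<close>).
  A polynomial outside of \<open>\<mm>L[u]\<close> has a value outside of \<open>\<mm>\<close> somewhere, because \<open>k\<close> is
  infinite; so the generic equation can be specialized once its denominators have been cleared.
  Conversely, if the equation holds at \<open>\<alpha>\<close>, then Nakayama's lemma for the ideal of all polynomials
  that vanish at \<open>\<alpha>\<close> shows that the generic equation holds after inverting a polynomial with value
  \<open>1\<close> at \<open>\<alpha>\<close>.

  Second, the minimal reductions of \<open>\<aa>\<close> are exactly those reductions that have the form
  \<open>q\<^sub>\<alpha>\<close>.  This rests on two bounds for the dimension of \<open>F\<close>.

  If some reduction has \<open>s\<close> generators, then \<open>d \<le> s\<close> (\<open>krull_dim_cone_le\<close>).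
  The graded pieces of \<open>F\<close> up to degree \<open>N\<close> are spanned by a constant times \<open>(N + 1)\<^sup>s\<close>
  elements.  A chain of primes of length \<open>s + 1\<close>, on the other hand, yields \<open>s + 1\<close> elements
  whose monomials are linearly independent over \<open>k\<close>, and these are too many
  (\<open>krull_dim_le_growth\<close>).  It follows that a reduction with \<open>d\<close> generators is minimal
  (\<open>generated_reduction_is_minimal\<close>): a reduction properly inside of it would be generated by fewer
  elements up to \<open>\<mm>\<aa>\<close>, and these would generate a reduction by Nakayama's lemma.

  Every reduction \<open>q\<close> contains a reduction generated by \<open>d\<close> elements
  (\<open>reduction_contains_generated_reduction\<close>).  Otherwise consider the homogeneous ideals of \<open>F\<close> whose
  quotient cannot be made zero in large degrees by \<open>t\<close> elements of \<open>q\<close>, starting with the zero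
  ideal and \<open>t = d\<close>.  A maximal one among them is prime, because finitely many general choices of the
  \<open>t\<close> elements can be made at the same time (\<open>common_combinations\<close>); an element of \<open>q\<close> outside of this
  prime leads to a larger ideal with \<open>t - 1\<close> in place of \<open>t\<close>.  This produces a chain of \<open>d + 2\<close>
  homogeneous primes (\<open>graded_prime_chain\<close>), which is too long.
\<close>

no_notation Sum_Type.Plus (infixr \<open><+>\<close> 65)

section \<open>Arithmetic of ideals\<close>

lemma ideal_zero_mem: "ideal I R \<Longrightarrow> \<zero>\<^bsub>R\<^esub> \<in> I"
  by (simp add: additive_subgroup.zero_closed ideal.axioms(1))

lemma ideal_add_mem: "ideal I R \<Longrightarrow> x \<in> I \<Longrightarrow> y \<in> I \<Longrightarrow> x \<oplus>\<^bsub>R\<^esub> y \<in> I"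
  by (simp add: additive_subgroup.a_closed ideal.axioms(1))

lemma ideal_minus_mem:
  assumes "ideal I R" "x \<in> I" "y \<in> I"
  shows "x \<ominus>\<^bsub>R\<^esub> y \<in> I"
proof -
  interpret ideal I R by fact
  show ?thesis using assms by (simp add: a_minus_def)
qed

context cring
begin

lemma finsum_mem_ideal:
  assumes "ideal I R" "\<And>i. i \<in> A \<Longrightarrow> f i \<in> I"
  shows "(\<Oplus>i\<in>A. f i) \<in> I"
proof (cases "finite A")
  case True
  then show ?thesis
    using assms(2)
  proof (induction rule: finite_induct)
    case empty
    then show ?case by (simp add: ideal_zero_mem[OF assms(1)])
  next
    case (insert x F)
    have "f \<in> F \<rightarrow> carrier R" "f x \<in> carrier R"
      using insert.prems ideal.Icarr[OF assms(1)] by auto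
    with insert show ?case by (simp add: ideal_add_mem[OF assms(1)])
  qed
qed (simp add: ideal_zero_mem[OF assms(1)])

lemma Idl_induct [consumes 2, case_names zero gen add]:
  assumes "S \<subseteq> carrier R" "x \<in> Idl S"
    and "P \<zero>"
    and "\<And>r y. r \<in> carrier R \<Longrightarrow> y \<in> S \<Longrightarrow> P (r \<otimes> y)"
    and "\<And>y z. y \<in> Idl S \<Longrightarrow> z \<in> Idl S \<Longrightarrow> P y \<Longrightarrow> P z \<Longrightarrow> P (y \<oplus> z)"
  shows "P x"
proof -
  interpret I: ideal "Idl S" R using genideal_ideal[OF assms(1)] .
  \<comment> \<open>the elements all of whose multiples have the property form an ideal\<close>
  let ?J = "{y \<in> Idl S. \<forall>r\<in>carrier R. P (r \<otimes> y)}"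
  have "ideal ?J R"
  proof (rule idealI)
    show "subgroup ?J (add_monoid R)"
    proof (rule add.subgroupI)
      show "?J \<noteq> {}" using assms(3) I.zero_closed by (auto intro!: exI[of _ \<zero>])
      show "\<ominus> y \<in> ?J" if "y \<in> ?J" for y
      proof -
        have "y \<in> carrier R" using that I.Icarr by auto
        moreover have "r \<otimes> \<ominus> y = (\<ominus> r) \<otimes> y" if "r \<in> carrier R" for r
          using that \<open>y \<in> carrier R\<close> by (simp add: l_minus r_minus)
        ultimately show ?thesis using that by auto
      qed
      show "y \<oplus> z \<in> ?J" if "y \<in> ?J" "z \<in> ?J" for y z
        using that I.Icarr by (auto simp: r_distr intro!: assms(5) I.I_l_closed)
    qed (use I.Icarr in auto)
    show "y \<otimes> x \<in> ?J" "x \<otimes> y \<in> ?J" if "y \<in> ?J" "x \<in> carrier R" for y x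
      using that I.Icarr by (auto simp: m_assoc[symmetric] I.I_l_closed I.I_r_closed m_comm[of y x])
  qed (rule ring_axioms)
  moreover have "S \<subseteq> ?J"
    using genideal_self[OF assms(1)] assms(1,4) by auto
  ultimately have "Idl S \<subseteq> ?J" by (rule genideal_minimal)
  with assms(2) have "\<forall>r\<in>carrier R. P (r \<otimes> x)" by blast
  then have "P (\<one> \<otimes> x)" by blast
  then show ?thesis using assms(2) I.Icarr by simp
qed

lemma Idl_mono:
  assumes "Y \<subseteq> carrier R" "S \<subseteq> Idl Y"
  shows "Idl S \<subseteq> Idl Y"
  using genideal_minimal[OF genideal_ideal[OF assms(1)] assms(2)] .

lemma ideal_prod_subset:
  assumes "ideal K R" "\<And>x y. x \<in> I \<Longrightarrow> y \<in> J \<Longrightarrow> x \<otimes> y \<in> K"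
  shows "I \<cdot> J \<subseteq> K"
proof
  fix z assume "z \<in> I \<cdot> J"
  then show "z \<in> K"
    by (induction rule: ideal_prod.induct) (auto intro: assms ideal_add_mem)
qed

lemma ideal_prod_mono: "I \<subseteq> I' \<Longrightarrow> J \<subseteq> J' \<Longrightarrow> I \<cdot> J \<subseteq> I' \<cdot> J'"
proof
  fix z assume *: "I \<subseteq> I'" "J \<subseteq> J'" "z \<in> I \<cdot> J"
  from *(3) show "z \<in> I' \<cdot> J'"
    by (induction rule: ideal_prod.induct) (use * in \<open>auto intro: ideal_prod.intros\<close>)
qed

lemma Idl_prod_Idl:
  assumes "S \<subseteq> carrier R" "Y \<subseteq> carrier R"
  shows "(Idl S) \<cdot> (Idl Y) = Idl ((\<lambda>(x, y). x \<otimes> y) ` (S \<times> Y))" (is "_ = Idl ?SY")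
proof
  have SY: "?SY \<subseteq> carrier R" using assms by auto
  interpret K: ideal "Idl ?SY" R using genideal_ideal[OF SY] .
  interpret I: ideal "Idl S" R using genideal_ideal[OF assms(1)] .
  interpret J: ideal "Idl Y" R using genideal_ideal[OF assms(2)] .
  show "(Idl S) \<cdot> (Idl Y) \<subseteq> Idl ?SY"
  proof (rule ideal_prod_subset[OF K.is_ideal])
    fix x y assume x: "x \<in> Idl S" and y: "y \<in> Idl Y"
    from assms(1) x show "x \<otimes> y \<in> Idl ?SY"
    proof (induction rule: Idl_induct)
      case zero
      then show ?case using J.Icarr[OF y] by simp
    next
      case (gen r a)
      from assms(2) y show ?case
      proof (induction rule: Idl_induct)
        case zero
        then show ?case using gen assms by auto
      next
        case (gen s b)
        have c: "a \<in> carrier R" "b \<in> carrier R" using \<open>a \<in> S\<close> \<open>b \<in> Y\<close> assms by auto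
        have "a \<otimes> b \<in> Idl ?SY"
          using genideal_self[OF SY] \<open>a \<in> S\<close> \<open>b \<in> Y\<close> by auto
        then have "(r \<otimes> s) \<otimes> (a \<otimes> b) \<in> Idl ?SY"
          using \<open>s \<in> carrier R\<close> \<open>r \<in> carrier R\<close> by (simp add: K.I_l_closed)
        moreover have "(r \<otimes> s) \<otimes> (a \<otimes> b) = (r \<otimes> a) \<otimes> (s \<otimes> b)"
          using c gen \<open>r \<in> carrier R\<close> by (simp add: m_ac)
        ultimately show ?case by simp
      next
        case (add y z)
        moreover have "y \<in> carrier R" "z \<in> carrier R" "a \<in> carrier R"
          using add J.Icarr \<open>a \<in> S\<close> assms(1) by auto
        ultimately show ?case using \<open>r \<in> carrier R\<close> by (simp add: r_distr)
      qed
    next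
      case (add x z)
      moreover have "x \<in> carrier R" "z \<in> carrier R" "y \<in> carrier R"
        using add I.Icarr J.Icarr y by auto
      ultimately show ?case by (simp add: l_distr)
    qed
  qed
  show "Idl ?SY \<subseteq> (Idl S) \<cdot> (Idl Y)"
    using genideal_self assms
    by (intro genideal_minimal ideal_prod_is_ideal genideal_ideal) (auto intro!: ideal_prod.prod)
qed

lemma ideal_pow_0 [simp]: "ideal_pow R I 0 = carrier R"
  by (simp add: ideal_pow_def nat_pow_def ideals_set_def)

lemma ideal_pow_ideal [simp]: "ideal I R \<Longrightarrow> ideal (ideal_pow R I n) R"
proof -
  interpret I: comm_monoid "ideals_set R" by (rule ideals_set_is_comm_monoid)
  assume "ideal I R"
  then have "ideal_pow R I n \<in> carrier (ideals_set R)"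
    unfolding ideal_pow_def by (intro I.nat_pow_closed) (simp add: ideals_set_def)
  then show ?thesis by (simp add: ideals_set_def)
qed

lemma ideal_pow_Suc: "ideal I R \<Longrightarrow> ideal_pow R I (Suc n) = I \<cdot> ideal_pow R I n"
  using ideal_prod_commute[of I "ideal_pow R I n"] ideal_pow_ideal[of I n]
  by (simp add: ideal_pow_def ideals_set_def)

lemma ideal_pow_1 [simp]: "ideal I R \<Longrightarrow> ideal_pow R I (Suc 0) = I"
  by (simp add: ideal_pow_Suc ideal_prod_one)

lemma ideal_pow_add:
  assumes "ideal I R"
  shows "ideal_pow R I (i + j) = ideal_pow R I i \<cdot> ideal_pow R I j"
proof -
  interpret I: comm_monoid "ideals_set R" by (rule ideals_set_is_comm_monoid)
  show ?thesis
    using I.nat_pow_mult[of I i j] assms unfolding ideal_pow_def by (simp add: ideals_set_def)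
qed

lemma ideal_pow_mult_mem:
  assumes "ideal I R" "x \<in> ideal_pow R I i" "y \<in> ideal_pow R I j"
  shows "x \<otimes> y \<in> ideal_pow R I (i + j)"
  using assms by (simp add: ideal_pow_add ideal_prod.prod)

fun nfold_products :: "'a set \<Rightarrow> nat \<Rightarrow> 'a set" where
  "nfold_products S 0 = {\<one>}"
| "nfold_products S (Suc n) = (\<lambda>(x, y). x \<otimes> y) ` (S \<times> nfold_products S n)"

lemma nfold_products_carrier: "S \<subseteq> carrier R \<Longrightarrow> nfold_products S n \<subseteq> carrier R"
  by (induction n) auto

lemma finite_nfold_products: "finite S \<Longrightarrow> finite (nfold_products S n)"
  by (induction n) auto

lemma ideal_pow_Idl:
  assumes "S \<subseteq> carrier R"
  shows "ideal_pow R (Idl S) n = Idl (nfold_products S n)"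
proof (induction n)
  case 0
  then show ?case by (simp add: genideal_one)
next
  case (Suc n)
  then show ?case
    using assms
    by (simp add: ideal_pow_Suc genideal_ideal Idl_prod_Idl nfold_products_carrier)
qed

lemma ideal_sum_mem:
  "x \<in> I <+> J \<longleftrightarrow> (\<exists>y\<in>I. \<exists>z\<in>J. x = y \<oplus> z)"
  by (auto simp: set_add_def')

lemma ideal_sum_upper:
  assumes "ideal I R" "ideal J R"
  shows "I \<subseteq> I <+> J" "J \<subseteq> I <+> J"
proof -
  have "I \<union> J \<subseteq> Idl (I \<union> J)"
    by (rule genideal_self) (auto dest: ideal.Icarr[OF assms(1)] ideal.Icarr[OF assms(2)])
  then show "I \<subseteq> I <+> J" "J \<subseteq> I <+> J"
    using union_genideal[OF assms] by auto
qed

lemma ideal_sum_least: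
  "ideal K R \<Longrightarrow> I \<subseteq> K \<Longrightarrow> J \<subseteq> K \<Longrightarrow> I <+> J \<subseteq> K"
  by (auto simp: ideal_sum_mem intro!: ideal_add_mem)

lemma ideal_sum_mono: "I \<subseteq> I' \<Longrightarrow> J \<subseteq> J' \<Longrightarrow> I <+>\<^bsub>R\<^esub> J \<subseteq> I' <+>\<^bsub>R\<^esub> J'"
  by (force simp: ideal_sum_mem)

lemma Idl_insert:
  assumes "S \<subseteq> carrier R" "g \<in> carrier R" "x \<in> Idl (insert g S)"
  obtains r y where "r \<in> carrier R" "y \<in> Idl S" "x = r \<otimes> g \<oplus> y"
proof -
  interpret ideal "Idl S" R using genideal_ideal[OF assms(1)] .
  have "insert g S \<subseteq> carrier R" using assms by auto
  from this assms(3) have "\<exists>r\<in>carrier R. \<exists>y\<in>Idl S. x = r \<otimes> g \<oplus> y"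
  proof (induction rule: Idl_induct)
    case zero
    then show ?case using assms by (intro bexI[of _ \<zero>]) auto
  next
    case (gen r y)
    show ?case
    proof (cases "y = g")
      case True
      then show ?thesis using gen assms by (intro bexI[of _ r] bexI[of _ \<zero>]) auto
    next
      case False
      then have "r \<otimes> y \<in> Idl S" using gen genideal_self[OF assms(1)] by (auto intro: I_l_closed)
      then show ?thesis using gen assms Icarr by (intro bexI[of _ \<zero>] bexI[of _ "r \<otimes> y"]) auto
    qed
  next
    case (add y z)
    then obtain r s u v where *: "r \<in> carrier R" "s \<in> carrier R" "u \<in> Idl S" "v \<in> Idl S"
      "y = r \<otimes> g \<oplus> u" "z = s \<otimes> g \<oplus> v" by blast
    then have "y \<oplus> z = (r \<oplus> s) \<otimes> g \<oplus> (u \<oplus> v)"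
      using assms Icarr by (simp add: l_distr a_ac)
    with * show ?case by (intro bexI[of _ "r \<oplus> s"] bexI[of _ "u \<oplus> v"]) auto
  qed
  then show ?thesis using that by blast
qed

lemma Idl_combination:
  assumes "finite A" "w ` A \<subseteq> carrier R" "x \<in> Idl (w ` A)"
  shows "\<exists>c\<in>A \<rightarrow> carrier R. x = (\<Oplus>j\<in>A. c j \<otimes> w j)"
  using assms
proof (induction A arbitrary: x rule: finite_induct)
  case empty
  then have "x \<in> {\<zero>}" using genideal_minimal[OF zeroideal, of "{}"] by auto
  then show ?case by auto
next
  case (insert a A)
  then obtain r y where ry: "r \<in> carrier R" "y \<in> Idl (w ` A)" "x = r \<otimes> w a \<oplus> y"
    using Idl_insert[of "w ` A" "w a" x] by (simp, blast)
  then obtain c where c: "c \<in> A \<rightarrow> carrier R" "y = (\<Oplus>j\<in>A. c j \<otimes> w j)"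
    using insert by auto
  have "(\<Oplus>j\<in>insert a A. (c(a := r)) j \<otimes> w j)
      = (c(a := r)) a \<otimes> w a \<oplus> (\<Oplus>j\<in>A. (c(a := r)) j \<otimes> w j)"
    using insert c ry by (intro add.finprod_insert) (auto simp: Pi_iff)
  also have "(\<Oplus>j\<in>A. (c(a := r)) j \<otimes> w j) = y"
    unfolding c(2) using insert c by (intro add.finprod_cong') (auto simp: Pi_iff)
  finally have "x = (\<Oplus>j\<in>insert a A. (c(a := r)) j \<otimes> w j)"
    using ry by simp
  moreover have "c(a := r) \<in> insert a A \<rightarrow> carrier R" using c ry by (auto simp: Pi_iff)
  ultimately show ?case by blast
qed

lemma mult_Idl_mem:
  assumes "ideal Q R" "S \<subseteq> carrier R" "c \<in> carrier R" "\<And>x. x \<in> S \<Longrightarrow> c \<otimes> x \<in> Q" "x \<in> Idl S"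
  shows "c \<otimes> x \<in> Q"
proof -
  interpret Q: ideal Q R by fact
  interpret I: ideal "Idl S" R using genideal_ideal[OF assms(2)] .
  from assms(2,5) show ?thesis
  proof (induction rule: Idl_induct)
    case zero
    then show ?case using assms(3) by simp
  next
    case (gen r y)
    then have "c \<otimes> (r \<otimes> y) = r \<otimes> (c \<otimes> y)"
      using assms(2,3) by (intro m_lcomm) auto
    then show ?case using Q.I_l_closed[OF assms(4)[OF gen(2)] gen(1)] by simp
  next
    case (add y z)
    have "c \<otimes> (y \<oplus> z) = c \<otimes> y \<oplus> c \<otimes> z"
      using assms(3) I.Icarr[OF add(1)] I.Icarr[OF add(2)] by (rule r_distr[rotated 2]) 
    then show ?case using add by simp
  qed
qed

text \<open>
  The generators are eliminated one by one, each at the cost of multiplying with an element of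
  \<open>1 + N\<close>.  This replaces the determinant of the relation matrix in the usual proof.
\<close>

lemma nakayama:
  assumes "ideal N R" "ideal Q R" "finite S" "S \<subseteq> carrier R"
    and "S \<subseteq> Q <+> N \<cdot> (Idl S)"
  shows "\<exists>t\<in>N. \<forall>x\<in>Idl S. (\<one> \<ominus> t) \<otimes> x \<in> Q"
proof -
  interpret N: ideal N R by fact
  interpret Q: ideal Q R by fact
  have "\<exists>t\<in>N. \<forall>x\<in>S. (\<one> \<ominus> t) \<otimes> x \<in> Q"
    using assms(3-5)
  proof (induction S rule: finite_induct)
    case empty
    then show ?case using N.zero_closed by blast
  next
    case (insert g S)
    have S: "S \<subseteq> carrier R" and g: "g \<in> carrier R" using insert by auto
    interpret I: ideal "Idl S" R using genideal_ideal[OF S] .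
    interpret NI: ideal "N \<cdot> (Idl S)" R
      using ideal_prod_is_ideal[OF N.is_ideal I.is_ideal] .
    interpret K: ideal "Q <+> N \<cdot> (Idl S)" R
      using add_ideals[OF Q.is_ideal NI.is_ideal] .
    have split: "\<exists>n\<in>N. \<exists>y\<in>N \<cdot> (Idl S). z = n \<otimes> g \<oplus> y" if "z \<in> N \<cdot> (Idl (insert g S))" for z
      using that
    proof (induction rule: ideal_prod.induct)
      case (prod n x)
      obtain r y where ry: "r \<in> carrier R" "y \<in> Idl S" "x = r \<otimes> g \<oplus> y"
        using Idl_insert[OF S g prod(2)] .
      then have "n \<otimes> x = (n \<otimes> r) \<otimes> g \<oplus> n \<otimes> y"
        using prod N.Icarr I.Icarr g by (simp add: r_distr m_assoc)
      with ry prod show ?case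
        by (intro bexI[of _ "n \<otimes> r"] bexI[of _ "n \<otimes> y"]) (auto intro: N.I_r_closed ideal_prod.prod)
    next
      case (sum s1 s2)
      then obtain n1 n2 y1 y2 where *: "n1 \<in> N" "n2 \<in> N" "y1 \<in> N \<cdot> (Idl S)" "y2 \<in> N \<cdot> (Idl S)"
        "s1 = n1 \<otimes> g \<oplus> y1" "s2 = n2 \<otimes> g \<oplus> y2" by blast
      then have "s1 \<oplus> s2 = (n1 \<oplus> n2) \<otimes> g \<oplus> (y1 \<oplus> y2)"
        using N.Icarr NI.Icarr g by (simp add: l_distr a_ac)
      with * show ?case by (intro bexI[of _ "n1 \<oplus> n2"] bexI[of _ "y1 \<oplus> y2"]) auto
    qed
    have dec: "\<exists>n\<in>N. \<exists>k\<in>Q <+> N \<cdot> (Idl S). x = n \<otimes> g \<oplus> k" if x: "x \<in> insert g S" for x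
    proof -
      obtain q z where "q \<in> Q" "z \<in> N \<cdot> (Idl (insert g S))" "x = q \<oplus> z"
        using insert.prems x ideal_sum_mem by blast
      moreover obtain n y where "n \<in> N" "y \<in> N \<cdot> (Idl S)" "z = n \<otimes> g \<oplus> y"
        using split \<open>z \<in> _\<close> by blast
      moreover have "q \<in> carrier R" "y \<in> carrier R" "n \<otimes> g \<in> carrier R"
        using calculation Q.Icarr NI.Icarr N.Icarr g by simp_all
      ultimately have "x = n \<otimes> g \<oplus> (q \<oplus> y)" by (simp add: a_lcomm)
      moreover have "q \<oplus> y \<in> Q <+> N \<cdot> (Idl S)"
        using \<open>q \<in> Q\<close> \<open>y \<in> N \<cdot> (Idl S)\<close> ideal_sum_mem by blast
      ultimately show ?thesis using \<open>n \<in> N\<close> by blast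
    qed
    obtain n k where nk: "n \<in> N" "k \<in> Q <+> N \<cdot> (Idl S)" "g = n \<otimes> g \<oplus> k"
      using dec[of g] by blast
    have nc: "n \<in> carrier R" "k \<in> carrier R" using nk N.Icarr K.Icarr by auto
    have g1: "(\<one> \<ominus> n) \<otimes> g \<in> Q <+> N \<cdot> (Idl S)"
    proof -
      have "(\<one> \<ominus> n) \<otimes> g = g \<ominus> n \<otimes> g"
        using nc g by algebra
      also have "\<dots> = (n \<otimes> g \<oplus> k) \<ominus> n \<otimes> g"
        using nk(3) by simp
      also have "\<dots> = k" using nc g by algebra
      finally show ?thesis using nk by simp
    qed
    have "S \<subseteq> Q <+> N \<cdot> (Idl S)"
    proof
      fix x assume x: "x \<in> S"
      then obtain p l where pl: "p \<in> N" "l \<in> Q <+> N \<cdot> (Idl S)" "x = p \<otimes> g \<oplus> l"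
        using dec[of x] by blast
      have c: "p \<in> carrier R" "l \<in> carrier R" "x \<in> carrier R"
        using pl N.Icarr K.Icarr x S by auto
      have "x = (p \<otimes> ((\<one> \<ominus> n) \<otimes> g) \<oplus> (\<one> \<ominus> n) \<otimes> l) \<oplus> n \<otimes> x"
        unfolding pl(3) using c nc g by algebra
      moreover have "p \<otimes> ((\<one> \<ominus> n) \<otimes> g) \<oplus> (\<one> \<ominus> n) \<otimes> l \<in> Q <+> N \<cdot> (Idl S)"
        using g1 pl(1,2) c(1) N.Icarr nc by (simp add: K.I_l_closed)
      moreover have "n \<otimes> x \<in> N \<cdot> (Idl S)"
        using genideal_self[OF S] x nk(1) by (blast intro: ideal_prod.prod)
      then have "n \<otimes> x \<in> Q <+> N \<cdot> (Idl S)"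
        using ideal_sum_upper(2)[OF Q.is_ideal NI.is_ideal] by blast
      ultimately show "x \<in> Q <+> N \<cdot> (Idl S)" by (metis K.a_closed)
    qed
    then obtain t where t: "t \<in> N" "\<forall>x\<in>S. (\<one> \<ominus> t) \<otimes> x \<in> Q"
      using insert.IH S by blast
    have tc: "t \<in> carrier R" using t N.Icarr by auto
    have tI: "(\<one> \<ominus> t) \<otimes> x \<in> Q" if "x \<in> Idl S" for x
      by (rule mult_Idl_mem[OF Q.is_ideal S _ _ that]) (use t(2) tc in auto)
    have tK: "(\<one> \<ominus> t) \<otimes> x \<in> Q" if x: "x \<in> Q <+> N \<cdot> (Idl S)" for x
    proof -
      obtain q y where "q \<in> Q" "y \<in> N \<cdot> (Idl S)" "x = q \<oplus> y"
        using x unfolding ideal_sum_mem by blast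
      moreover have "y \<in> Idl S"
        using ideal_prod_inter[OF N.is_ideal I.is_ideal] calculation by auto
      moreover have "(\<one> \<ominus> t) \<otimes> (q \<oplus> y) = (\<one> \<ominus> t) \<otimes> q \<oplus> (\<one> \<ominus> t) \<otimes> y"
        using tc Q.Icarr[OF \<open>q \<in> Q\<close>] I.Icarr[OF \<open>y \<in> Idl S\<close>] by (simp add: r_distr)
      ultimately show ?thesis
        using tI[of y] tc Q.I_l_closed[of q "\<one> \<ominus> t"] by simp
    qed
    define s where "s = t \<oplus> n \<ominus> t \<otimes> n"
    have s: "s \<in> N" unfolding s_def
      using ideal_minus_mem[OF N.is_ideal N.a_closed[OF t(1) nk(1)] N.I_r_closed[OF t(1) nc(1)]] .
    have s1: "\<one> \<ominus> s = (\<one> \<ominus> n) \<otimes> (\<one> \<ominus> t)"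
      unfolding s_def using tc nc(1) by algebra
    then have s2: "\<one> \<ominus> s = (\<one> \<ominus> t) \<otimes> (\<one> \<ominus> n)"
      using tc nc(1) by (simp add: m_comm)
    have "(\<one> \<ominus> s) \<otimes> x \<in> Q" if "x \<in> insert g S" for x
    proof (cases "x = g")
      case True
      have "(\<one> \<ominus> s) \<otimes> g = (\<one> \<ominus> t) \<otimes> ((\<one> \<ominus> n) \<otimes> g)"
        unfolding s2 using tc nc(1) g by (simp add: m_assoc)
      then show ?thesis using tK[OF g1] True by simp
    next
      case False
      then have x: "x \<in> S" "x \<in> carrier R" using that S by auto
      have "(\<one> \<ominus> s) \<otimes> x = (\<one> \<ominus> n) \<otimes> ((\<one> \<ominus> t) \<otimes> x)"
        unfolding s1 using tc nc(1) x by (simp add: m_assoc)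
      then show ?thesis using Q.I_l_closed[of "(\<one> \<ominus> t) \<otimes> x" "\<one> \<ominus> n"] t(2) x nc(1) by simp
    qed
    then show ?case using s by blast
  qed
  then obtain t where t: "t \<in> N" "\<forall>x\<in>S. (\<one> \<ominus> t) \<otimes> x \<in> Q" by blast
  have tc: "t \<in> carrier R" using t N.Icarr by auto
  have "\<forall>x\<in>Idl S. (\<one> \<ominus> t) \<otimes> x \<in> Q"
    by (intro ballI, rule mult_Idl_mem[OF Q.is_ideal assms(4)]) (use t(2) tc in auto)
  then show ?thesis using t(1) by blast
qed

end

section \<open>Polynomials in several indeterminates\<close>

lemma finite_submultisets: "finite {l. l \<subseteq># (k :: 'c multiset)}"
proof (induction k)
  case (add x k)
  have "{l. l \<subseteq># add_mset x k} \<subseteq> {l. l \<subseteq># k} \<union> add_mset x ` {l. l \<subseteq># k}"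
  proof
    fix l assume l: "l \<in> {l. l \<subseteq># add_mset x k}"
    show "l \<in> {l. l \<subseteq># k} \<union> add_mset x ` {l. l \<subseteq># k}"
    proof (cases "x \<in># l")
      case True
      then obtain l' where "l = add_mset x l'" by (metis insert_DiffM)
      then show ?thesis using l by auto
    next
      case False
      then have "l \<subseteq># k"
        using l by (metis diff_union_swap2 mem_Collect_eq add_mset_remove_trivial
            diff_single_trivial mset_subset_eq_exists_conv subset_eq_diff_conv
            union_mset_add_mset_right add.right_neutral)
      then show ?thesis by simp
    qed
  qed
  then show ?case using add by (auto intro: finite_subset)
qed auto

lemma mem_add_mset_diff_iff:
  assumes "l \<subseteq># add_mset i k"
  shows "i \<in># add_mset i k - l \<longleftrightarrow> l \<subseteq># k"
proof
  assume "i \<in># add_mset i k - l"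
  then have "count l i \<le> count k i" by (simp add: in_diff_count)
  then show "l \<subseteq># k"
    using assms unfolding subseteq_mset_def by (metis count_add_mset)
next
  assume "l \<subseteq># k"
  then have "count l i \<le> count k i" by (simp add: subseteq_mset_def)
  then show "i \<in># add_mset i k - l" by (simp add: in_diff_count)
qed

context cring
begin

text \<open>
  The product of \<^const>\<open>mpoly_ring\<close>.  Its laws are proved by induction on the way in which the
  right factor is built from constants and indeterminates, so that only the products with these two
  have to be computed from the convolution sum.
\<close>

definition conv :: "('c multiset \<Rightarrow> 'a) \<Rightarrow> ('c multiset \<Rightarrow> 'a) \<Rightarrow> 'c multiset \<Rightarrow> 'a" where
  "conv p q = (\<lambda>k. \<Oplus>l\<in>{l. l \<subseteq># k}. p l \<otimes> q (k - l))"

lemma conv_coeff: "carrier_coeff p \<Longrightarrow> carrier_coeff q \<Longrightarrow> carrier_coeff (conv p q)"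
  by (auto simp: carrier_coeff_def conv_def intro!: finsum_closed)

lemma conv_const:
  assumes "carrier_coeff p" "c \<in> carrier R"
  shows "conv p (indexed_const c) = (\<lambda>k. p k \<otimes> c)"
proof
  fix k
  have "conv p (indexed_const c) k = (\<Oplus>l\<in>{l. l \<subseteq># k}. if k = l then p l \<otimes> c else \<zero>)"
    unfolding conv_def indexed_const_def
    using assms by (intro finsum_cong') (auto simp: carrier_coeff_def Diff_eq_empty_iff_mset subset_mset.antisym)
  also have "\<dots> = p k \<otimes> c"
    using assms finite_submultisets[of k]
    by (intro add.finprod_singleton) (auto simp: carrier_coeff_def)
  finally show "conv p (indexed_const c) k = p k \<otimes> c" .
qed

lemma conv_padd:
  assumes "carrier_coeff p" "carrier_coeff q" "carrier_coeff r"
  shows "conv p (indexed_padd q r) = indexed_padd (conv p q) (conv p r)"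
proof
  fix k
  have "conv p (indexed_padd q r) k = (\<Oplus>l\<in>{l. l \<subseteq># k}. p l \<otimes> q (k - l) \<oplus> p l \<otimes> r (k - l))"
    unfolding conv_def indexed_padd_def
    using assms by (intro finsum_cong') (auto simp: carrier_coeff_def r_distr)
  also have "\<dots> = indexed_padd (conv p q) (conv p r) k"
    unfolding conv_def indexed_padd_def
    using assms by (intro finsum_addf) (auto simp: carrier_coeff_def)
  finally show "conv p (indexed_padd q r) k = indexed_padd (conv p q) (conv p r) k" .
qed

lemma conv_pmult:
  assumes "carrier_coeff p" "carrier_coeff q"
  shows "conv p (indexed_pmult q i) = indexed_pmult (conv p q) i"
proof
  fix k
  show "conv p (indexed_pmult q i) k = indexed_pmult (conv p q) i k"
  proof (cases "i \<in># k")
    case True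
    then obtain k' where k: "k = add_mset i k'" by (metis insert_DiffM)
    have iff: "i \<in># k - l \<longleftrightarrow> l \<subseteq># k'" if "l \<subseteq># k" for l
      using that unfolding k by (rule mem_add_mset_diff_iff)
    have "conv p (indexed_pmult q i) k = (\<Oplus>l\<in>{l. l \<subseteq># k'}. p l \<otimes> q (k' - l))"
      unfolding conv_def indexed_pmult_def
    proof (rule add.finprod_mono_neutral_cong_right)
      show "{l. l \<subseteq># k'} \<subseteq> {l. l \<subseteq># k}"
        unfolding k by (auto intro: subset_mset.order_trans)
    next
      fix l assume "l \<in> {l. l \<subseteq># k'}"
      then have l: "l \<subseteq># k'" "l \<subseteq># k" unfolding k by (auto intro: subset_mset.order_trans)
      then have "k - l - {#i#} = k' - l" unfolding k by (metis add_mset_remove_trivial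
          diff_right_commute)
      then show "p l \<otimes> (if i \<in># k - l then q (k - l - {#i#}) else \<zero>) = p l \<otimes> q (k' - l)"
        using iff[OF l(2)] l by simp
    qed (use assms iff in \<open>auto simp: carrier_coeff_def finite_submultisets\<close>)
    then show ?thesis unfolding indexed_pmult_def conv_def k by simp
  next
    case False
    have "conv p (indexed_pmult q i) k = (\<Oplus>l\<in>{l. l \<subseteq># k}. \<zero>)"
      unfolding conv_def indexed_pmult_def
      using assms False by (intro finsum_cong') (auto simp: carrier_coeff_def dest: in_diffD)
    then show ?thesis using False by (simp add: indexed_pmult_def)
  qed
qed

lemma conv_comm:
  fixes p q :: "'c multiset \<Rightarrow> 'a"
  assumes "carrier_coeff p" "carrier_coeff q"
  shows "conv p q = conv q p"
proof
  fix k :: "'c multiset"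
  have inj: "inj_on (\<lambda>l. k - l) {l. l \<subseteq># k}"
    by (rule inj_onI) (metis mem_Collect_eq subset_mset.diff_diff_right add.commute add_diff_cancel_left'
        subset_mset.add_diff_inverse)
  have img: "(\<lambda>l. k - l) ` {l. l \<subseteq># k} = {l. l \<subseteq># k}"
  proof (intro subset_antisym subsetI)
    fix l assume "l \<in> {l. l \<subseteq># k}"
    then have "l = k - (k - l)" by (auto simp: multiset_eq_iff subseteq_mset_def)
    then show "l \<in> (\<lambda>l. k - l) ` {l. l \<subseteq># k}" by (rule image_eqI) simp
  qed auto
  have "conv q p k = (\<Oplus>l\<in>(\<lambda>l. k - l) ` {l. l \<subseteq># k}. q l \<otimes> p (k - l))"
    unfolding img by (simp add: conv_def)
  also have "\<dots> = (\<Oplus>l\<in>{l. l \<subseteq># k}. q (k - l) \<otimes> p (k - (k - l)))"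
    using assms by (intro add.finprod_reindex inj) (auto simp: carrier_coeff_def)
  also have "\<dots> = (\<Oplus>l\<in>{l. l \<subseteq># k}. p l \<otimes> q (k - l))"
  proof (rule finsum_cong')
    fix l assume "l \<in> {l. l \<subseteq># k}"
    then have "k - (k - l) = l" by (auto simp: multiset_eq_iff subseteq_mset_def)
    then show "q (k - l) \<otimes> p (k - (k - l)) = p l \<otimes> q (k - l)"
      using assms by (simp add: carrier_coeff_def m_comm)
  qed (use assms in \<open>auto simp: carrier_coeff_def\<close>)
  finally show "conv p q k = conv q p k" by (simp add: conv_def)
qed

abbreviation pset :: "'c set \<Rightarrow> ('c multiset \<Rightarrow> 'a) set" where
  "pset V \<equiv> indexed_pset V (carrier R)"

lemma pset_coeff: "p \<in> pset V \<Longrightarrow> carrier_coeff p"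
  using indexed_pset_in_carrier by blast

lemma conv_closed:
  fixes V :: "'c set"
  assumes "p \<in> pset V" "q \<in> pset V"
  shows "conv p q \<in> pset V"
  using assms(2,1)
proof (induction q rule: indexed_pset.induct)
  case (indexed_const c)
  have "(\<lambda>k. p k \<otimes> c) \<in> pset V"
    using indexed_const(2)
  proof (induction p rule: indexed_pset.induct)
    case (indexed_const d)
    have "(\<lambda>k :: 'c multiset. indexed_const d k \<otimes> c) = indexed_const (d \<otimes> c)"
      using \<open>c \<in> carrier R\<close> by (auto simp: indexed_const_def)
    then show ?case using indexed_const \<open>c \<in> carrier R\<close> by (simp add: indexed_pset.indexed_const)
  next
    case (indexed_padd p q)
    have "(\<lambda>k. indexed_padd p q k \<otimes> c) = indexed_padd (\<lambda>k. p k \<otimes> c) (\<lambda>k. q k \<otimes> c)"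
      using \<open>c \<in> carrier R\<close> pset_coeff[OF indexed_padd(1)] pset_coeff[OF indexed_padd(2)]
      by (auto simp: indexed_padd_def carrier_coeff_def l_distr)
    then show ?case using indexed_padd by (simp add: indexed_pset.indexed_padd)
  next
    case (indexed_pmult p i)
    have "(\<lambda>k. indexed_pmult p i k \<otimes> c) = indexed_pmult (\<lambda>k. p k \<otimes> c) i"
      using \<open>c \<in> carrier R\<close> by (auto simp: indexed_pmult_def)
    then show ?case using indexed_pmult by (simp add: indexed_pset.indexed_pmult)
  qed
  then show ?case using conv_const[OF pset_coeff[OF indexed_const(2)] indexed_const(1)] by simp
next
  case (indexed_padd q r)
  then show ?case
    using conv_padd[of p q r] by (simp add: pset_coeff[of _ V] indexed_pset.indexed_padd)
next
  case (indexed_pmult q i)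
  then show ?case
    using conv_pmult[of p q i] by (simp add: pset_coeff[of _ V] indexed_pset.indexed_pmult)
qed

lemma conv_assoc:
  assumes "p \<in> pset V" "q \<in> pset V" "r \<in> pset V"
  shows "conv (conv p q) r = conv p (conv q r)"
  using assms(3)
proof (induction r rule: indexed_pset.induct)
  case (indexed_const c)
  note coeff = assms(1,2)[THEN pset_coeff] conv_closed[OF assms(1,2), THEN pset_coeff]
  have qc: "carrier_coeff (\<lambda>k. q k \<otimes> c)"
    using indexed_const coeff by (auto simp: carrier_coeff_def)
  have "conv p q k \<otimes> c = conv p (\<lambda>k. q k \<otimes> c) k" for k
  proof -
    have "conv p q k \<otimes> c = (\<Oplus>l\<in>{l. l \<subseteq># k}. p l \<otimes> q (k - l) \<otimes> c)"
      unfolding conv_def using indexed_const coeff finite_submultisets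
      by (intro finsum_ldistr) (auto simp: carrier_coeff_def)
    also have "\<dots> = conv p (\<lambda>k. q k \<otimes> c) k"
      unfolding conv_def using indexed_const coeff
      by (intro finsum_cong') (auto simp: carrier_coeff_def m_assoc)
    finally show ?thesis .
  qed
  then show ?case
    using conv_const[OF coeff(3) indexed_const] conv_const[OF coeff(2) indexed_const] by auto
next
  case (indexed_padd r s)
  note coeff = assms(1,2)[THEN pset_coeff] conv_closed[OF assms(1,2), THEN pset_coeff]
    indexed_padd(1,2)[THEN pset_coeff]
  show ?case
    using indexed_padd coeff by (simp add: conv_padd conv_coeff)
next
  case (indexed_pmult r i)
  note coeff = assms(1,2)[THEN pset_coeff] conv_closed[OF assms(1,2), THEN pset_coeff]
    indexed_pmult(1)[THEN pset_coeff]
  show ?case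
    using indexed_pmult coeff by (simp add: conv_pmult conv_coeff)
qed

lemma mpoly_ring_simps:
  "carrier (mpoly_ring R V) = pset V"
  "p \<otimes>\<^bsub>mpoly_ring R V\<^esub> q = conv p q"
  "\<one>\<^bsub>mpoly_ring R V\<^esub> = indexed_const \<one>"
  "\<zero>\<^bsub>mpoly_ring R V\<^esub> = indexed_const \<zero>"
  "p \<oplus>\<^bsub>mpoly_ring R V\<^esub> q = indexed_padd p q"
  by (simp_all add: mpoly_ring_def conv_def fun_eq_iff)

lemma mpoly_ring_cring: "cring (mpoly_ring R V)"
proof (rule cringI)
  show "abelian_group (mpoly_ring R V)"
  proof (rule abelian_groupI, unfold mpoly_ring_simps)
    fix p assume p: "p \<in> pset V"
    have "conv p (indexed_const (\<ominus> \<one>)) \<in> pset V"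
      by (intro conv_closed p indexed_pset.indexed_const) auto
    moreover have "indexed_padd (conv p (indexed_const (\<ominus> \<one>))) p = indexed_const \<zero>"
      unfolding conv_const[OF pset_coeff[OF p] a_inv_closed[OF one_closed]]
      using pset_coeff[OF p] by (auto simp: indexed_padd_def carrier_coeff_def
          indexed_const_def fun_eq_iff r_minus l_neg)
    ultimately show "\<exists>q\<in>pset V. indexed_padd q p = indexed_const \<zero>" by blast
    show "indexed_padd (indexed_const \<zero>) p = p"
      using indexed_padd_zero[OF pset_coeff[OF p]] by simp
  next
    show "indexed_padd p q \<in> pset V" if "p \<in> pset V" "q \<in> pset V" for p q
      using that by (rule indexed_pset.indexed_padd)
  qed (auto simp: indexed_padd_def carrier_coeff_def fun_eq_iff a_ac dest!: pset_coeff
      intro: indexed_pset.intros)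
  show "comm_monoid (mpoly_ring R V)"
  proof (rule comm_monoidI, unfold mpoly_ring_simps)
    fix p assume p: "p \<in> pset V"
    have "conv (indexed_const \<one>) p = conv p (indexed_const \<one>)"
      by (intro conv_comm pset_coeff[OF p] pset_coeff[of _ V] indexed_pset.indexed_const) auto
    also have "\<dots> = p"
      using pset_coeff[OF p] by (simp add: conv_const carrier_coeff_def)
    finally show "conv (indexed_const \<one>) p = p" .
  qed (auto intro: conv_closed conv_assoc conv_comm pset_coeff indexed_pset.indexed_const)
  fix p q r
  assume "p \<in> carrier (mpoly_ring R V)" "q \<in> carrier (mpoly_ring R V)" "r \<in> carrier (mpoly_ring R V)"
  then have pqr: "carrier_coeff p" "carrier_coeff q" "carrier_coeff r"
    unfolding mpoly_ring_simps by (auto intro: pset_coeff)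
  then show "(p \<oplus>\<^bsub>mpoly_ring R V\<^esub> q) \<otimes>\<^bsub>mpoly_ring R V\<^esub> r =
      p \<otimes>\<^bsub>mpoly_ring R V\<^esub> r \<oplus>\<^bsub>mpoly_ring R V\<^esub> q \<otimes>\<^bsub>mpoly_ring R V\<^esub> r"
    unfolding mpoly_ring_simps
    using conv_padd[of r p q] by (simp add: conv_comm indexed_padd_in_carrier)
qed

lemma const_ring_hom:
  fixes V :: "'c set"
  shows "indexed_const \<in> ring_hom R (mpoly_ring R V)"
proof (rule ring_hom_memI, unfold mpoly_ring_simps)
  fix c d assume cd: "c \<in> carrier R" "d \<in> carrier R"
  then show "indexed_const c \<in> pset V" by (simp add: indexed_pset.indexed_const)
  have "carrier_coeff (indexed_const c :: 'c multiset \<Rightarrow> 'a)"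
    using cd by (simp add: carrier_coeff_def indexed_const_def)
  then show "(indexed_const (c \<otimes> d) :: 'c multiset \<Rightarrow> 'a) = conv (indexed_const c) (indexed_const d)"
    using cd(2) by (auto simp: conv_const) (auto simp: indexed_const_def)
  show "(indexed_const (c \<oplus> d) :: 'c multiset \<Rightarrow> 'a) = indexed_padd (indexed_const c) (indexed_const d)"
    by (simp add: indexed_padd_const)
qed simp

lemma pmult_eq_conv_var:
  assumes "p \<in> pset V"
  shows "indexed_pmult p i = conv p (indexed_var i)"
  using conv_pmult[OF pset_coeff[OF assms], of "indexed_const \<one>" i] conv_const[OF pset_coeff[OF assms], of \<one>]
    pset_coeff[OF assms]
  unfolding indexed_var_def by (auto simp: carrier_coeff_def indexed_const_def)

lemma var_in_pset: "i \<in> V \<Longrightarrow> indexed_var i \<in> pset V"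
  unfolding indexed_var_def by (auto intro: indexed_pset.intros)

text \<open>
  Evaluation at a point is a homomorphism to the coefficient ring.  The induction on the right factor
  again reduces multiplicativity to constants and indeterminates.
\<close>

definition monomial_eval :: "('c \<Rightarrow> 'a) \<Rightarrow> 'c multiset \<Rightarrow> 'a" where
  "monomial_eval \<alpha> k = (\<Otimes>v\<in>set_mset k. \<alpha> v [^] count k v)"

definition poly_eval :: "('c \<Rightarrow> 'a) \<Rightarrow> ('c multiset \<Rightarrow> 'a) \<Rightarrow> 'a" where
  "poly_eval \<alpha> p = (\<Oplus>k\<in>{k. p k \<noteq> \<zero>}. p k \<otimes> monomial_eval \<alpha> k)"

context
  fixes \<alpha> :: "'c \<Rightarrow> 'a"
  assumes \<alpha>: "\<And>v. \<alpha> v \<in> carrier R"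
begin

lemma monomial_eval_closed [simp]: "monomial_eval \<alpha> k \<in> carrier R"
  unfolding monomial_eval_def using \<alpha> by (intro finprod_closed) auto

lemma monomial_eval_add_mset:
  "monomial_eval \<alpha> (add_mset i k) = monomial_eval \<alpha> k \<otimes> \<alpha> i"
proof -
  let ?A = "insert i (set_mset k)"
  have "monomial_eval \<alpha> k = (\<Otimes>v\<in>?A. \<alpha> v [^] count k v)"
    unfolding monomial_eval_def
    using \<alpha> by (intro finprod_mono_neutral_cong_left) (auto simp: not_in_iff)
  moreover have "\<alpha> i = (\<Otimes>v\<in>?A. if i = v then \<alpha> v else \<one>)"
    using \<alpha> by (intro finprod_singleton[symmetric]) auto
  moreover have "(\<Otimes>v\<in>?A. \<alpha> v [^] count k v) \<otimes> (\<Otimes>v\<in>?A. if i = v then \<alpha> v else \<one>)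
      = (\<Otimes>v\<in>?A. \<alpha> v [^] count k v \<otimes> (if i = v then \<alpha> v else \<one>))"
    using \<alpha> by (intro finprod_multf[symmetric]) auto
  moreover have "\<dots> = (\<Otimes>v\<in>?A. \<alpha> v [^] count (add_mset i k) v)"
    using \<alpha> by (intro finprod_cong') auto
  ultimately show ?thesis by (simp add: monomial_eval_def)
qed

lemma poly_eval_superset:
  assumes "carrier_coeff p" "finite A" "{k. p k \<noteq> \<zero>} \<subseteq> A"
  shows "poly_eval \<alpha> p = (\<Oplus>k\<in>A. p k \<otimes> monomial_eval \<alpha> k)"
  unfolding poly_eval_def
  using assms by (intro add.finprod_mono_neutral_cong_left) (auto simp: carrier_coeff_def)

lemma finite_support: "p \<in> pset V \<Longrightarrow> finite {k. p k \<noteq> \<zero>}"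
proof (induction p rule: indexed_pset.induct)
  case (indexed_const c)
  have "{k. indexed_const c k \<noteq> \<zero>} \<subseteq> {{#}}" by (auto simp: indexed_const_def)
  then show ?case by (rule finite_subset) simp
next
  case (indexed_padd p q)
  have "{k. indexed_padd p q k \<noteq> \<zero>} \<subseteq> {k. p k \<noteq> \<zero>} \<union> {k. q k \<noteq> \<zero>}"
    by (auto simp: indexed_padd_def)
  then show ?case using indexed_padd by (meson finite_UnI finite_subset)
next
  case (indexed_pmult p i)
  have "{k. indexed_pmult p i k \<noteq> \<zero>} \<subseteq> add_mset i ` {k. p k \<noteq> \<zero>}"
    by (auto simp: indexed_pmult_def image_iff split: if_splits intro!: exI[of _ "_ - {#i#}"])
  then show ?case using indexed_pmult by (meson finite_imageI finite_subset)
qed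

lemma poly_eval_const:
  assumes "c \<in> carrier R"
  shows "poly_eval \<alpha> (indexed_const c) = c"
proof -
  have "poly_eval \<alpha> (indexed_const c) = (\<Oplus>k\<in>{{#}}. indexed_const c k \<otimes> monomial_eval \<alpha> k)"
    using assms by (intro poly_eval_superset) (auto simp: carrier_coeff_def indexed_const_def)
  also have "\<dots> = c"
    using assms by (simp add: indexed_const_def monomial_eval_def)
  finally show ?thesis .
qed

lemma poly_eval_padd:
  assumes "p \<in> pset V" "q \<in> pset V"
  shows "poly_eval \<alpha> (indexed_padd p q) = poly_eval \<alpha> p \<oplus> poly_eval \<alpha> q"
proof -
  note coeff = assms[THEN pset_coeff]
  let ?A = "{k. p k \<noteq> \<zero>} \<union> {k. q k \<noteq> \<zero>}"
  have A: "finite ?A" using assms[THEN finite_support] by simp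
  have "poly_eval \<alpha> (indexed_padd p q) = (\<Oplus>k\<in>?A. indexed_padd p q k \<otimes> monomial_eval \<alpha> k)"
    using coeff A by (intro poly_eval_superset indexed_padd_in_carrier) (auto simp: indexed_padd_def)
  also have "\<dots> = (\<Oplus>k\<in>?A. p k \<otimes> monomial_eval \<alpha> k \<oplus> q k \<otimes> monomial_eval \<alpha> k)"
    using coeff by (intro finsum_cong') (auto simp: indexed_padd_def carrier_coeff_def l_distr)
  also have "\<dots> = (\<Oplus>k\<in>?A. p k \<otimes> monomial_eval \<alpha> k) \<oplus> (\<Oplus>k\<in>?A. q k \<otimes> monomial_eval \<alpha> k)"
    using coeff by (intro finsum_addf) (auto simp: carrier_coeff_def)
  also have "\<dots> = poly_eval \<alpha> p \<oplus> poly_eval \<alpha> q"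
    using poly_eval_superset[OF coeff(1) A] poly_eval_superset[OF coeff(2) A] by simp
  finally show ?thesis .
qed

lemma poly_eval_pmult:
  assumes "p \<in> pset V"
  shows "poly_eval \<alpha> (indexed_pmult p i) = poly_eval \<alpha> p \<otimes> \<alpha> i"
proof -
  note coeff = assms[THEN pset_coeff]
  let ?A = "{k. p k \<noteq> \<zero>}"
  have A: "finite ?A" using assms by (rule finite_support)
  have "poly_eval \<alpha> (indexed_pmult p i)
      = (\<Oplus>k\<in>add_mset i ` ?A. indexed_pmult p i k \<otimes> monomial_eval \<alpha> k)"
    using coeff A
    by (intro poly_eval_superset indexed_pmult_in_carrier)
      (auto simp: indexed_pmult_def image_iff split: if_splits intro!: exI[of _ "_ - {#i#}"])
  also have "\<dots> = (\<Oplus>k\<in>?A. indexed_pmult p i (add_mset i k) \<otimes> monomial_eval \<alpha> (add_mset i k))"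
    using coeff indexed_pmult_in_carrier[OF coeff]
    by (intro add.finprod_reindex) (auto simp: carrier_coeff_def inj_on_def)
  also have "\<dots> = (\<Oplus>k\<in>?A. p k \<otimes> monomial_eval \<alpha> k \<otimes> \<alpha> i)"
    using coeff \<alpha>
    by (intro finsum_cong') (auto simp: indexed_pmult_def carrier_coeff_def monomial_eval_add_mset m_assoc)
  also have "\<dots> = (\<Oplus>k\<in>?A. p k \<otimes> monomial_eval \<alpha> k) \<otimes> \<alpha> i"
    using coeff \<alpha> A by (intro finsum_ldistr[symmetric]) (auto simp: carrier_coeff_def)
  finally show ?thesis by (simp add: poly_eval_def)
qed

lemma poly_eval_closed:
  assumes "p \<in> pset V"
  shows "poly_eval \<alpha> p \<in> carrier R"
  unfolding poly_eval_def
  using pset_coeff[OF assms] by (intro finsum_closed) (auto simp: carrier_coeff_def)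

lemma poly_eval_conv:
  assumes "p \<in> pset V" "q \<in> pset V"
  shows "poly_eval \<alpha> (conv p q) = poly_eval \<alpha> p \<otimes> poly_eval \<alpha> q"
  using assms(2)
proof (induction q rule: indexed_pset.induct)
  case (indexed_const c)
  note coeff = assms(1)[THEN pset_coeff]
  let ?A = "{k. p k \<noteq> \<zero>}"
  have A: "finite ?A" using assms(1) by (rule finite_support)
  have "poly_eval \<alpha> (conv p (indexed_const c)) = (\<Oplus>k\<in>?A. p k \<otimes> c \<otimes> monomial_eval \<alpha> k)"
    unfolding conv_const[OF coeff indexed_const]
    using indexed_const coeff A by (intro poly_eval_superset) (auto simp: carrier_coeff_def)
  also have "\<dots> = (\<Oplus>k\<in>?A. p k \<otimes> monomial_eval \<alpha> k \<otimes> c)"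
    using coeff indexed_const
    by (intro finsum_cong') (auto simp: carrier_coeff_def m_ac)
  also have "\<dots> = (\<Oplus>k\<in>?A. p k \<otimes> monomial_eval \<alpha> k) \<otimes> c"
    using coeff indexed_const A by (intro finsum_ldistr[symmetric]) (auto simp: carrier_coeff_def)
  finally show ?case unfolding poly_eval_const[OF indexed_const] by (simp add: poly_eval_def)
next
  case (indexed_padd q r)
  note c = indexed_padd(1,2)[THEN conv_closed[OF assms(1)]] indexed_padd(1,2)
  have "poly_eval \<alpha> (conv p (indexed_padd q r)) = poly_eval \<alpha> (conv p q) \<oplus> poly_eval \<alpha> (conv p r)"
    using poly_eval_padd[OF c(1,2)] c assms(1) by (simp add: conv_padd pset_coeff[of _ V])
  then show ?case
    using indexed_padd poly_eval_padd[OF c(3,4)] assms(1) by (simp add: r_distr poly_eval_closed[of _ V])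
next
  case (indexed_pmult q i)
  note c = indexed_pmult(1)[THEN conv_closed[OF assms(1)]] indexed_pmult(1)
  have "poly_eval \<alpha> (conv p (indexed_pmult q i)) = poly_eval \<alpha> (conv p q) \<otimes> \<alpha> i"
    using poly_eval_pmult[OF c(1)] c assms(1) by (simp add: conv_pmult pset_coeff[of _ V])
  then show ?case
    using indexed_pmult poly_eval_pmult[OF c(2)] assms(1) \<alpha>
    by (simp add: m_assoc poly_eval_closed[of _ V])
qed

lemma poly_eval_ring_hom: "poly_eval \<alpha> \<in> ring_hom (mpoly_ring R V) R"
  by (rule ring_hom_memI, unfold mpoly_ring_simps)
    (auto intro: poly_eval_closed poly_eval_conv poly_eval_padd simp: poly_eval_const)

lemma poly_eval_var: "poly_eval \<alpha> (indexed_var i) = \<alpha> i"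
  using poly_eval_pmult[of "indexed_const \<one>" UNIV i] \<alpha>
  by (simp add: indexed_var_def indexed_pset.indexed_const poly_eval_const)

end

end

section \<open>Polynomials that do not vanish at a common point\<close>

locale noetherian_local_ring = local_ring R M + noetherian_ring R for R (structure) and M
begin

lemma M_ideal: "ideal M R" by (rule is_ideal)

lemma one_notin_M: "\<one> \<notin> M"
  using I_notcarr one_imp_carrier by blast

lemma M_prime: "x \<in> carrier R \<Longrightarrow> y \<in> carrier R \<Longrightarrow> x \<otimes> y \<in> M \<Longrightarrow> x \<in> M \<or> y \<in> M"
  using primeideal.I_prime[OF maximalideal_prime[OF is_maximalideal]] .

text \<open>
  A chain of ideals contains its union in a Noetherian ring, so there is a maximal ideal above a
  proper ideal.
\<close>

lemma proper_ideal_le_M: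
  assumes "ideal I R" "\<one> \<notin> I"
  shows "I \<subseteq> M"
proof -
  let ?A = "{J. ideal J R \<and> I \<subseteq> J \<and> \<one> \<notin> J}"
  have "\<exists>J\<in>?A. \<forall>K\<in>?A. J \<subseteq> K \<longrightarrow> K = J"
  proof (rule subset_Zorn_nonempty)
    fix C assume C: "C \<noteq> {}" "subset.chain ?A C"
    then have "subset.chain {J. ideal J R} C"
      by (auto simp: subset.chain_def)
    with C(1) have "\<Union>C \<in> C" by (rule ideal_chain_is_trivial)
    then show "\<Union>C \<in> ?A" using C(2) by (auto simp: subset.chain_def)
  qed (use assms in blast)
  then obtain J where JA: "J \<in> ?A" and max: "\<forall>K\<in>?A. J \<subseteq> K \<longrightarrow> K = J" ..
  from JA have J: "ideal J R" "I \<subseteq> J" "\<one> \<notin> J" by simp_all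
  have "maximalideal J R"
  proof (rule maximalidealI)
    fix K assume K: "ideal K R" "J \<subseteq> K" "K \<subseteq> carrier R"
    show "K = J \<or> K = carrier R"
    proof (cases "\<one> \<in> K")
      case True
      then show ?thesis using ideal.one_imp_carrier[OF K(1)] by simp
    next
      case False
      then have "K \<in> ?A" using K J(2) by auto
      then show ?thesis using max K(2) by blast
    qed
  qed (use J in auto)
  then show ?thesis using maximal_unique J by blast
qed

lemma unit_if_notin_M:
  assumes "x \<in> carrier R" "x \<notin> M"
  obtains y where "y \<in> carrier R" "y \<otimes> x = \<one>"
proof -
  have "\<one> \<in> PIdl x"
    using proper_ideal_le_M[OF cgenideal_ideal[OF assms(1)]] cgenideal_self[OF assms(1)] assms(2)
    by auto
  then show ?thesis using that by (auto simp: cgenideal_def)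
qed

lemma one_minus_notin_M: "t \<in> M \<Longrightarrow> \<one> \<ominus> t \<notin> M"
proof
  assume t: "t \<in> M" "\<one> \<ominus> t \<in> M"
  have "\<one> = (\<one> \<ominus> t) \<oplus> t" using Icarr[OF t(1)] by algebra
  then show False using t one_notin_M a_closed[OF t(2,1)] by simp
qed

text \<open>
  The factor \<open>1 - t\<close> in the general form of Nakayama's lemma is a unit for \<open>t \<in> M\<close>.
\<close>

lemma nakayama_local:
  assumes "ideal Q R" "ideal I R" "I \<subseteq> Q <+> M \<cdot> I"
  shows "I \<subseteq> Q"
proof -
  obtain S where S: "S \<subseteq> carrier R" "finite S" "I = Idl S"
    using finetely_gen[OF assms(2)] by blast
  have "S \<subseteq> Q <+> M \<cdot> (Idl S)"
    using assms(3) genideal_self[OF S(1)] unfolding S(3) by blast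
  from nakayama[OF M_ideal assms(1) S(2,1) this] obtain t
    where t: "t \<in> M" "\<forall>x\<in>I. (\<one> \<ominus> t) \<otimes> x \<in> Q" unfolding S(3) by blast
  have tc: "\<one> \<ominus> t \<in> carrier R" using t Icarr by simp
  obtain y where y: "y \<in> carrier R" "y \<otimes> (\<one> \<ominus> t) = \<one>"
    using unit_if_notin_M[OF tc one_minus_notin_M[OF t(1)]] .
  show ?thesis
  proof
    fix x assume x: "x \<in> I"
    then have xc: "x \<in> carrier R" using ideal.Icarr[OF assms(2)] by blast
    have "x = y \<otimes> ((\<one> \<ominus> t) \<otimes> x)"
      using y xc tc by (simp add: m_assoc[symmetric])
    also have "\<dots> \<in> Q"
      using t x y ideal.I_l_closed[OF assms(1)] by blast
    finally show "x \<in> Q" .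
  qed
qed

lemma residue_field: "field (R Quot M)"
  by (rule quotient_is_field[OF is_cring])

lemma residue_zero_iff:
  assumes "x \<in> carrier R"
  shows "M +> x = \<zero>\<^bsub>R Quot M\<^esub> \<longleftrightarrow> x \<in> M"
  using assms a_rcos_const[of x] a_rcos_self[of x] by (auto simp: FactRing_def)

lemma finitely_many_residue_roots:
  fixes n :: nat
  assumes c: "\<And>k. c k \<in> carrier R" and l: "l \<le> n" "c l \<notin> M"
  shows "finite {M +> z | z. z \<in> carrier R \<and> (\<Oplus>k\<in>{..n}. c k \<otimes> z [^] k) \<in> M}"
proof -
  let ?K = "R Quot M"
  interpret K: field ?K by (rule residue_field)
  interpret h: ring_hom_cring R ?K "(+>) M" by (rule rcos_ring_hom_cring[OF is_cring])
  have kc: "M +> x \<in> carrier ?K" if "x \<in> carrier R" for x using that by (rule h.hom_closed)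
  define ps where "ps = map (\<lambda>k. M +> c k) (rev [0..<Suc n])"
  have ps: "set ps \<subseteq> carrier ?K" unfolding ps_def using c kc by auto
  have eval: "K.eval ps (M +> z) = M +> (\<Oplus>k\<in>{..n}. c k \<otimes> z [^] k)" if z: "z \<in> carrier R" for z
    unfolding ps_def
  proof (induction n)
    case 0
    then show ?case using c z kc[OF z] kc[OF c] by simp
  next
    case (Suc n)
    then show ?case using c z kc[OF z] kc[OF c] by (simp add: Pi_iff)
  qed
  have poly: "K.normalize ps \<in> carrier (poly_ring ?K)"
    using K.normalize_gives_polynomial[OF ps] by (simp add: univ_poly_carrier)
  have "M +> c l \<noteq> \<zero>\<^bsub>?K\<^esub>" using l c residue_zero_iff by blast
  moreover have "K.normalize qs \<noteq> []" if "q \<in> set qs" "q \<noteq> \<zero>\<^bsub>?K\<^esub>" for q qs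
    using that by (induction qs) auto
  moreover have "M +> c l \<in> set ps"
    unfolding ps_def set_map set_rev set_upt using l(1) by (intro imageI) auto
  ultimately have "K.normalize ps \<noteq> []" by blast
  moreover have "K.eval (K.normalize ps) (M +> z) = \<zero>\<^bsub>?K\<^esub>"
    if "z \<in> carrier R" "(\<Oplus>k\<in>{..n}. c k \<otimes> z [^] k) \<in> M" for z
    unfolding K.eval_normalize[OF ps kc[OF that(1)]] eval[OF that(1)]
    using residue_zero_iff[OF Icarr[OF that(2)]] that(2) by blast
  ultimately have "{M +> z | z. z \<in> carrier R \<and> (\<Oplus>k\<in>{..n}. c k \<otimes> z [^] k) \<in> M}
      \<subseteq> {x. K.is_root (K.normalize ps) x}"
    unfolding K.is_root_def using kc by blast
  then show ?thesis
    using K.finite_number_of_roots[OF poly] by (rule finite_subset)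
qed

lemma common_univariate_nonvanishing:
  fixes n n' :: nat
  assumes inf: "infinite (carrier (R Quot M))"
    and c: "\<And>k. c k \<in> carrier R" "l \<le> n" "c l \<notin> M"
    and c': "\<And>k. c' k \<in> carrier R" "l' \<le> n'" "c' l' \<notin> M"
  obtains z where "z \<in> carrier R" "(\<Oplus>k\<in>{..n}. c k \<otimes> z [^] k) \<notin> M"
    "(\<Oplus>k\<in>{..n'}. c' k \<otimes> z [^] k) \<notin> M"
proof -
  let ?B = "{M +> z | z. z \<in> carrier R \<and> (\<Oplus>k\<in>{..n}. c k \<otimes> z [^] k) \<in> M}
    \<union> {M +> z | z. z \<in> carrier R \<and> (\<Oplus>k\<in>{..n'}. c' k \<otimes> z [^] k) \<in> M}"
  have "finite ?B"
    using finitely_many_residue_roots[of c l n] finitely_many_residue_roots[of c' l' n'] c c' by blast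
  then obtain x where "x \<in> carrier (R Quot M)" "x \<notin> ?B"
    using inf by (meson finite_subset subsetI)
  then obtain z where "z \<in> carrier R" "M +> z \<notin> ?B"
    by (auto simp: FactRing_def A_RCOSETS_def')
  then show ?thesis using that by blast
qed

text \<open>
  The polynomial in \<open>v\<close> with coefficients \<open>c 0, \<dots>, c n\<close>, which do not involve \<open>v\<close>.
  Slicing a polynomial in this way permits induction on the set of indeterminates.
\<close>

definition univariate ::
    "'c set \<Rightarrow> 'c \<Rightarrow> nat \<Rightarrow> (nat \<Rightarrow> 'c multiset \<Rightarrow> 'a) \<Rightarrow> 'c multiset \<Rightarrow> 'a" where
  "univariate V v n c = (\<Oplus>\<^bsub>mpoly_ring R (insert v V)\<^esub>k\<in>{..n}. c k \<otimes>\<^bsub>mpoly_ring R (insert v V)\<^esub>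
      indexed_var v [^]\<^bsub>mpoly_ring R (insert v V)\<^esub> k)"

lemma slices:
  fixes V :: "'c set"
  assumes "p \<in> pset (insert v V)"
  shows "\<exists>(n::nat) c. (\<forall>k. c k \<in> pset V) \<and> (\<forall>k>n. c k = indexed_const \<zero>) \<and>
    p = univariate V v n c"
proof -
  let ?A = "mpoly_ring R (insert v V)"
  interpret A: cring ?A by (rule mpoly_ring_cring)
  let ?x = "indexed_var v"
  have sub: "q \<in> carrier ?A" if "q \<in> pset V" for q
    using that by (induction q rule: indexed_pset.induct)
      (auto simp: mpoly_ring_simps intro: indexed_pset.intros)
  have x: "?x \<in> carrier ?A" by (simp add: mpoly_ring_simps var_in_pset)
  have zero: "indexed_const \<zero> \<in> pset V" by (auto intro: indexed_pset.indexed_const)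
  have extend: "(\<Oplus>\<^bsub>?A\<^esub>k\<in>{..N}. c k \<otimes>\<^bsub>?A\<^esub> ?x [^]\<^bsub>?A\<^esub> k) = (\<Oplus>\<^bsub>?A\<^esub>k\<in>{..n}. c k \<otimes>\<^bsub>?A\<^esub> ?x [^]\<^bsub>?A\<^esub> k)"
    if "n \<le> N" "\<forall>k. c k \<in> pset V" "\<forall>k>n. c k = indexed_const \<zero>" for n N :: nat and c
  proof (rule A.add.finprod_mono_neutral_cong_right)
    fix k assume "k \<in> {..N} - {..n}"
    then have "c k = \<zero>\<^bsub>?A\<^esub>" using that by (simp add: mpoly_ring_simps)
    then show "c k \<otimes>\<^bsub>?A\<^esub> ?x [^]\<^bsub>?A\<^esub> k = \<zero>\<^bsub>?A\<^esub>" using x by simp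
  qed (use that x sub in auto)
  show ?thesis
    using assms
  proof (induction p rule: indexed_pset.induct)
    case (indexed_const d)
    have d: "indexed_const d \<in> pset V" using indexed_const by (rule indexed_pset.indexed_const)
    define e :: "nat \<Rightarrow> 'c multiset \<Rightarrow> 'a" where "e k = (if k = 0 then indexed_const d else indexed_const \<zero>)" for k :: nat
    have "(\<Oplus>\<^bsub>?A\<^esub>k\<in>{..0::nat}. e k \<otimes>\<^bsub>?A\<^esub> ?x [^]\<^bsub>?A\<^esub> k) = indexed_const d"
      using sub[OF d] x by (simp add: e_def)
    then have "indexed_const d = univariate V v 0 e" by (simp add: univariate_def)
    moreover have "\<forall>k. e k \<in> pset V" "\<forall>k>0. e k = indexed_const \<zero>"
      using d zero by (simp_all add: e_def)
    ultimately show ?case by blast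
  next
    case (indexed_padd p q)
    obtain n c where c: "\<forall>k. c k \<in> pset V" "\<forall>k>n. c k = indexed_const \<zero>"
        "p = univariate V v n c"
      using indexed_padd(3) by blast
    obtain n' c' where c': "\<forall>k. c' k \<in> pset V" "\<forall>k>n'. c' k = indexed_const \<zero>"
        "q = univariate V v n' c'"
      using indexed_padd(4) by blast
    let ?N = "max n n'"
    have "indexed_padd p q = p \<oplus>\<^bsub>?A\<^esub> q" by (simp add: mpoly_ring_simps)
    also have "\<dots> = (\<Oplus>\<^bsub>?A\<^esub>k\<in>{..?N}. c k \<otimes>\<^bsub>?A\<^esub> ?x [^]\<^bsub>?A\<^esub> k)
        \<oplus>\<^bsub>?A\<^esub> (\<Oplus>\<^bsub>?A\<^esub>k\<in>{..?N}. c' k \<otimes>\<^bsub>?A\<^esub> ?x [^]\<^bsub>?A\<^esub> k)"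
      unfolding c(3) c'(3) univariate_def using extend[of n ?N c] extend[of n' ?N c'] c c' by simp
    also have "\<dots> = (\<Oplus>\<^bsub>?A\<^esub>k\<in>{..?N}. c k \<otimes>\<^bsub>?A\<^esub> ?x [^]\<^bsub>?A\<^esub> k \<oplus>\<^bsub>?A\<^esub> c' k \<otimes>\<^bsub>?A\<^esub> ?x [^]\<^bsub>?A\<^esub> k)"
      using x sub c(1) c'(1) by (intro A.finsum_addf[symmetric]) auto
    also have "\<dots> = (\<Oplus>\<^bsub>?A\<^esub>k\<in>{..?N}. (c k \<oplus>\<^bsub>?A\<^esub> c' k) \<otimes>\<^bsub>?A\<^esub> ?x [^]\<^bsub>?A\<^esub> k)"
      using x sub c(1) c'(1) by (intro A.finsum_cong') (auto simp: A.l_distr)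
    finally have "indexed_padd p q = univariate V v ?N (\<lambda>k. indexed_padd (c k) (c' k))"
      by (simp add: univariate_def mpoly_ring_simps)
    moreover have "\<forall>k. indexed_padd (c k) (c' k) \<in> pset V"
      using c c' by (simp add: indexed_pset.indexed_padd)
    moreover have "\<forall>k>?N. indexed_padd (c k) (c' k) = indexed_const \<zero>"
      using c c' by (simp add: indexed_padd_const)
    ultimately show ?case
      by (intro exI[of _ ?N] exI[of _ "\<lambda>k. indexed_padd (c k) (c' k)"] conjI)
  next
    case (indexed_pmult p i)
    obtain n c where c: "\<forall>k. c k \<in> pset V" "\<forall>k>n. c k = indexed_const \<zero>"
        "p = univariate V v n c"
      using indexed_pmult(3) by blast
    let ?y = "indexed_var i"
    have y: "?y \<in> carrier ?A" using indexed_pmult(2) by (simp add: mpoly_ring_simps var_in_pset)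
    have "indexed_pmult p i = p \<otimes>\<^bsub>?A\<^esub> ?y"
      using pmult_eq_conv_var[OF indexed_pmult(1)] by (simp add: mpoly_ring_simps)
    also have "\<dots> = (\<Oplus>\<^bsub>?A\<^esub>k\<in>{..n}. c k \<otimes>\<^bsub>?A\<^esub> ?x [^]\<^bsub>?A\<^esub> k \<otimes>\<^bsub>?A\<^esub> ?y)"
      unfolding c(3) univariate_def using x y sub c(1) by (intro A.finsum_ldistr) auto
    finally have eq: "indexed_pmult p i = \<dots>" .
    show ?case
    proof (cases "i \<in> V")
      case True
      have "c k \<otimes>\<^bsub>?A\<^esub> ?x [^]\<^bsub>?A\<^esub> k \<otimes>\<^bsub>?A\<^esub> ?y = indexed_pmult (c k) i \<otimes>\<^bsub>?A\<^esub> ?x [^]\<^bsub>?A\<^esub> k" for k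
      proof -
        have "indexed_pmult (c k) i = c k \<otimes>\<^bsub>?A\<^esub> ?y"
          using pmult_eq_conv_var[of "c k" V i] c(1) by (simp add: mpoly_ring_simps)
        then show ?thesis using x y sub c(1) by (simp add: A.m_ac)
      qed
      with eq have "indexed_pmult p i
          = univariate V v n (\<lambda>k. indexed_pmult (c k) i)"
        by (simp add: univariate_def)
      moreover have "\<forall>k. indexed_pmult (c k) i \<in> pset V"
        using c True by (simp add: indexed_pset.indexed_pmult)
      moreover have "\<forall>k>n. indexed_pmult (c k) i = indexed_const \<zero>"
        using c by simp
      ultimately show ?thesis
        by (intro exI[of _ n] exI[of _ "\<lambda>k. indexed_pmult (c k) i"] conjI)
    next
      case False
      then have i: "i = v" using indexed_pmult by simp
      define c' where "c' k = (case k of 0 \<Rightarrow> indexed_const \<zero> | Suc k \<Rightarrow> c k)" for k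
      have c': "\<forall>k. c' k \<in> pset V" "\<forall>k>Suc n. c' k = indexed_const \<zero>"
        using c zero by (auto simp: c'_def split: nat.splits)
      have "(\<Oplus>\<^bsub>?A\<^esub>k\<in>{..Suc n}. c' k \<otimes>\<^bsub>?A\<^esub> ?x [^]\<^bsub>?A\<^esub> k)
          = (\<Oplus>\<^bsub>?A\<^esub>k\<in>{..n}. c' (Suc k) \<otimes>\<^bsub>?A\<^esub> ?x [^]\<^bsub>?A\<^esub> Suc k) \<oplus>\<^bsub>?A\<^esub> c' 0 \<otimes>\<^bsub>?A\<^esub> ?x [^]\<^bsub>?A\<^esub> (0::nat)"
        using c' x sub by (intro A.finsum_Suc2) auto
      also have "c' 0 \<otimes>\<^bsub>?A\<^esub> ?x [^]\<^bsub>?A\<^esub> (0::nat) = \<zero>\<^bsub>?A\<^esub>"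
        using sub[OF zero] by (simp add: c'_def mpoly_ring_simps(4)[symmetric])
      also have "(\<Oplus>\<^bsub>?A\<^esub>k\<in>{..n}. c' (Suc k) \<otimes>\<^bsub>?A\<^esub> ?x [^]\<^bsub>?A\<^esub> Suc k)
          = (\<Oplus>\<^bsub>?A\<^esub>k\<in>{..n}. c k \<otimes>\<^bsub>?A\<^esub> ?x [^]\<^bsub>?A\<^esub> k \<otimes>\<^bsub>?A\<^esub> ?y)"
        unfolding i using x sub c(1) by (intro A.finsum_cong') (auto simp: c'_def A.m_assoc)
      also have "\<dots> = indexed_pmult p i" by (rule eq[symmetric])
      finally have "indexed_pmult p i = univariate V v (Suc n) c'"
        unfolding univariate_def using sub[OF c'(1)[rule_format]] indexed_pset.indexed_pmult[OF indexed_pmult(1,2)]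
        by (simp add: mpoly_ring_simps(1)[symmetric])
      then show ?thesis using c' by blast
    qed
  qed
qed

abbreviation extended_M :: "'c set \<Rightarrow> ('c multiset \<Rightarrow> 'a) set" where
  "extended_M V \<equiv> Idl\<^bsub>mpoly_ring R V\<^esub> (indexed_const ` M)"

lemma const_M_subset: "indexed_const ` M \<subseteq> carrier (mpoly_ring R V)"
  using Icarr ring_hom_closed[OF const_ring_hom] by blast

text \<open>
  The indeterminates are specialized one at a time.  A polynomial outside of \<open>M[u]\<close> has a slice
  outside of \<open>M[u]\<close>, and by induction two such slices take values outside of \<open>M\<close> at a common
  point.  The remaining indeterminate then has to avoid the finitely many residue classes of the
  roots of two polynomials.
\<close>

lemma common_nonvanishing:
  assumes inf: "infinite (carrier (R Quot M))"
    and "finite V"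
    and "p \<in> pset V" "p \<notin> extended_M V" "q \<in> pset V" "q \<notin> extended_M V"
  shows "\<exists>\<alpha>. (\<forall>v. \<alpha> v \<in> carrier R) \<and> poly_eval \<alpha> p \<notin> M \<and> poly_eval \<alpha> q \<notin> M"
  using assms(2-)
proof (induction V arbitrary: p q rule: finite_induct)
  case empty
  interpret A: cring "mpoly_ring R ({} :: 'c set)" by (rule mpoly_ring_cring)
  have *: "poly_eval (\<lambda>_. \<one>) p \<notin> M" if "p \<in> pset {}" "p \<notin> extended_M {}" for p :: "'c multiset \<Rightarrow> 'a"
  proof -
    have "\<exists>c\<in>carrier R. p = indexed_const c"
      using that(1)
    proof (induction p rule: indexed_pset.induct)
      case (indexed_padd p q)
      then show ?case by (auto simp: indexed_padd_const)
    qed auto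
    then obtain c where c: "c \<in> carrier R" "p = indexed_const c" by blast
    then have "c \<notin> M" using that(2) A.genideal_self[OF const_M_subset] by blast
    then show ?thesis using c by (simp add: poly_eval_const)
  qed
  show ?case using *[of p] *[of q] empty by (intro exI[of _ "\<lambda>_. \<one>"]) auto
next
  case (insert v V)
  let ?A = "mpoly_ring R (insert v V)"
  interpret A: cring ?A by (rule mpoly_ring_cring)
  interpret B: cring "mpoly_ring R V" by (rule mpoly_ring_cring)
  interpret J: ideal "extended_M (insert v V)" ?A
    by (rule A.genideal_ideal[OF const_M_subset])
  have sub: "q \<in> pset (insert v V)" if "q \<in> pset V" for q
    using that by (induction q rule: indexed_pset.induct) (auto intro: indexed_pset.intros)
  have subJ: "extended_M V \<subseteq> extended_M (insert v V)"
  proof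
    fix q assume "q \<in> extended_M V"
    with const_M_subset show "q \<in> extended_M (insert v V)"
    proof (induction rule: B.Idl_induct)
      case zero
      show ?case using J.zero_closed by (simp add: mpoly_ring_simps)
    next
      case (gen r y)
      then show ?case
        using J.I_l_closed[of y r] A.genideal_self[OF const_M_subset] sub[of r]
        by (auto simp: mpoly_ring_simps)
    next
      case (add y z)
      then show ?case using J.a_closed[of y z] by (simp add: mpoly_ring_simps)
    qed
  qed
  define val where "val n c \<alpha> = (\<Oplus>k\<in>{..n::nat}. poly_eval \<alpha> (c k) \<otimes> \<alpha> v [^] k)"
    for n and c :: "nat \<Rightarrow> 'c multiset \<Rightarrow> 'a" and \<alpha> :: "'c \<Rightarrow> 'a"
  have slice: "\<exists>n c l. (\<forall>k. c k \<in> pset V) \<and> l \<le> n \<and> c l \<notin> extended_M V \<and>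
      (\<forall>\<alpha>. (\<forall>u. \<alpha> u \<in> carrier R) \<longrightarrow>
        poly_eval \<alpha> p = val n c \<alpha>)"
    if p: "p \<in> pset (insert v V)" "p \<notin> extended_M (insert v V)" for p
  proof -
    obtain n c where c: "\<forall>k. c k \<in> pset V"
      "p = univariate V v n c"
      using slices[OF p(1)] by blast
    have cA: "c k \<in> carrier ?A" for k using c(1) sub by (simp add: mpoly_ring_simps)
    have x: "indexed_var v \<in> carrier ?A" by (simp add: mpoly_ring_simps var_in_pset)
    have "\<exists>l\<le>n. c l \<notin> extended_M V"
    proof (rule ccontr)
      assume "\<not> ?thesis"
      then have "c k \<in> extended_M (insert v V)" if "k \<le> n" for k using that subJ by blast
      then have "p \<in> extended_M (insert v V)"
        unfolding c(2) univariate_def using x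
        by (intro A.finsum_mem_ideal[OF J.is_ideal] J.I_r_closed) auto
      then show False using p by blast
    qed
    moreover have "poly_eval \<alpha> p = val n c \<alpha>"
      if \<alpha>: "\<forall>u. \<alpha> u \<in> carrier R" for \<alpha>
    proof -
      interpret h: ring_hom_cring ?A R "poly_eval \<alpha>"
        using \<alpha> by (intro ring_hom_cring.intro ring_hom_cring_axioms.intro poly_eval_ring_hom
            mpoly_ring_cring is_cring) auto
      note hom_pow = ring_hom_ring.hom_nat_pow[OF ring_hom_ringI2[OF A.ring_axioms ring_axioms h.homh]]
      have "poly_eval \<alpha> p = (\<Oplus>k\<in>{..n}. poly_eval \<alpha> (c k \<otimes>\<^bsub>?A\<^esub> indexed_var v [^]\<^bsub>?A\<^esub> k))"
        unfolding c(2) univariate_def using cA x by (subst h.hom_finsum) (auto simp: o_def)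
      also have "\<dots> = (\<Oplus>k\<in>{..n}. poly_eval \<alpha> (c k) \<otimes> \<alpha> v [^] k)"
        using cA x \<alpha> h.hom_closed poly_eval_var[of \<alpha> v]
        by (intro finsum_cong') (auto simp: hom_pow)
      finally show ?thesis by (simp add: val_def)
    qed
    ultimately show ?thesis using c(1) by blast
  qed
  obtain n c l n' c' l' where
    c: "\<forall>k. c k \<in> pset V" "l \<le> n" "c l \<notin> extended_M V"
    and p: "\<And>\<alpha>. (\<forall>u. \<alpha> u \<in> carrier R) \<Longrightarrow>
        poly_eval \<alpha> p = val n c \<alpha>"
    and c': "\<forall>k. c' k \<in> pset V" "l' \<le> n'" "c' l' \<notin> extended_M V"
    and q: "\<And>\<alpha>. (\<forall>u. \<alpha> u \<in> carrier R) \<Longrightarrow>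
        poly_eval \<alpha> q = val n' c' \<alpha>"
    using slice[OF insert.prems(1,2)] slice[OF insert.prems(3,4)] by metis
  obtain \<alpha> where \<alpha>: "\<forall>u. \<alpha> u \<in> carrier R" "poly_eval \<alpha> (c l) \<notin> M" "poly_eval \<alpha> (c' l') \<notin> M"
    using insert.IH[of "c l" "c' l'"] c c' by blast
  have ev: "poly_eval \<beta> (c k) \<in> carrier R" "poly_eval \<beta> (c' k) \<in> carrier R"
    if "\<forall>u. \<beta> u \<in> carrier R" for k \<beta>
    using poly_eval_closed[of \<beta> "c k" V] poly_eval_closed[of \<beta> "c' k" V] c c' that by auto
  have aux: "poly_eval (\<alpha>(v := z)) r = poly_eval \<alpha> r" if "r \<in> pset V" "z \<in> carrier R" for r z
    using that(1)
  proof (induction r rule: indexed_pset.induct)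
    case (indexed_const d)
    then show ?case using \<alpha> that(2) by (simp add: poly_eval_const)
  next
    case (indexed_padd r s)
    then show ?case using \<alpha> that(2) by (simp add: poly_eval_padd)
  next
    case (indexed_pmult r i)
    then have "i \<noteq> v" using insert by auto
    then show ?case using indexed_pmult \<alpha> that(2) by (simp add: poly_eval_pmult)
  qed
  obtain z where z: "z \<in> carrier R" "(\<Oplus>k\<in>{..n}. poly_eval \<alpha> (c k) \<otimes> z [^] k) \<notin> M"
    "(\<Oplus>k\<in>{..n'}. poly_eval \<alpha> (c' k) \<otimes> z [^] k) \<notin> M"
    by (rule common_univariate_nonvanishing[OF inf, of "\<lambda>k. poly_eval \<alpha> (c k)" l n
          "\<lambda>k. poly_eval \<alpha> (c' k)" l' n'])
      (use ev[OF \<alpha>(1)] c(2) c'(2) \<alpha>(2,3) in auto)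
  have z': "\<forall>u. (\<alpha>(v := z)) u \<in> carrier R" using z \<alpha> by auto
  have "poly_eval (\<alpha>(v := z)) p \<notin> M"
    unfolding p[OF z'] val_def using z(1,2) c(1) by (simp add: aux del: fun_upd_apply add: fun_upd_same)
  moreover have "poly_eval (\<alpha>(v := z)) q \<notin> M"
    unfolding q[OF z'] val_def using z(1,3) c'(1) by (simp add: aux del: fun_upd_apply add: fun_upd_same)
  ultimately show ?case using z' by blast
qed

lemma poly_eval_extended_M:
  assumes "\<And>v. \<alpha> v \<in> carrier R" "p \<in> extended_M V"
  shows "poly_eval \<alpha> p \<in> M"
proof -
  interpret A: cring "mpoly_ring R V" by (rule mpoly_ring_cring)
  interpret h: ring_hom_cring "mpoly_ring R V" R "poly_eval \<alpha>"
    using assms by (intro ring_hom_cring.intro ring_hom_cring_axioms.intro poly_eval_ring_hom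
        mpoly_ring_cring is_cring) auto
  interpret J: ideal "extended_M V" "mpoly_ring R V"
    by (rule A.genideal_ideal[OF const_M_subset])
  from const_M_subset assms(2) show ?thesis
  proof (induction rule: A.Idl_induct)
    case zero
    show ?case by simp
  next
    case (gen r y)
    then obtain x where "x \<in> M" "y = indexed_const x" by blast
    then show ?case using gen(1) assms(1) Icarr
      by (simp add: poly_eval_const I_l_closed mpoly_ring_simps(1)
          ring_hom_closed[OF const_ring_hom, unfolded mpoly_ring_simps(1)])
  next
    case (add y z)
    then show ?case using J.Icarr by simp
  qed
qed

text \<open>
  The common point of nonvanishing makes \<open>M[u]\<close> prime, without any ordering of the monomials.
\<close>

lemma extended_M_prime:
  assumes "infinite (carrier (R Quot M))" "finite V"
    and "p \<in> pset V" "p \<notin> extended_M V" "q \<in> pset V" "q \<notin> extended_M V"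
  shows "conv p q \<notin> extended_M V"
proof
  assume *: "conv p q \<in> extended_M V"
  obtain \<alpha> where \<alpha>: "\<forall>v. \<alpha> v \<in> carrier R" "poly_eval \<alpha> p \<notin> M" "poly_eval \<alpha> q \<notin> M"
    using common_nonvanishing[OF assms] by blast
  have "poly_eval \<alpha> (conv p q) \<in> M" using poly_eval_extended_M[OF _ *] \<alpha> by blast
  moreover have "poly_eval \<alpha> (conv p q) = poly_eval \<alpha> p \<otimes> poly_eval \<alpha> q"
    using poly_eval_conv[of \<alpha> p V q] \<alpha> assms by blast
  ultimately show False
    using M_prime[of "poly_eval \<alpha> p" "poly_eval \<alpha> q"] poly_eval_closed[of \<alpha>] \<alpha> assms by metis
qed

end

section \<open>Localization\<close>

locale multiplicative_subset = cring R for R (structure) +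
  fixes S :: "'a set"
  assumes S_carrier: "S \<subseteq> carrier R"
    and one_S: "\<one> \<in> S"
    and mult_S: "s \<in> S \<Longrightarrow> t \<in> S \<Longrightarrow> s \<otimes> t \<in> S"
begin

lemma S_mem [simp]: "s \<in> S \<Longrightarrow> s \<in> carrier R"
  using S_carrier by blast

text \<open>
  A fraction is the class of all of its representations.  As the witnesses \<open>t\<close> multiply, the
  relation between representations is transitive.
\<close>

lemma fraction_eqI:
  assumes "r \<in> carrier R" "s \<in> S" "r' \<in> carrier R" "s' \<in> S" "t \<in> S"
    and eq: "t \<otimes> (s' \<otimes> r) = t \<otimes> (s \<otimes> r')"
  shows "fraction R S r s = fraction R S r' s'"
proof -
  have sub: "fraction R S r s \<subseteq> fraction R S r' s'"
    if "r \<in> carrier R" "s \<in> S" "r' \<in> carrier R" "s' \<in> S" "t \<in> S" "t \<otimes> (s' \<otimes> r) = t \<otimes> (s \<otimes> r')"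
    for r s r' s' t
  proof
    fix z assume "z \<in> fraction R S r s"
    then obtain p q u where z: "z = (p, q)" "p \<in> carrier R" "q \<in> S" "u \<in> S"
      "u \<otimes> (q \<otimes> r) = u \<otimes> (s \<otimes> p)" by (auto simp: fraction_def)
    note c = that(1,3) z(2) that(2,4,5)[THEN S_mem] z(3,4)[THEN S_mem]
    have "(t \<otimes> u \<otimes> s) \<otimes> (q \<otimes> r') = (u \<otimes> q) \<otimes> (t \<otimes> (s \<otimes> r'))"
      using c by (simp add: m_ac)
    also have "\<dots> = (u \<otimes> q) \<otimes> (t \<otimes> (s' \<otimes> r))"
      using that(6) by simp
    also have "\<dots> = (t \<otimes> s') \<otimes> (u \<otimes> (q \<otimes> r))"
      using c by (simp add: m_ac)
    also have "\<dots> = (t \<otimes> s') \<otimes> (u \<otimes> (s \<otimes> p))"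
      using z(5) by simp
    also have "\<dots> = (t \<otimes> u \<otimes> s) \<otimes> (s' \<otimes> p)"
      using c by (simp add: m_ac)
    finally show "z \<in> fraction R S r' s'"
      using that z mult_S by (auto simp: fraction_def)
  qed
  show ?thesis
    using sub[OF assms] sub[OF assms(3,4,1,2,5) eq[symmetric]] by blast
qed

lemma fraction_self: "r \<in> carrier R \<Longrightarrow> s \<in> S \<Longrightarrow> (r, s) \<in> fraction R S r s"
  using one_S by (auto simp: fraction_def)

lemma fraction_eqD:
  assumes "fraction R S r s = fraction R S r' s'" "r \<in> carrier R" "s \<in> S"
  shows "\<exists>t\<in>S. t \<otimes> (s \<otimes> r') = t \<otimes> (s' \<otimes> r)"
  using fraction_self[OF assms(2,3)] unfolding assms(1) by (auto simp: fraction_def)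

abbreviation Loc where "Loc \<equiv> localization R S"

lemma Loc_carrier: "carrier Loc = {fraction R S r s | r s. r \<in> carrier R \<and> s \<in> S}"
  by (simp add: localization_def)

lemma Loc_cases:
  assumes "z \<in> carrier Loc"
  obtains r s where "r \<in> carrier R" "s \<in> S" "z = fraction R S r s"
  using assms by (auto simp: Loc_carrier)

lemma fraction_closed [simp]: "r \<in> carrier R \<Longrightarrow> s \<in> S \<Longrightarrow> fraction R S r s \<in> carrier Loc"
  by (auto simp: Loc_carrier)

lemma Loc_one: "\<one>\<^bsub>Loc\<^esub> = fraction R S \<one> \<one>"
  and Loc_zero: "\<zero>\<^bsub>Loc\<^esub> = fraction R S \<zero> \<one>"
  by (simp_all add: localization_def)

text \<open>
  The operations of \<^const>\<open>localization\<close> are unions over all representations of the operands.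
  They collapse to one member, since all members are equal.
\<close>

lemma UN_constant_fractions:
  assumes "r \<in> carrier R" "s \<in> S" "r' \<in> carrier R" "s' \<in> S"
    and "\<And>p q p' q'. (p, q) \<in> fraction R S r s \<Longrightarrow> (p', q') \<in> fraction R S r' s' \<Longrightarrow>
      f p q p' q' = f r s r' s'"
  shows "(\<Union>(p, q)\<in>fraction R S r s. \<Union>(p', q')\<in>fraction R S r' s'. f p q p' q') = f r s r' s'"
proof
  show "f r s r' s' \<subseteq> (\<Union>(p, q)\<in>fraction R S r s. \<Union>(p', q')\<in>fraction R S r' s'. f p q p' q')"
    using fraction_self[OF assms(1,2)] fraction_self[OF assms(3,4)] by fast
  show "(\<Union>(p, q)\<in>fraction R S r s. \<Union>(p', q')\<in>fraction R S r' s'. f p q p' q') \<subseteq> f r s r' s'"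
    using assms(5) by fast
qed

lemma fraction_mult:
  assumes "r \<in> carrier R" "s \<in> S" "r' \<in> carrier R" "s' \<in> S"
  shows "fraction R S r s \<otimes>\<^bsub>Loc\<^esub> fraction R S r' s' = fraction R S (r \<otimes> r') (s \<otimes> s')"
proof -
  have "fraction R S (p \<otimes> p') (q \<otimes> q') = fraction R S (r \<otimes> r') (s \<otimes> s')"
    if pq: "(p, q) \<in> fraction R S r s" "(p', q') \<in> fraction R S r' s'" for p q p' q'
  proof -
    obtain t where t: "t \<in> S" "t \<otimes> (q \<otimes> r) = t \<otimes> (s \<otimes> p)" "p \<in> carrier R" "q \<in> S"
      using pq(1) by (auto simp: fraction_def)
    obtain u where u: "u \<in> S" "u \<otimes> (q' \<otimes> r') = u \<otimes> (s' \<otimes> p')" "p' \<in> carrier R" "q' \<in> S"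
      using pq(2) by (auto simp: fraction_def)
    have "(t \<otimes> u) \<otimes> ((s \<otimes> s') \<otimes> (p \<otimes> p')) = (t \<otimes> (s \<otimes> p)) \<otimes> (u \<otimes> (s' \<otimes> p'))"
      using assms t(1,3,4) u(1,3,4) by (simp add: m_ac)
    also have "\<dots> = (t \<otimes> (q \<otimes> r)) \<otimes> (u \<otimes> (q' \<otimes> r'))"
      using t(2) u(2) by simp
    also have "\<dots> = (t \<otimes> u) \<otimes> ((q \<otimes> q') \<otimes> (r \<otimes> r'))"
      using assms t(1,3,4) u(1,3,4) by (simp add: m_ac)
    finally show ?thesis
      using assms t(1,3,4) u(1,3,4) by (intro fraction_eqI[of _ _ _ _ "t \<otimes> u"] mult_S) auto
  qed
  from UN_constant_fractions[OF assms, of "\<lambda>p q p' q'. fraction R S (p \<otimes> p') (q \<otimes> q')", OF this]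
  show ?thesis by (simp add: localization_def)
qed

lemma fraction_add:
  assumes "r \<in> carrier R" "s \<in> S" "r' \<in> carrier R" "s' \<in> S"
  shows "fraction R S r s \<oplus>\<^bsub>Loc\<^esub> fraction R S r' s'
    = fraction R S (s' \<otimes> r \<oplus> s \<otimes> r') (s \<otimes> s')"
proof -
  have "fraction R S (q' \<otimes> p \<oplus> q \<otimes> p') (q \<otimes> q') = fraction R S (s' \<otimes> r \<oplus> s \<otimes> r') (s \<otimes> s')"
    if pq: "(p, q) \<in> fraction R S r s" "(p', q') \<in> fraction R S r' s'" for p q p' q'
  proof -
    obtain t where t: "t \<in> S" "t \<otimes> (q \<otimes> r) = t \<otimes> (s \<otimes> p)" "p \<in> carrier R" "q \<in> S"
      using pq(1) by (auto simp: fraction_def)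
    obtain u where u: "u \<in> S" "u \<otimes> (q' \<otimes> r') = u \<otimes> (s' \<otimes> p')" "p' \<in> carrier R" "q' \<in> S"
      using pq(2) by (auto simp: fraction_def)
    note c = assms(1,3) t(3) u(3) assms(2,4)[THEN S_mem] t(1,4)[THEN S_mem] u(1,4)[THEN S_mem]
    have "(t \<otimes> u) \<otimes> ((s \<otimes> s') \<otimes> (q' \<otimes> p \<oplus> q \<otimes> p'))
        = (u \<otimes> s' \<otimes> q') \<otimes> (t \<otimes> (s \<otimes> p)) \<oplus> (t \<otimes> s \<otimes> q) \<otimes> (u \<otimes> (s' \<otimes> p'))"
      using c by algebra
    also have "\<dots> = (u \<otimes> s' \<otimes> q') \<otimes> (t \<otimes> (q \<otimes> r)) \<oplus> (t \<otimes> s \<otimes> q) \<otimes> (u \<otimes> (q' \<otimes> r'))"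
      using t(2) u(2) by simp
    also have "\<dots> = (t \<otimes> u) \<otimes> ((q \<otimes> q') \<otimes> (s' \<otimes> r \<oplus> s \<otimes> r'))"
      using c by algebra
    finally show ?thesis
      using assms t(1,3,4) u(1,3,4) by (intro fraction_eqI[of _ _ _ _ "t \<otimes> u"] mult_S) auto
  qed
  from UN_constant_fractions[OF assms,
      of "\<lambda>p q p' q'. fraction R S (q' \<otimes> p \<oplus> q \<otimes> p') (q \<otimes> q')", OF this]
  show ?thesis by (simp add: localization_def)
qed

lemma fraction_eqI':
  assumes "r \<in> carrier R" "s \<in> S" "r' \<in> carrier R" "s' \<in> S" "s' \<otimes> r = s \<otimes> r'"
  shows "fraction R S r s = fraction R S r' s'"
  using assms one_S by (intro fraction_eqI[of _ _ _ _ \<one>]) auto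

lemma Loc_cring: "cring Loc"
proof (rule cringI)
  show "abelian_group Loc"
  proof (rule abelian_groupI)
    fix x y z assume "x \<in> carrier Loc" "y \<in> carrier Loc" "z \<in> carrier Loc"
    then obtain r s r' s' r'' s'' where
      *: "r \<in> carrier R" "s \<in> S" "x = fraction R S r s" "r' \<in> carrier R" "s' \<in> S" "y = fraction R S r' s'"
        "r'' \<in> carrier R" "s'' \<in> S" "z = fraction R S r'' s''"
      by (metis Loc_cases)
    note c = *(1,4,7) *(2,5,8)[THEN S_mem]
    have "s'' \<otimes> (s' \<otimes> r \<oplus> s \<otimes> r') \<oplus> (s \<otimes> s') \<otimes> r''
        = (s' \<otimes> s'') \<otimes> r \<oplus> s \<otimes> (s'' \<otimes> r' \<oplus> s' \<otimes> r'')" "(s \<otimes> s') \<otimes> s'' = s \<otimes> (s' \<otimes> s'')"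
      using c by algebra+
    then show "x \<oplus>\<^bsub>Loc\<^esub> y \<oplus>\<^bsub>Loc\<^esub> z = x \<oplus>\<^bsub>Loc\<^esub> (y \<oplus>\<^bsub>Loc\<^esub> z)"
      using * by (simp add: fraction_add mult_S)
  next
    fix x y assume "x \<in> carrier Loc" "y \<in> carrier Loc"
    then obtain r s r' s' where
      *: "r \<in> carrier R" "s \<in> S" "x = fraction R S r s" "r' \<in> carrier R" "s' \<in> S" "y = fraction R S r' s'"
      by (metis Loc_cases)
    then show "x \<oplus>\<^bsub>Loc\<^esub> y \<in> carrier Loc" by (simp add: fraction_add mult_S)
    show "x \<oplus>\<^bsub>Loc\<^esub> y = y \<oplus>\<^bsub>Loc\<^esub> x"
      using * by (simp add: fraction_add m_comm[of s s'] a_comm)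
  next
    show "\<zero>\<^bsub>Loc\<^esub> \<in> carrier Loc" using one_S by (simp add: Loc_zero)
  next
    fix x assume "x \<in> carrier Loc"
    then obtain r s where *: "r \<in> carrier R" "s \<in> S" "x = fraction R S r s"
      by (metis Loc_cases)
    then show "\<zero>\<^bsub>Loc\<^esub> \<oplus>\<^bsub>Loc\<^esub> x = x" using one_S by (simp add: Loc_zero fraction_add)
    have "fraction R S (\<ominus> r) s \<oplus>\<^bsub>Loc\<^esub> x = \<zero>\<^bsub>Loc\<^esub>"
    proof -
      have "fraction R S (\<ominus> r) s \<oplus>\<^bsub>Loc\<^esub> x = fraction R S \<zero> (s \<otimes> s)"
        using * by (simp add: fraction_add r_minus l_neg)
      also have "\<dots> = \<zero>\<^bsub>Loc\<^esub>"
        unfolding Loc_zero using * one_S mult_S by (intro fraction_eqI') auto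
      finally show ?thesis .
    qed
    then show "\<exists>y\<in>carrier Loc. y \<oplus>\<^bsub>Loc\<^esub> x = \<zero>\<^bsub>Loc\<^esub>"
      using * by (intro bexI[of _ "fraction R S (\<ominus> r) s"]) auto
  qed
  show "comm_monoid Loc"
  proof (rule comm_monoidI)
    fix x y z assume "x \<in> carrier Loc" "y \<in> carrier Loc" "z \<in> carrier Loc"
    then obtain r s r' s' r'' s'' where
      "r \<in> carrier R" "s \<in> S" "x = fraction R S r s" "r' \<in> carrier R" "s' \<in> S" "y = fraction R S r' s'"
        "r'' \<in> carrier R" "s'' \<in> S" "z = fraction R S r'' s''"
      by (metis Loc_cases)
    then show "x \<otimes>\<^bsub>Loc\<^esub> y \<otimes>\<^bsub>Loc\<^esub> z = x \<otimes>\<^bsub>Loc\<^esub> (y \<otimes>\<^bsub>Loc\<^esub> z)"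
      by (simp add: fraction_mult mult_S m_assoc)
  next
    fix x y assume "x \<in> carrier Loc" "y \<in> carrier Loc"
    then obtain r s r' s' where
      *: "r \<in> carrier R" "s \<in> S" "x = fraction R S r s" "r' \<in> carrier R" "s' \<in> S" "y = fraction R S r' s'"
      by (metis Loc_cases)
    then show "x \<otimes>\<^bsub>Loc\<^esub> y \<in> carrier Loc" by (simp add: fraction_mult mult_S)
    show "x \<otimes>\<^bsub>Loc\<^esub> y = y \<otimes>\<^bsub>Loc\<^esub> x"
      using * by (simp add: fraction_mult m_comm[of s s'] m_comm[of r r'])
  next
    show "\<one>\<^bsub>Loc\<^esub> \<in> carrier Loc" using one_S by (simp add: Loc_one)
  next
    fix x assume "x \<in> carrier Loc"
    then obtain r s where *: "r \<in> carrier R" "s \<in> S" "x = fraction R S r s"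
      by (metis Loc_cases)
    then show "\<one>\<^bsub>Loc\<^esub> \<otimes>\<^bsub>Loc\<^esub> x = x" using one_S by (simp add: Loc_one fraction_mult)
  qed
  fix x y z assume "x \<in> carrier Loc" "y \<in> carrier Loc" "z \<in> carrier Loc"
  then obtain r s r' s' r'' s'' where
    *: "r \<in> carrier R" "s \<in> S" "x = fraction R S r s" "r' \<in> carrier R" "s' \<in> S" "y = fraction R S r' s'"
      "r'' \<in> carrier R" "s'' \<in> S" "z = fraction R S r'' s''"
    by (metis Loc_cases)
  note c = *(1,4,7) *(2,5,8)[THEN S_mem]
  have "((s \<otimes> s'') \<otimes> (s' \<otimes> s'')) \<otimes> ((s' \<otimes> r \<oplus> s \<otimes> r') \<otimes> r'')
      = ((s \<otimes> s') \<otimes> s'') \<otimes> ((s' \<otimes> s'') \<otimes> (r \<otimes> r'') \<oplus> (s \<otimes> s'') \<otimes> (r' \<otimes> r''))"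
    using c by algebra
  then have "fraction R S ((s' \<otimes> r \<oplus> s \<otimes> r') \<otimes> r'') ((s \<otimes> s') \<otimes> s'')
      = fraction R S ((s' \<otimes> s'') \<otimes> (r \<otimes> r'') \<oplus> (s \<otimes> s'') \<otimes> (r' \<otimes> r'')) ((s \<otimes> s'') \<otimes> (s' \<otimes> s''))"
    using * by (intro fraction_eqI') (auto intro: mult_S)
  then show "(x \<oplus>\<^bsub>Loc\<^esub> y) \<otimes>\<^bsub>Loc\<^esub> z = x \<otimes>\<^bsub>Loc\<^esub> z \<oplus>\<^bsub>Loc\<^esub> y \<otimes>\<^bsub>Loc\<^esub> z"
    using * by (simp add: fraction_add fraction_mult mult_S)
qed

abbreviation to_loc where "to_loc r \<equiv> fraction R S r \<one>"

lemma to_loc_closed: "r \<in> carrier R \<Longrightarrow> to_loc r \<in> carrier Loc"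
  using one_S by simp

lemma to_loc_mult:
  "r \<in> carrier R \<Longrightarrow> r' \<in> carrier R \<Longrightarrow> to_loc (r \<otimes> r') = to_loc r \<otimes>\<^bsub>Loc\<^esub> to_loc r'"
  using one_S by (simp add: fraction_mult)

lemma to_loc_add:
  "r \<in> carrier R \<Longrightarrow> r' \<in> carrier R \<Longrightarrow> to_loc (r \<oplus> r') = to_loc r \<oplus>\<^bsub>Loc\<^esub> to_loc r'"
  using one_S by (simp add: fraction_add)

lemma fraction_eq_mult_to_loc:
  "r \<in> carrier R \<Longrightarrow> s \<in> S \<Longrightarrow> fraction R S r s = fraction R S \<one> s \<otimes>\<^bsub>Loc\<^esub> to_loc r"
  using one_S by (simp add: fraction_mult)

text \<open>
  The fractions with numerator in the ideal form an ideal, which contains the extended ideal.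
\<close>

lemma to_loc_mem_Idl_iff:
  assumes Y: "Y \<subseteq> carrier R" and x: "x \<in> carrier R"
  shows "to_loc x \<in> Idl\<^bsub>Loc\<^esub> (to_loc ` Y) \<longleftrightarrow> (\<exists>s\<in>S. s \<otimes> x \<in> Idl Y)"
proof
  interpret L: cring Loc by (rule Loc_cring)
  interpret I: ideal "Idl Y" R using genideal_ideal[OF Y] .
  have lY: "to_loc ` Y \<subseteq> carrier Loc" using Y to_loc_closed by blast
  interpret J: ideal "Idl\<^bsub>Loc\<^esub> (to_loc ` Y)" Loc using L.genideal_ideal[OF lY] .
  {
    assume "to_loc x \<in> Idl\<^bsub>Loc\<^esub> (to_loc ` Y)"
    with lY have "\<exists>r\<in>Idl Y. \<exists>s\<in>S. to_loc x = fraction R S r s"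
    proof (induction rule: L.Idl_induct)
      case zero
      then show ?case using one_S I.zero_closed by (auto simp: Loc_zero)
    next
      case (gen z w)
      then obtain y where y: "y \<in> Y" "w = to_loc y" by blast
      obtain r s where rs: "r \<in> carrier R" "s \<in> S" "z = fraction R S r s"
        using gen(1) by (rule Loc_cases)
      then have "z \<otimes>\<^bsub>Loc\<^esub> w = fraction R S (r \<otimes> y) s"
        using y Y one_S by (simp add: fraction_mult subsetD)
      moreover have "r \<otimes> y \<in> Idl Y"
        using rs y genideal_self[OF Y] by (auto intro: I.I_l_closed)
      ultimately show ?case using rs by blast
    next
      case (add z w)
      then obtain r s r' s' where *: "r \<in> Idl Y" "s \<in> S" "z = fraction R S r s"
        "r' \<in> Idl Y" "s' \<in> S" "w = fraction R S r' s'" by blast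
      then have "z \<oplus>\<^bsub>Loc\<^esub> w = fraction R S (s' \<otimes> r \<oplus> s \<otimes> r') (s \<otimes> s')"
        using I.Icarr by (simp add: fraction_add)
      moreover have "s' \<otimes> r \<oplus> s \<otimes> r' \<in> Idl Y"
        using I.a_closed[OF I.I_l_closed[OF *(1), of s'] I.I_l_closed[OF *(4), of s]] *(2,5) by simp
      ultimately show ?case using * mult_S by blast
    qed
    then obtain r s where rs: "r \<in> Idl Y" "s \<in> S" "to_loc x = fraction R S r s" by blast
    then obtain t where t: "t \<in> S" "t \<otimes> (\<one> \<otimes> r) = t \<otimes> (s \<otimes> x)"
      using fraction_eqD[OF rs(3) x one_S] by blast
    then have "(t \<otimes> s) \<otimes> x = t \<otimes> r"
      using rs I.Icarr[OF rs(1)] x by (simp add: m_assoc)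
    then show "\<exists>s\<in>S. s \<otimes> x \<in> Idl Y"
      using I.I_l_closed[OF rs(1), of t] t(1) rs(2) mult_S[OF t(1) rs(2)] by (metis S_mem)
  next
    assume "\<exists>s\<in>S. s \<otimes> x \<in> Idl Y"
    then obtain s where s: "s \<in> S" "s \<otimes> x \<in> Idl Y" by blast
    have *: "to_loc y \<in> Idl\<^bsub>Loc\<^esub> (to_loc ` Y)" if "y \<in> Idl Y" for y
      using Y that
    proof (induction rule: Idl_induct)
      case zero
      then show ?case using J.zero_closed by (simp add: Loc_zero)
    next
      case (gen r y)
      then show ?case
        using L.genideal_self[OF lY] Y J.I_l_closed[of "to_loc y" "to_loc r"] to_loc_closed[of r]
        by (auto simp: to_loc_mult subsetD)
    next
      case (add y z)
      then show ?case using I.Icarr J.a_closed by (simp add: to_loc_add)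
    qed
    have "to_loc x = fraction R S (s \<otimes> x) s"
      using s x one_S by (intro fraction_eqI') auto
    also have "\<dots> = fraction R S \<one> s \<otimes>\<^bsub>Loc\<^esub> to_loc (s \<otimes> x)"
      using s x by (intro fraction_eq_mult_to_loc) auto
    also have "\<dots> \<in> Idl\<^bsub>Loc\<^esub> (to_loc ` Y)"
      using *[OF s(2)] s by (intro J.I_l_closed) auto
    finally show "to_loc x \<in> Idl\<^bsub>Loc\<^esub> (to_loc ` Y)" .
  }
qed

lemma Idl_to_loc_subset_iff:
  assumes Y: "Y \<subseteq> carrier R" and X: "T \<subseteq> carrier R" "finite T"
  shows "Idl\<^bsub>Loc\<^esub> (to_loc ` T) \<subseteq> Idl\<^bsub>Loc\<^esub> (to_loc ` Y) \<longleftrightarrow> (\<exists>s\<in>S. \<forall>x\<in>T. s \<otimes> x \<in> Idl Y)"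
proof -
  interpret L: cring Loc by (rule Loc_cring)
  interpret I: ideal "Idl Y" R using genideal_ideal[OF Y] .
  have c: "to_loc ` Y \<subseteq> carrier Loc" "to_loc ` T \<subseteq> carrier Loc"
    using Y X to_loc_closed by blast+
  have "Idl\<^bsub>Loc\<^esub> (to_loc ` T) \<subseteq> Idl\<^bsub>Loc\<^esub> (to_loc ` Y) \<longleftrightarrow> to_loc ` T \<subseteq> Idl\<^bsub>Loc\<^esub> (to_loc ` Y)"
    using L.Idl_mono[OF c(1)] L.genideal_self[OF c(2)] by blast
  also have "\<dots> \<longleftrightarrow> (\<forall>x\<in>T. \<exists>s\<in>S. s \<otimes> x \<in> Idl Y)"
    using to_loc_mem_Idl_iff[OF Y] X by blast
  also have "\<dots> \<longleftrightarrow> (\<exists>s\<in>S. \<forall>x\<in>T. s \<otimes> x \<in> Idl Y)"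
  proof
    assume "\<forall>x\<in>T. \<exists>s\<in>S. s \<otimes> x \<in> Idl Y"
    with X(2,1) show "\<exists>s\<in>S. \<forall>x\<in>T. s \<otimes> x \<in> Idl Y"
    proof (induction T rule: finite_induct)
      case empty
      then show ?case using one_S by blast
    next
      case (insert x T)
      then obtain s t where st: "s \<in> S" "\<forall>x\<in>T. s \<otimes> x \<in> Idl Y" "t \<in> S" "t \<otimes> x \<in> Idl Y"
        by auto
      have "(s \<otimes> t) \<otimes> y \<in> Idl Y" if "y \<in> insert x T" for y
      proof (cases "y = x")
        case True
        then have "(s \<otimes> t) \<otimes> y = s \<otimes> (t \<otimes> x)" using st insert by (simp add: m_assoc)
        then show ?thesis using st by (auto intro: I.I_l_closed)
      next
        case False
        then have y: "y \<in> T" "y \<in> carrier R" using that insert by auto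
        then have "(s \<otimes> t) \<otimes> y = t \<otimes> (s \<otimes> y)" using st by (simp add: m_ac)
        then show ?thesis using st y by (auto intro: I.I_l_closed)
      qed
      then show ?case using st mult_S by blast
    qed
  qed blast
  finally show ?thesis .
qed

end

section \<open>Generic combinations of the generators and their specializations\<close>

lemma ring_hom_vimage_ideal:
  assumes "h \<in> ring_hom R S" "cring R" "cring S" "ideal J S"
  shows "ideal {x \<in> carrier R. h x \<in> J} R"
proof -
  interpret R: cring R by fact
  interpret S: cring S by fact
  show ?thesis
    using ring_hom_ring.ideal_vimage[OF ring_hom_ringI2[OF R.ring_axioms S.ring_axioms assms(1)] assms(4)] .
qed

lemma ring_hom_Idl_image_subset:
  assumes "h \<in> ring_hom R S" "cring R" "cring S" "ideal J S" "Y \<subseteq> carrier R"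
    and "h ` Y \<subseteq> J"
  shows "h ` (Idl\<^bsub>R\<^esub> Y) \<subseteq> J"
proof -
  have "Idl\<^bsub>R\<^esub> Y \<subseteq> {x \<in> carrier R. h x \<in> J}"
    by (rule ring.genideal_minimal[OF cring.axioms(1)[OF assms(2)] ring_hom_vimage_ideal[OF assms(1-4)]])
      (use assms(5,6) in blast)
  then show ?thesis by blast
qed

lemma ring_hom_Idl_image:
  assumes "h \<in> ring_hom R S" "cring R" "cring S" "Y \<subseteq> carrier R"
  shows "Idl\<^bsub>S\<^esub> (h ` (Idl\<^bsub>R\<^esub> Y)) = Idl\<^bsub>S\<^esub> (h ` Y)"
proof
  interpret R: cring R by fact
  interpret S: cring S by fact
  have hY: "h ` Y \<subseteq> carrier S" using assms(4) by (auto intro!: ring_hom_closed[OF assms(1)])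
  have "h ` (Idl\<^bsub>R\<^esub> Y) \<subseteq> Idl\<^bsub>S\<^esub> (h ` Y)"
    by (rule ring_hom_Idl_image_subset[OF assms(1-3) S.genideal_ideal[OF hY] assms(4)
          S.genideal_self[OF hY]])
  then show "Idl\<^bsub>S\<^esub> (h ` (Idl\<^bsub>R\<^esub> Y)) \<subseteq> Idl\<^bsub>S\<^esub> (h ` Y)"
    by (rule S.Idl_mono[OF hY])
  have hI: "h ` (Idl\<^bsub>R\<^esub> Y) \<subseteq> carrier S"
    using ideal.Icarr[OF R.genideal_ideal[OF assms(4)]]
    by (auto intro!: ring_hom_closed[OF assms(1)])
  show "Idl\<^bsub>S\<^esub> (h ` Y) \<subseteq> Idl\<^bsub>S\<^esub> (h ` (Idl\<^bsub>R\<^esub> Y))"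
    using R.genideal_self[OF assms(4)] by (intro S.subset_Idl_subset[OF hI]) blast
qed

lemma (in cring) finsum_diff_mem_ideal:
  assumes "ideal I R" "f \<in> A \<rightarrow> carrier R" "g \<in> A \<rightarrow> carrier R"
    and "\<And>i. i \<in> A \<Longrightarrow> f i \<ominus> g i \<in> I"
  shows "(\<Oplus>i\<in>A. f i) \<ominus> (\<Oplus>i\<in>A. g i) \<in> I"
proof -
  have "(\<Oplus>i\<in>A. f i) = (\<Oplus>i\<in>A. (f i \<ominus> g i) \<oplus> g i)"
  proof (rule finsum_cong')
    fix i assume "i \<in> A"
    then have "f i \<in> carrier R" "g i \<in> carrier R" using assms by auto
    then show "f i = f i \<ominus> g i \<oplus> g i" by algebra
  qed (use assms in auto)
  also have "\<dots> = (\<Oplus>i\<in>A. f i \<ominus> g i) \<oplus> (\<Oplus>i\<in>A. g i)"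
    using assms by (intro finsum_addf) auto
  finally have eq: "(\<Oplus>i\<in>A. f i) = (\<Oplus>i\<in>A. f i \<ominus> g i) \<oplus> (\<Oplus>i\<in>A. g i)" .
  have "(\<Oplus>i\<in>A. f i \<ominus> g i) \<in> carrier R" "(\<Oplus>i\<in>A. g i) \<in> carrier R"
    using assms by (auto intro!: finsum_closed)
  then have "(\<Oplus>i\<in>A. f i) \<ominus> (\<Oplus>i\<in>A. g i) = (\<Oplus>i\<in>A. f i \<ominus> g i)"
    unfolding eq by (simp add: a_minus_def a_assoc r_neg)
  then show ?thesis using finsum_mem_ideal[OF assms(1,4)] by simp
qed

context noetherian_local_ring
begin

text \<open>
  The value of the \<open>i\<close>-th generic combination of \<open>w 1, \<dots>, w m\<close> at the point \<open>\<alpha>\<close>.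
\<close>

definition specialize :: "nat \<Rightarrow> (nat \<Rightarrow> 'a) \<Rightarrow> (nat \<times> nat \<Rightarrow> 'a) \<Rightarrow> nat \<Rightarrow> 'a" where
  "specialize m w \<alpha> i = (\<Oplus>j\<in>{1..m}. \<alpha> (i, j) \<otimes> w j)"

lemma generic_poly_ring_eq: "generic_poly_ring R d m = mpoly_ring R ({1..d} \<times> {1..m})"
  by (simp add: generic_poly_ring_def)

lemma generic_poly_ring_cring: "cring (generic_poly_ring R d m)"
  unfolding generic_poly_ring_eq by (rule mpoly_ring_cring)

lemma generic_const_hom: "indexed_const \<in> ring_hom R (generic_poly_ring R d m)"
  unfolding generic_poly_ring_eq by (rule const_ring_hom)

lemma generic_const_closed: "x \<in> carrier R \<Longrightarrow> indexed_const x \<in> carrier (generic_poly_ring R d m)"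
  using ring_hom_closed[OF generic_const_hom] .

lemma generic_var_closed: "i \<in> {1..d} \<Longrightarrow> j \<in> {1..m} \<Longrightarrow> indexed_var (i, j) \<in> carrier (generic_poly_ring R d m)"
  unfolding generic_poly_ring_eq mpoly_ring_simps by (rule var_in_pset) auto

lemma poly_eval_hom:
  assumes "\<And>v. \<alpha> v \<in> carrier R"
  shows "ring_hom_cring (generic_poly_ring R d m) R (poly_eval \<alpha>)"
  using poly_eval_ring_hom[OF assms] generic_poly_ring_cring is_cring
  by (intro ring_hom_cring.intro ring_hom_cring_axioms.intro) (auto simp: generic_poly_ring_eq)

text \<open>
  A reduction equation modulo \<open>J\<close>, with \<open>K\<close> in the role of a power of the ideal, becomes
  membership in this ideal when the coefficients of the combinations are generic.
\<close>

definition generic_span ::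
    "nat \<Rightarrow> nat \<Rightarrow> (nat \<Rightarrow> 'a) \<Rightarrow> 'a set \<Rightarrow> 'a set \<Rightarrow> ((nat \<times> nat) multiset \<Rightarrow> 'a) set" where
  "generic_span d m w J K = Idl\<^bsub>generic_poly_ring R d m\<^esub> (indexed_const ` J \<union>
     (\<lambda>(i, y). generic_combination R d m w i \<otimes>\<^bsub>generic_poly_ring R d m\<^esub> indexed_const y) ` ({1..d} \<times> K))"

context
  fixes d m :: nat and w :: "nat \<Rightarrow> 'a"
  assumes w: "\<And>j. j \<in> {1..m} \<Longrightarrow> w j \<in> carrier R"
begin

abbreviation polys where "polys \<equiv> generic_poly_ring R d m"

abbreviation (input) comb where "comb \<equiv> generic_combination R d m w"

interpretation A: cring polys by (rule generic_poly_ring_cring)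

lemma generic_combination_closed: "i \<in> {1..d} \<Longrightarrow> comb i \<in> carrier polys"
  unfolding generic_combination_def using generic_const_closed w generic_var_closed by (intro A.finsum_closed) auto

lemma specialize_closed: "(\<And>v. \<alpha> v \<in> carrier R) \<Longrightarrow> specialize m w \<alpha> i \<in> carrier R"
  unfolding specialize_def using w by (intro finsum_closed) auto

lemma poly_eval_generic_combination:
  assumes \<alpha>: "\<And>v. \<alpha> v \<in> carrier R" and i: "i \<in> {1..d}"
  shows "poly_eval \<alpha> (comb i) = specialize m w \<alpha> i"
proof -
  interpret h: ring_hom_cring polys R "poly_eval \<alpha>" by (rule poly_eval_hom[OF \<alpha>])
  have "poly_eval \<alpha> (comb i) = (\<Oplus>j\<in>{1..m}. poly_eval \<alpha> (indexed_var (i, j) \<otimes>\<^bsub>polys\<^esub> indexed_const (w j)))"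
    unfolding generic_combination_def
    using i w generic_const_closed generic_var_closed by (subst h.hom_finsum) (auto simp: o_def)
  also have "\<dots> = specialize m w \<alpha> i"
    unfolding specialize_def
    using i w generic_const_closed generic_var_closed \<alpha>
    by (intro finsum_cong') (auto simp: poly_eval_var poly_eval_const)
  finally show ?thesis .
qed

lemma generic_span_gens:
  assumes "J \<subseteq> carrier R" "K \<subseteq> carrier R"
  shows "indexed_const ` J \<union> (\<lambda>(i, y). comb i \<otimes>\<^bsub>polys\<^esub> indexed_const y) ` ({1..d} \<times> K) \<subseteq> carrier polys"
  using assms generic_const_closed generic_combination_closed by (auto simp: subset_iff)

text \<open>
  A generic combination differs from its value at \<open>\<alpha>\<close> by a combination whose coefficients
  vanish at \<open>\<alpha>\<close>.  So Nakayama's lemma applies to the ideal of all polynomials vanishing at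
  \<open>\<alpha>\<close>, and the polynomial \<open>s\<close> is its factor \<open>1 - t\<close>.
\<close>

lemma generic_span_if_specialization:
  assumes \<alpha>: "\<And>v. \<alpha> v \<in> carrier R"
    and "ideal J R" "ideal K R" "ideal T R"
    and T: "T \<subseteq> J <+> (Idl (specialize m w \<alpha> ` {1..d})) \<cdot> K"
    and wK: "\<And>j y. j \<in> {1..m} \<Longrightarrow> y \<in> K \<Longrightarrow> w j \<otimes> y \<in> T"
  shows "\<exists>s\<in>carrier polys. poly_eval \<alpha> s = \<one> \<and> (\<forall>x\<in>T. s \<otimes>\<^bsub>polys\<^esub> indexed_const x \<in> generic_span d m w J K)"
proof -
  interpret J: ideal J R by fact
  interpret K: ideal K R by fact
  interpret T: ideal T R by fact
  interpret h: ring_hom_cring polys R "poly_eval \<alpha>" by (rule poly_eval_hom[OF \<alpha>])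
  interpret c: ring_hom_cring R polys indexed_const
    using generic_poly_ring_cring is_cring generic_const_hom by (intro ring_hom_cring.intro ring_hom_cring_axioms.intro) auto
  have Jc: "J \<subseteq> carrier R" and Kc: "K \<subseteq> carrier R" using J.Icarr K.Icarr by auto
  interpret Q: ideal "generic_span d m w J K" polys
    unfolding generic_span_def by (rule A.genideal_ideal[OF generic_span_gens[OF Jc Kc]])
  define N where "N = {p \<in> carrier polys. poly_eval \<alpha> p \<in> {\<zero>}}"
  have N: "ideal N polys"
    unfolding N_def using ring_hom_vimage_ideal[OF h.homh generic_poly_ring_cring is_cring zeroideal] .
  obtain S where S: "S \<subseteq> carrier R" "finite S" "T = Idl S"
    using finetely_gen[OF T.is_ideal] by blast
  have cS: "indexed_const ` S \<subseteq> carrier polys" using S(1) generic_const_closed by blast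
  let ?I = "Idl\<^bsub>polys\<^esub> (indexed_const ` S)"
  interpret I: ideal ?I polys by (rule A.genideal_ideal[OF cS])
  have cT: "indexed_const x \<in> ?I" if "x \<in> T" for x
    using ring_hom_Idl_image_subset[OF generic_const_hom is_cring generic_poly_ring_cring I.is_ideal S(1)]
      A.genideal_self[OF cS] that S(3) by blast
  interpret NI: ideal "N \<cdot>\<^bsub>polys\<^esub> ?I" polys by (rule A.ideal_prod_is_ideal[OF N I.is_ideal])
  let ?G = "generic_span d m w J K <+>\<^bsub>polys\<^esub> N \<cdot>\<^bsub>polys\<^esub> ?I"
  interpret G: ideal ?G polys by (rule A.add_ideals[OF Q.is_ideal NI.is_ideal])
  have up: "generic_span d m w J K \<subseteq> ?G" "N \<cdot>\<^bsub>polys\<^esub> ?I \<subseteq> ?G"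
    using A.ideal_sum_upper[OF Q.is_ideal NI.is_ideal] by auto
  define PG where "PG = {x \<in> carrier R. indexed_const x \<in> ?G}"
  have PG: "ideal PG R"
    unfolding PG_def by (rule ring_hom_vimage_ideal[OF generic_const_hom is_cring generic_poly_ring_cring G.is_ideal])
  have gens: "indexed_const ` J \<union> (\<lambda>(i, y). comb i \<otimes>\<^bsub>polys\<^esub> indexed_const y) ` ({1..d} \<times> K)
      \<subseteq> generic_span d m w J K"
    using A.genideal_self[OF generic_span_gens[OF Jc Kc]] unfolding generic_span_def .
  have gens2: "comb i \<otimes>\<^bsub>polys\<^esub> indexed_const y \<in> generic_span d m w J K" if "i \<in> {1..d}" "y \<in> K" for i y
    by (rule subsetD[OF gens], rule UnI2, rule image_eqI[of _ _ "(i, y)"]) (use that in simp_all)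
  have diff_add: "p = q \<oplus>\<^bsub>polys\<^esub> (p \<ominus>\<^bsub>polys\<^esub> q)" if "p \<in> carrier polys" "q \<in> carrier polys" for p q
    using that by algebra
  have "J \<subseteq> PG" using gens up(1) Jc unfolding PG_def by blast
  moreover have "(Idl (specialize m w \<alpha> ` {1..d})) \<cdot> K \<subseteq> PG"
  proof (rule ideal_prod_subset[OF PG])
    fix x y assume x: "x \<in> Idl (specialize m w \<alpha> ` {1..d})" and y: "y \<in> K"
    have sc: "specialize m w \<alpha> ` {1..d} \<subseteq> carrier R" using specialize_closed[OF \<alpha>] by auto
    have yc: "y \<in> carrier R" using y K.Icarr by auto
    have "y \<otimes> x \<in> PG"
    proof (rule mult_Idl_mem[OF PG sc yc _ x])
      fix z assume "z \<in> specialize m w \<alpha> ` {1..d}"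
      then obtain i where i: "i \<in> {1..d}" "z = specialize m w \<alpha> i" by blast
      let ?f = "\<lambda>j. indexed_const (\<alpha> (i, j)) \<otimes>\<^bsub>polys\<^esub> indexed_const (w j \<otimes> y)"
      let ?g = "\<lambda>j. indexed_var (i, j) \<otimes>\<^bsub>polys\<^esub> indexed_const (w j \<otimes> y)"
      have fc: "?f \<in> {1..m} \<rightarrow> carrier polys" "?g \<in> {1..m} \<rightarrow> carrier polys"
        using generic_const_closed \<alpha> w yc generic_var_closed i by auto
      have diff: "(\<Oplus>\<^bsub>polys\<^esub>j\<in>{1..m}. ?f j) \<ominus>\<^bsub>polys\<^esub> (\<Oplus>\<^bsub>polys\<^esub>j\<in>{1..m}. ?g j) \<in> N \<cdot>\<^bsub>polys\<^esub> ?I"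
      proof (rule A.finsum_diff_mem_ideal[OF NI.is_ideal fc])
        fix j assume j: "j \<in> {1..m}"
        have c: "indexed_const (\<alpha> (i, j)) \<in> carrier polys" "indexed_var (i, j) \<in> carrier polys"
          "indexed_const (w j \<otimes> y) \<in> carrier polys"
          using generic_const_closed \<alpha> w yc generic_var_closed i j by auto
        have "poly_eval \<alpha> (indexed_const (\<alpha> (i, j)) \<ominus>\<^bsub>polys\<^esub> indexed_var (i, j)) = \<zero>"
          unfolding a_minus_def h.hom_add[OF c(1) A.a_inv_closed[OF c(2)]] h.hom_a_inv[OF c(2)]
            poly_eval_const[OF \<alpha> \<alpha>] poly_eval_var[OF \<alpha>] by (rule r_neg[OF \<alpha>])
        then have "indexed_const (\<alpha> (i, j)) \<ominus>\<^bsub>polys\<^esub> indexed_var (i, j) \<in> N"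
          using A.minus_closed[OF c(1,2)] by (simp only: N_def mem_Collect_eq singleton_iff simp_thms)
        then have "(indexed_const (\<alpha> (i, j)) \<ominus>\<^bsub>polys\<^esub> indexed_var (i, j)) \<otimes>\<^bsub>polys\<^esub> indexed_const (w j \<otimes> y)
            \<in> N \<cdot>\<^bsub>polys\<^esub> ?I"
          using cT[OF wK[OF j y]] by (rule ideal_prod.prod)
        moreover have "(indexed_const (\<alpha> (i, j)) \<ominus>\<^bsub>polys\<^esub> indexed_var (i, j)) \<otimes>\<^bsub>polys\<^esub> indexed_const (w j \<otimes> y)
            = ?f j \<ominus>\<^bsub>polys\<^esub> ?g j"
          using c by algebra
        ultimately show "?f j \<ominus>\<^bsub>polys\<^esub> ?g j \<in> N \<cdot>\<^bsub>polys\<^esub> ?I" by simp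
      qed
      have f: "(\<Oplus>\<^bsub>polys\<^esub>j\<in>{1..m}. ?f j) = indexed_const (y \<otimes> z)"
      proof -
        have "y \<otimes> z = (\<Oplus>j\<in>{1..m}. y \<otimes> (\<alpha> (i, j) \<otimes> w j))"
          unfolding i(2) specialize_def using \<alpha> w yc by (intro finsum_rdistr) auto
        also have "\<dots> = (\<Oplus>j\<in>{1..m}. \<alpha> (i, j) \<otimes> (w j \<otimes> y))"
          using \<alpha> w yc by (intro finsum_cong') (auto simp: m_ac)
        finally have "indexed_const (y \<otimes> z)
            = (\<Oplus>\<^bsub>polys\<^esub>j\<in>{1..m}. (indexed_const \<circ> (\<lambda>j. \<alpha> (i, j) \<otimes> (w j \<otimes> y))) j)"
          using \<alpha> w yc by (simp add: c.hom_finsum Pi_def comp_def)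
        also have "\<dots> = (\<Oplus>\<^bsub>polys\<^esub>j\<in>{1..m}. ?f j)"
          using \<alpha> w yc fc by (intro A.finsum_cong') (auto simp: c.hom_mult)
        finally show ?thesis ..
      qed
      have g: "(\<Oplus>\<^bsub>polys\<^esub>j\<in>{1..m}. ?g j) = comb i \<otimes>\<^bsub>polys\<^esub> indexed_const y"
      proof -
        have "comb i \<otimes>\<^bsub>polys\<^esub> indexed_const y
            = (\<Oplus>\<^bsub>polys\<^esub>j\<in>{1..m}. indexed_var (i, j) \<otimes>\<^bsub>polys\<^esub> indexed_const (w j) \<otimes>\<^bsub>polys\<^esub> indexed_const y)"
          unfolding generic_combination_def
          using w yc generic_const_closed generic_var_closed i by (intro A.finsum_ldistr) auto
        also have "\<dots> = (\<Oplus>\<^bsub>polys\<^esub>j\<in>{1..m}. ?g j)"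
          using w yc generic_const_closed generic_var_closed i fc
          by (intro A.finsum_cong') (auto simp: A.m_assoc)
        finally show ?thesis ..
      qed
      have c1: "indexed_const (y \<otimes> z) \<in> carrier polys" "comb i \<otimes>\<^bsub>polys\<^esub> indexed_const y \<in> carrier polys"
        using generic_const_closed yc generic_combination_closed i specialize_closed[OF \<alpha>] by auto
      have "indexed_const (y \<otimes> z) = (comb i \<otimes>\<^bsub>polys\<^esub> indexed_const y)
          \<oplus>\<^bsub>polys\<^esub> (indexed_const (y \<otimes> z) \<ominus>\<^bsub>polys\<^esub> comb i \<otimes>\<^bsub>polys\<^esub> indexed_const y)"
        by (rule diff_add[OF c1])
      also have "\<dots> \<in> ?G"
        using gens2[OF i(1) y] diff[unfolded f g] unfolding A.ideal_sum_mem by blast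
      finally show "y \<otimes> z \<in> PG"
        unfolding PG_def using yc specialize_closed[OF \<alpha>] i by auto
    qed
    moreover have "y \<otimes> x = x \<otimes> y"
      using yc ideal.Icarr[OF genideal_ideal[OF sc] x] by (simp add: m_comm)
    ultimately show "x \<otimes> y \<in> PG" by simp
  qed
  ultimately have "T \<subseteq> PG"
    using T ideal_sum_least[OF PG] by blast
  then have "indexed_const ` S \<subseteq> ?G"
    using genideal_self[OF S(1)] S(3) unfolding PG_def by blast
  with A.nakayama[OF N Q.is_ideal finite_imageI[OF S(2)] cS]
  obtain t where t: "t \<in> N" "\<forall>x\<in>?I. (\<one>\<^bsub>polys\<^esub> \<ominus>\<^bsub>polys\<^esub> t) \<otimes>\<^bsub>polys\<^esub> x \<in> generic_span d m w J K" by blast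
  have tc: "t \<in> carrier polys" "poly_eval \<alpha> t = \<zero>" using t(1) unfolding N_def by auto
  then have "poly_eval \<alpha> (\<one>\<^bsub>polys\<^esub> \<ominus>\<^bsub>polys\<^esub> t) = \<one>"
    unfolding a_minus_def by simp
  then show ?thesis
    using t(2) cT tc by (intro bexI[of _ "\<one>\<^bsub>polys\<^esub> \<ominus>\<^bsub>polys\<^esub> t"]) auto
qed

text \<open>
  Evaluation maps the generic span into the specialized one and \<open>s\<close> to a unit.
\<close>

lemma specialization_if_generic_span:
  assumes \<beta>: "\<And>v. \<beta> v \<in> carrier R"
    and "ideal J R" "ideal K R" "x \<in> carrier R"
    and s: "s \<in> carrier polys" "poly_eval \<beta> s \<notin> M"
    and sx: "s \<otimes>\<^bsub>polys\<^esub> indexed_const x \<in> generic_span d m w J K"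
  shows "x \<in> J <+> (Idl (specialize m w \<beta> ` {1..d})) \<cdot> K"
proof -
  interpret J: ideal J R by fact
  interpret K: ideal K R by fact
  interpret h: ring_hom_cring polys R "poly_eval \<beta>" by (rule poly_eval_hom[OF \<beta>])
  have Jc: "J \<subseteq> carrier R" and Kc: "K \<subseteq> carrier R" using J.Icarr K.Icarr by auto
  have sc: "specialize m w \<beta> ` {1..d} \<subseteq> carrier R" using specialize_closed[OF \<beta>] by auto
  let ?B = "Idl (specialize m w \<beta> ` {1..d})"
  interpret B: ideal ?B R by (rule genideal_ideal[OF sc])
  interpret BK: ideal "?B \<cdot> K" R by (rule ideal_prod_is_ideal[OF B.is_ideal K.is_ideal])
  let ?G = "J <+> ?B \<cdot> K"
  interpret G: ideal ?G R by (rule add_ideals[OF J.is_ideal BK.is_ideal])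
  have up: "J \<subseteq> ?G" "?B \<cdot> K \<subseteq> ?G"
    using ideal_sum_upper[OF J.is_ideal BK.is_ideal] by auto
  have "poly_eval \<beta> ` generic_span d m w J K \<subseteq> ?G"
    unfolding generic_span_def
  proof (rule ring_hom_Idl_image_subset[OF h.homh generic_poly_ring_cring is_cring G.is_ideal generic_span_gens[OF Jc Kc]])
    have "poly_eval \<beta> (indexed_const x) \<in> ?G" if "x \<in> J" for x
      using that up(1) Jc \<beta> by (auto simp: poly_eval_const)
    moreover have "poly_eval \<beta> (comb i \<otimes>\<^bsub>polys\<^esub> indexed_const y) \<in> ?G" if "i \<in> {1..d}" "y \<in> K" for i y
    proof -
      have "poly_eval \<beta> (comb i \<otimes>\<^bsub>polys\<^esub> indexed_const y) = specialize m w \<beta> i \<otimes> y"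
        using that Kc \<beta> generic_combination_closed generic_const_closed by (simp add: poly_eval_generic_combination poly_eval_const subsetD)
      moreover have "specialize m w \<beta> i \<in> ?B" using genideal_self[OF sc] that by blast
      ultimately show ?thesis using that up(2) ideal_prod.prod[of _ ?B y K R] by auto
    qed
    ultimately show "poly_eval \<beta> ` (indexed_const ` J \<union>
        (\<lambda>(i, y). comb i \<otimes>\<^bsub>polys\<^esub> indexed_const y) ` ({1..d} \<times> K)) \<subseteq> ?G" by auto
  qed
  then have "poly_eval \<beta> (s \<otimes>\<^bsub>polys\<^esub> indexed_const x) \<in> ?G" using sx by blast
  then have *: "poly_eval \<beta> s \<otimes> x \<in> ?G"
    using s assms(4) generic_const_closed \<beta> by (simp add: poly_eval_const)
  obtain y where y: "y \<in> carrier R" "y \<otimes> poly_eval \<beta> s = \<one>"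
    using unit_if_notin_M[OF h.hom_closed[OF s(1)] s(2)] .
  have "y \<otimes> (poly_eval \<beta> s \<otimes> x) = x"
    using y s(1) assms(4) by (simp add: m_assoc[symmetric])
  then show ?thesis using G.I_l_closed[OF * y(1)] by simp
qed

end

end

lemma (in ring_hom_cring) image_nfold_products:
  assumes "Y \<subseteq> carrier R"
  shows "h ` R.nfold_products Y n = S.nfold_products (h ` Y) n"
proof (induction n)
  case (Suc n)
  have "h ` R.nfold_products Y (Suc n) = (\<lambda>(x, y). h (x \<otimes> y)) ` (Y \<times> R.nfold_products Y n)"
    by (simp add: image_image case_prod_unfold)
  also have "\<dots> = (\<lambda>(x, y). h x \<otimes>\<^bsub>S\<^esub> h y) ` (Y \<times> R.nfold_products Y n)"
    using assms R.nfold_products_carrier[OF assms, of n] by (intro image_cong) (auto simp: subset_iff)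
  also have "\<dots> = (\<lambda>(x, y). x \<otimes>\<^bsub>S\<^esub> y) ` ((h ` Y) \<times> (h ` R.nfold_products Y n))"
    by (auto simp: image_iff)
  finally show ?case using Suc by simp
qed simp

context noetherian_local_ring
begin

lemma generic_denominators_eq:
  "generic_denominators R M d m = pset ({1..d} \<times> {1..m}) - extended_M ({1..d} \<times> {1..m})"
  by (simp add: generic_denominators_def generic_poly_ring_def mpoly_ring_simps)

lemma notin_extended_M:
  assumes "\<And>v. \<alpha> v \<in> carrier R" "poly_eval \<alpha> s = \<one>"
  shows "s \<notin> extended_M V"
  using poly_eval_extended_M[of \<alpha> s V] assms one_notin_M by auto

lemma generic_denominators_multiplicative:
  assumes "infinite (carrier (R Quot M))"
  shows "multiplicative_subset (generic_poly_ring R d m) (generic_denominators R M d m)"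
proof (rule multiplicative_subset.intro)
  show "cring (generic_poly_ring R d m)" by (rule generic_poly_ring_cring)
  have "poly_eval (\<lambda>_. \<one>) (indexed_const \<one>) = \<one>" by (simp add: poly_eval_const)
  then have "indexed_const \<one> \<notin> extended_M ({1..d} \<times> {1..m})"
    by (intro notin_extended_M) auto
  then show "multiplicative_subset_axioms (generic_poly_ring R d m) (generic_denominators R M d m)"
    unfolding generic_denominators_eq generic_poly_ring_def
    using extended_M_prime[OF assms, of "{1..d} \<times> {1..m}"]
    by (unfold_locales) (auto simp: mpoly_ring_simps conv_closed intro: indexed_pset.indexed_const)
qed

text \<open>
  From left to right, the generic equation is cleared of its denominators by one polynomial outside
  of \<open>M[u]\<close> and evaluated at a point where this polynomial is a unit.  From right to left, the
  factor \<open>s\<close> with value \<open>1\<close> at the point \<open>\<alpha>\<close> lies outside of \<open>M[u]\<close>, so it becomes a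
  unit in the generic ring.
\<close>

theorem generic_reduction_iff:
  fixes a :: "nat \<Rightarrow> 'a"
  assumes inf: "infinite (carrier (R Quot M))"
    and a: "\<And>j. j \<in> {1..m} \<Longrightarrow> a j \<in> carrier R"
    and I: "I = Idl (a ` {1..m})"
  shows "ideal_pow (generic_ring R M d m) (generic_extension R M d m I) (Suc n)
      = generic_minimal_reduction R M d m a \<cdot>\<^bsub>generic_ring R M d m\<^esub>
        ideal_pow (generic_ring R M d m) (generic_extension R M d m I) n
    \<longleftrightarrow> (\<exists>\<alpha>. (\<forall>v. \<alpha> v \<in> carrier R) \<and>
      ideal_pow R I (Suc n) = (Idl (specialize m a \<alpha> ` {1..d})) \<cdot> ideal_pow R I n)"
proof -
  let ?A = "generic_poly_ring R d m" and ?S = "generic_denominators R M d m"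
  let ?G = "generic_ring R M d m"
  let ?b = "generic_combination R d m a"
  let ?X = "a ` {1..m}"
  interpret A: cring ?A by (rule generic_poly_ring_cring)
  interpret S: multiplicative_subset ?A ?S by (rule generic_denominators_multiplicative[OF inf])
  have G: "?G = S.Loc" by (simp add: generic_ring_def)
  interpret G: cring ?G unfolding G by (rule S.Loc_cring)
  define l where "l = to_generic_ring R M d m"
  have l_def': "l p = fraction ?A ?S p \<one>\<^bsub>?A\<^esub>" for p by (simp add: l_def to_generic_ring_def)
  then have l_fun: "l = (\<lambda>p. fraction ?A ?S p \<one>\<^bsub>?A\<^esub>)" by blast
  interpret l: ring_hom_cring ?A ?G l
  proof (intro ring_hom_cring.intro ring_hom_cring_axioms.intro generic_poly_ring_cring G.is_cring ring_hom_memI)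
    show "l \<one>\<^bsub>?A\<^esub> = \<one>\<^bsub>?G\<^esub>" by (simp add: l_def' G S.Loc_one)
  qed (auto simp: l_def' G S.to_loc_closed S.to_loc_mult S.to_loc_add)
  interpret c: ring_hom_cring R ?A indexed_const
    by (intro ring_hom_cring.intro ring_hom_cring_axioms.intro generic_poly_ring_cring is_cring generic_const_hom)
  define h where "h x = l (indexed_const x)" for x
  interpret h: ring_hom_cring R ?G h
    by (intro ring_hom_cring.intro ring_hom_cring_axioms.intro G.is_cring is_cring ring_hom_memI)
      (auto simp: h_def)
  have X: "?X \<subseteq> carrier R" using a by auto
  have hX: "h ` ?X \<subseteq> carrier ?G" using X by auto
  let ?fp = "nfold_products ?X"
  have fp: "?fp k \<subseteq> carrier R" for k by (rule nfold_products_carrier[OF X])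
  have powI: "ideal_pow R I k = Idl (?fp k)" for k
    unfolding I by (rule ideal_pow_Idl[OF X])
  have ideal_I: "ideal I R" unfolding I by (rule genideal_ideal[OF X])
  let ?Iu = "generic_extension R M d m I"
  have Iu: "?Iu = Idl\<^bsub>?G\<^esub> (h ` ?X)"
    unfolding generic_extension_def I h_def l_def
    using ring_hom_Idl_image[OF h.homh is_cring G.is_cring X] unfolding h_def l_def .
  have ideal_Iu: "ideal ?Iu ?G" unfolding Iu by (rule G.genideal_ideal[OF hX])
  have powIu: "ideal_pow ?G ?Iu k = Idl\<^bsub>?G\<^esub> (l ` indexed_const ` ?fp k)" for k
    unfolding Iu G.ideal_pow_Idl[OF hX] h.image_nfold_products[OF X, symmetric]
    by (simp add: h_def image_image)
  have bc: "?b i \<in> carrier ?A" if "i \<in> {1..d}" for i using generic_combination_closed[of m a] a that by simp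
  have lb: "l ` ?b ` {1..d} \<subseteq> carrier ?G" using bc by auto
  let ?q = "generic_minimal_reduction R M d m a"
  have q: "?q = Idl\<^bsub>?G\<^esub> (l ` ?b ` {1..d})"
    by (simp add: generic_minimal_reduction_def l_def image_image)
  let ?Y = "\<lambda>k. (\<lambda>(i, y). ?b i \<otimes>\<^bsub>?A\<^esub> indexed_const y) ` ({1..d} \<times> ?fp k)"
  have Y: "?Y k \<subseteq> carrier ?A" for k
    using bc fp[of k] by (auto simp: subset_iff)
  have lc: "l ` indexed_const ` ?fp k \<subseteq> carrier ?G" for k using fp[of k] by auto
  have prod: "?q \<cdot>\<^bsub>?G\<^esub> ideal_pow ?G ?Iu n = Idl\<^bsub>?G\<^esub> (l ` ?Y n)"
  proof -
    have "(\<lambda>(x, y). x \<otimes>\<^bsub>?G\<^esub> y) ` ((l ` ?b ` {1..d}) \<times> (l ` indexed_const ` ?fp n))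
        = (\<lambda>(i, y). l (?b i) \<otimes>\<^bsub>?G\<^esub> l (indexed_const y)) ` ({1..d} \<times> ?fp n)"
      by (auto simp: image_iff)
    also have "\<dots> = l ` ?Y n"
      unfolding image_image using bc fp[of n] by (intro image_cong) (auto simp: subset_iff)
    finally show ?thesis unfolding q powIu G.Idl_prod_Idl[OF lb lc] by simp
  qed
  have "?q \<subseteq> ?Iu"
    unfolding q
  proof (rule G.genideal_minimal[OF ideal_Iu])
    let ?P = "{p \<in> carrier ?A. l p \<in> ?Iu}"
    have P: "ideal ?P ?A" by (rule ring_hom_vimage_ideal[OF l.homh generic_poly_ring_cring G.is_cring ideal_Iu])
    have "?b i \<in> ?P" if "i \<in> {1..d}" for i
      unfolding generic_combination_def
    proof (rule A.finsum_mem_ideal[OF P])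
      fix j assume j: "j \<in> {1..m}"
      have "h (a j) \<in> ?Iu" unfolding Iu using G.genideal_self[OF hX] j by blast
      then have "indexed_const (a j) \<in> ?P" using a[OF j] by (simp add: h_def)
      then show "indexed_var (i, j) \<otimes>\<^bsub>?A\<^esub> indexed_const (a j) \<in> ?P"
        using generic_var_closed[OF that j] by (rule ideal.I_l_closed[OF P])
    qed
    then show "l ` ?b ` {1..d} \<subseteq> ?Iu" by auto
  qed
  then have "?q \<cdot>\<^bsub>?G\<^esub> ideal_pow ?G ?Iu n \<subseteq> ideal_pow ?G ?Iu (Suc n)"
    unfolding G.ideal_pow_Suc[OF ideal_Iu] by (intro G.ideal_prod_mono) auto
  then have "ideal_pow ?G ?Iu (Suc n) = ?q \<cdot>\<^bsub>?G\<^esub> ideal_pow ?G ?Iu n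
      \<longleftrightarrow> ideal_pow ?G ?Iu (Suc n) \<subseteq> ?q \<cdot>\<^bsub>?G\<^esub> ideal_pow ?G ?Iu n"
    by auto
  also have "\<dots> \<longleftrightarrow> Idl\<^bsub>?G\<^esub> (l ` indexed_const ` ?fp (Suc n)) \<subseteq> Idl\<^bsub>?G\<^esub> (l ` ?Y n)"
    by (simp only: prod powIu[of "Suc n"])
  also have "\<dots> \<longleftrightarrow> (\<exists>s\<in>?S. \<forall>x\<in>indexed_const ` ?fp (Suc n). s \<otimes>\<^bsub>?A\<^esub> x \<in> Idl\<^bsub>?A\<^esub> (?Y n))"
    unfolding G l_fun
  proof (rule S.Idl_to_loc_subset_iff[OF Y])
    show "indexed_const ` ?fp (Suc n) \<subseteq> carrier ?A" using fp[of "Suc n"] by blast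
    show "finite (indexed_const ` ?fp (Suc n))" by (intro finite_imageI finite_nfold_products) simp
  qed
  also have "\<dots> \<longleftrightarrow> (\<exists>\<alpha>. (\<forall>v. \<alpha> v \<in> carrier R) \<and>
      ideal_pow R I (Suc n) \<subseteq> (Idl (specialize m a \<alpha> ` {1..d})) \<cdot> ideal_pow R I n)"
  proof (intro iffI; elim bexE exE conjE)
    fix s assume s: "s \<in> ?S" "\<forall>x\<in>indexed_const ` ?fp (Suc n). s \<otimes>\<^bsub>?A\<^esub> x \<in> Idl\<^bsub>?A\<^esub> (?Y n)"
    have sA: "s \<in> carrier ?A" using s(1) by (simp add: generic_denominators_def)
    obtain \<alpha> where \<alpha>: "\<forall>v. \<alpha> v \<in> carrier R" "poly_eval \<alpha> s \<notin> M"
      using common_nonvanishing[OF inf, of "{1..d} \<times> {1..m}" s s] s(1)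
      unfolding generic_denominators_eq by auto
    let ?B = "Idl (specialize m a \<alpha> ` {1..d})"
    have B: "ideal ?B R"
      using specialize_closed[of m a \<alpha>] a \<alpha> by (intro genideal_ideal) auto
    have BI: "ideal (?B \<cdot> ideal_pow R I n) R"
      using ideal_prod_is_ideal[OF B] ideal_I by simp
    have "x \<in> ?B \<cdot> ideal_pow R I n" if x: "x \<in> ?fp (Suc n)" for x
    proof -
      have xc: "x \<in> carrier R" using x fp[of "Suc n"] by blast
      have "s \<otimes>\<^bsub>?A\<^esub> indexed_const x \<in> generic_span d m a {\<zero>} (ideal_pow R I n)"
      proof -
        have "Idl\<^bsub>?A\<^esub> (?Y n) \<subseteq> generic_span d m a {\<zero>} (ideal_pow R I n)"
          unfolding generic_span_def
        proof (rule A.subset_Idl_subset)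
          show "indexed_const ` {\<zero>} \<union> (\<lambda>(i, y). ?b i \<otimes>\<^bsub>?A\<^esub> indexed_const y) ` ({1..d} \<times> ideal_pow R I n)
              \<subseteq> carrier ?A"
            using ideal.Icarr[OF ideal_pow_ideal[OF ideal_I, of n]] a
            by (intro generic_span_gens) auto
          show "?Y n \<subseteq> indexed_const ` {\<zero>} \<union>
              (\<lambda>(i, y). ?b i \<otimes>\<^bsub>?A\<^esub> indexed_const y) ` ({1..d} \<times> ideal_pow R I n)"
            using genideal_self[OF fp[of n]] unfolding powI by blast
        qed
        then show ?thesis using s(2) x by blast
      qed
      then have "x \<in> {\<zero>} <+> ?B \<cdot> ideal_pow R I n"
        by (intro specialization_if_generic_span[OF a _ zeroideal ideal_pow_ideal[OF ideal_I] xc sA \<alpha>(2)])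
          (use \<alpha>(1) in auto)
      then show ?thesis
        using ideal_sum_least[OF BI, of "{\<zero>}" "?B \<cdot> ideal_pow R I n"] ideal_zero_mem[OF BI] by blast
    qed
    then have "ideal_pow R I (Suc n) \<subseteq> ?B \<cdot> ideal_pow R I n"
      unfolding powI[of "Suc n"] by (intro genideal_minimal[OF BI]) blast
    then show "\<exists>\<alpha>. (\<forall>v. \<alpha> v \<in> carrier R) \<and>
      ideal_pow R I (Suc n) \<subseteq> (Idl (specialize m a \<alpha> ` {1..d})) \<cdot> ideal_pow R I n"
      using \<alpha>(1) by blast
  next
    fix \<alpha> assume \<alpha>: "\<forall>v. \<alpha> v \<in> carrier R"
      and sub: "ideal_pow R I (Suc n) \<subseteq> (Idl (specialize m a \<alpha> ` {1..d})) \<cdot> ideal_pow R I n"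
    have \<alpha>': "\<And>v. \<alpha> v \<in> carrier R" using \<alpha> by blast
    have B: "ideal (Idl (specialize m a \<alpha> ` {1..d})) R"
      using specialize_closed[of m a \<alpha>] a \<alpha> by (intro genideal_ideal) auto
    have BI: "ideal ((Idl (specialize m a \<alpha> ` {1..d})) \<cdot> ideal_pow R I n) R"
      using ideal_prod_is_ideal[OF B] ideal_I by simp
    have "\<exists>s\<in>carrier ?A. poly_eval \<alpha> s = \<one> \<and>
        (\<forall>x\<in>ideal_pow R I (Suc n). s \<otimes>\<^bsub>?A\<^esub> indexed_const x \<in> generic_span d m a {\<zero>} (ideal_pow R I n))"
    proof (rule generic_span_if_specialization[OF a \<alpha>' zeroideal])
      show "ideal_pow R I (Suc n)
          \<subseteq> {\<zero>} <+> (Idl (specialize m a \<alpha> ` {1..d})) \<cdot> ideal_pow R I n"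
        using sub ideal_sum_upper(2)[OF zeroideal BI] by blast
      show "a j \<otimes> y \<in> ideal_pow R I (Suc n)" if "j \<in> {1..m}" "y \<in> ideal_pow R I n" for j y
      proof -
        have "a j \<in> I" unfolding I using genideal_self[OF X] that by blast
        then show ?thesis
          unfolding ideal_pow_Suc[OF ideal_I] using that(2) by (rule ideal_prod.prod)
      qed
    qed (use ideal_I in auto)
    then obtain s where s: "s \<in> carrier ?A" "poly_eval \<alpha> s = \<one>"
      "\<forall>x\<in>ideal_pow R I (Suc n). s \<otimes>\<^bsub>?A\<^esub> indexed_const x \<in> generic_span d m a {\<zero>} (ideal_pow R I n)"
      by blast
    have "s \<in> ?S"
      using s(1) notin_extended_M[OF \<alpha>' s(2)]
      unfolding generic_denominators_eq by (simp add: generic_poly_ring_def mpoly_ring_simps)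
    moreover have "generic_span d m a {\<zero>} (ideal_pow R I n) \<subseteq> Idl\<^bsub>?A\<^esub> (?Y n)"
      unfolding generic_span_def
    proof (rule A.genideal_minimal[OF A.genideal_ideal[OF Y]])
      interpret J: ideal "Idl\<^bsub>?A\<^esub> (?Y n)" ?A by (rule A.genideal_ideal[OF Y])
      have cfp: "indexed_const ` ?fp n \<subseteq> carrier ?A" using fp[of n] by auto
      have "?b i \<otimes>\<^bsub>?A\<^esub> indexed_const y \<in> Idl\<^bsub>?A\<^esub> (?Y n)" if i: "i \<in> {1..d}" and y: "y \<in> ideal_pow R I n" for i y
      proof (rule A.mult_Idl_mem[OF J.is_ideal cfp bc[OF i]])
        show "indexed_const y \<in> Idl\<^bsub>?A\<^esub> (indexed_const ` ?fp n)"
          using ring_hom_Idl_image_subset[OF c.homh is_cring generic_poly_ring_cring A.genideal_ideal[OF cfp] fp[of n]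
              A.genideal_self[OF cfp]] y unfolding powI by blast
        fix z :: "(nat \<times> nat) multiset \<Rightarrow> 'a" assume "z \<in> indexed_const ` ?fp n"
        then obtain x where x: "x \<in> ?fp n" "z = indexed_const x" by blast
        have "?b i \<otimes>\<^bsub>?A\<^esub> z \<in> ?Y n"
          by (rule image_eqI[of _ _ "(i, x)"]) (use x i in simp_all)
        then show "?b i \<otimes>\<^bsub>?A\<^esub> z \<in> Idl\<^bsub>?A\<^esub> (?Y n)" using A.genideal_self[OF Y] by blast
      qed
      then show "indexed_const ` {\<zero>} \<union> (\<lambda>(i, y). ?b i \<otimes>\<^bsub>?A\<^esub> indexed_const y) ` ({1..d} \<times> ideal_pow R I n)
          \<subseteq> Idl\<^bsub>?A\<^esub> (?Y n)"
        using J.zero_closed by auto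
    qed
    moreover have "?fp (Suc n) \<subseteq> ideal_pow R I (Suc n)"
      unfolding powI by (rule genideal_self[OF fp])
    ultimately show "\<exists>s\<in>?S. \<forall>x\<in>indexed_const ` ?fp (Suc n). s \<otimes>\<^bsub>?A\<^esub> x \<in> Idl\<^bsub>?A\<^esub> (?Y n)"
      using s(3) by blast
  qed
  also have "\<dots> \<longleftrightarrow> (\<exists>\<alpha>. (\<forall>v. \<alpha> v \<in> carrier R) \<and>
      ideal_pow R I (Suc n) = (Idl (specialize m a \<alpha> ` {1..d})) \<cdot> ideal_pow R I n)"
  proof -
    have "(Idl (specialize m a \<alpha> ` {1..d})) \<cdot> ideal_pow R I n \<subseteq> ideal_pow R I (Suc n)"
      if "\<forall>v. \<alpha> v \<in> carrier R" for \<alpha>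
    proof -
      have "specialize m a \<alpha> i \<in> I" for i
        unfolding specialize_def
        using that genideal_self[OF X] unfolding I
        by (intro finsum_mem_ideal genideal_ideal[OF X] ideal.I_l_closed) auto
      then show ?thesis
        unfolding ideal_pow_Suc[OF ideal_I]
        by (intro ideal_prod_mono genideal_minimal[OF ideal_I]) auto
    qed
    then show ?thesis by blast
  qed
  finally show ?thesis .
qed

end

section \<open>Homogeneous ideals of the fiber cone\<close>

lemma (in cring) mult_image_ideal:
  assumes "ideal K R" "x \<in> carrier R"
  shows "ideal ((\<otimes>) x ` K) R"
proof -
  interpret K: ideal K R by fact
  show ?thesis
  proof (rule idealI)
    show "subgroup ((\<otimes>) x ` K) (add_monoid R)"
    proof (rule add.subgroupI)
      show "(\<otimes>) x ` K \<noteq> {}" by (metis K.zero_closed image_is_empty empty_iff)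
      show "(\<otimes>) x ` K \<subseteq> carrier R" using assms(2) by (auto intro: m_closed K.Icarr)
      show "\<ominus> y \<in> (\<otimes>) x ` K" if y: "y \<in> (\<otimes>) x ` K" for y
      proof -
        obtain k where "k \<in> K" "y = x \<otimes> k" using y by blast
        then have "\<ominus> y = x \<otimes> (\<ominus> k)" using assms(2) K.Icarr by (simp add: r_minus)
        then show ?thesis using \<open>k \<in> K\<close> by blast
      qed
      show "y \<oplus> z \<in> (\<otimes>) x ` K" if yz: "y \<in> (\<otimes>) x ` K" "z \<in> (\<otimes>) x ` K" for y z
      proof -
        obtain k l where "k \<in> K" "y = x \<otimes> k" "l \<in> K" "z = x \<otimes> l" using yz by blast
        then have "y \<oplus> z = x \<otimes> (k \<oplus> l)" using assms(2) K.Icarr by (simp add: r_distr)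
        then show ?thesis using \<open>k \<in> K\<close> \<open>l \<in> K\<close> by blast
      qed
    qed
    fix y r assume "y \<in> (\<otimes>) x ` K" "r \<in> carrier R"
    then obtain k where k: "k \<in> K" "y = x \<otimes> k" by blast
    then have "r \<otimes> y = x \<otimes> (r \<otimes> k)" "y \<otimes> r = x \<otimes> (k \<otimes> r)"
      using assms(2) K.Icarr \<open>r \<in> carrier R\<close> by (simp_all add: m_lcomm m_assoc)
    then show "r \<otimes> y \<in> (\<otimes>) x ` K" "y \<otimes> r \<in> (\<otimes>) x ` K"
      using k \<open>r \<in> carrier R\<close> by (auto intro: K.I_l_closed K.I_r_closed)
  qed (rule ring_axioms)
qed

context noetherian_local_ring
begin

text \<open>
  A homogeneous ideal of the fiber cone of \<open>I\<close> is represented by the preimages of its components,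
  which are ideals between \<open>M I\<^sup>n\<close> and \<open>I\<^sup>n\<close>.
\<close>

definition graded_ideal :: "'a set \<Rightarrow> (nat \<Rightarrow> 'a set) \<Rightarrow> bool" where
  "graded_ideal I P \<longleftrightarrow>
     (\<forall>n. ideal (P n) R \<and> M \<cdot> ideal_pow R I n \<subseteq> P n \<and> P n \<subseteq> ideal_pow R I n) \<and>
     (\<forall>n. \<forall>x\<in>I. \<forall>y\<in>P n. x \<otimes> y \<in> P (Suc n))"

definition graded_prime :: "'a set \<Rightarrow> (nat \<Rightarrow> 'a set) \<Rightarrow> bool" where
  "graded_prime I P \<longleftrightarrow> graded_ideal I P \<and> \<one> \<notin> P 0 \<and>
     (\<forall>i j. \<forall>x\<in>ideal_pow R I i. \<forall>y\<in>ideal_pow R I j. x \<otimes> y \<in> P (i + j) \<longrightarrow> x \<in> P i \<or> y \<in> P j)"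

text \<open>
  The quotient of the fiber cone by \<open>P\<close> vanishes in all large degrees after dividing by \<open>t\<close>
  elements of \<open>q\<close>, which are considered in degree \<open>1\<close>.
\<close>

definition covered :: "'a set \<Rightarrow> 'a set \<Rightarrow> (nat \<Rightarrow> 'a set) \<Rightarrow> nat \<Rightarrow> bool" where
  "covered I q P t \<longleftrightarrow> (\<exists>e. (\<forall>i\<in>{1..t}. e i \<in> q) \<and>
     (\<exists>n. ideal_pow R I (Suc n) \<subseteq> P (Suc n) <+> (Idl (e ` {1..t})) \<cdot> ideal_pow R I n))"

lemma combinations_are_specializations:
  assumes w: "\<And>j. j \<in> {1..m} \<Longrightarrow> w j \<in> carrier R"
    and e: "\<forall>i\<in>{1..t}. e i \<in> Idl (w ` {1..m})"
  shows "\<exists>\<alpha>. (\<forall>v. \<alpha> v \<in> carrier R) \<and> (\<forall>i\<in>{1..t}. e i = specialize m w \<alpha> i)"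
proof -
  have "\<forall>i\<in>{1..t}. \<exists>c\<in>{1..m} \<rightarrow> carrier R. e i = (\<Oplus>j\<in>{1..m}. c j \<otimes> w j)"
  proof
    fix i assume "i \<in> {1..t}"
    then show "\<exists>c\<in>{1..m} \<rightarrow> carrier R. e i = (\<Oplus>j\<in>{1..m}. c j \<otimes> w j)"
      using e w by (intro Idl_combination) auto
  qed
  then obtain c where c: "\<And>i. i \<in> {1..t} \<Longrightarrow> c i \<in> {1..m} \<rightarrow> carrier R"
    "\<And>i. i \<in> {1..t} \<Longrightarrow> e i = (\<Oplus>j\<in>{1..m}. c i j \<otimes> w j)"
    by metis
  define \<alpha> where "\<alpha> = (\<lambda>(i, j). if i \<in> {1..t} \<and> j \<in> {1..m} then c i j else \<zero>)"
  have \<alpha>: "\<alpha> v \<in> carrier R" for v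
    using c(1) by (auto simp: \<alpha>_def Pi_iff split: prod.splits)
  moreover have "e i = specialize m w \<alpha> i" if i: "i \<in> {1..t}" for i
  proof -
    have "c i j = \<alpha> (i, j)" if "j \<in> {1..m}" for j
      using that i by (simp add: \<alpha>_def)
    then show ?thesis
      unfolding specialize_def c(2)[OF i] using \<alpha> w by (intro finsum_cong') auto
  qed
  ultimately show ?thesis by blast
qed

text \<open>
  The elements can be chosen to serve two ideals at the same time, because the conditions on the
  coefficients are open.
\<close>

lemma common_combinations:
  assumes inf: "infinite (carrier (R Quot M))"
    and ideals: "ideal q R" "ideal J R" "ideal J' R" "ideal K R" "ideal T R"
    and qK: "q \<cdot> K \<subseteq> T"
    and e: "\<forall>i\<in>{1..t}. e i \<in> q" "T \<subseteq> J <+> (Idl (e ` {1..t})) \<cdot> K"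
    and e': "\<forall>i\<in>{1..t}. e' i \<in> q" "T \<subseteq> J' <+> (Idl (e' ` {1..t})) \<cdot> K"
  shows "\<exists>f. (\<forall>i\<in>{1..t::nat}. f i \<in> q) \<and> T \<subseteq> J <+> (Idl (f ` {1..t})) \<cdot> K
    \<and> T \<subseteq> J' <+> (Idl (f ` {1..t})) \<cdot> K"
proof -
  obtain S where S: "S \<subseteq> carrier R" "finite S" "q = Idl S"
    using finetely_gen[OF ideals(1)] by blast
  obtain w0 :: "nat \<Rightarrow> 'a" and p where w0: "S = w0 ` {i. i < p}"
    using S(2) by (metis finite_imp_nat_seg_image_inj_on)
  define w where "w j = w0 (j - 1)" for j
  have "{i. i < p} = (\<lambda>j. j - 1) ` {1..p}"
    by (auto simp: image_iff intro!: bexI[of _ "Suc _"])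
  then have wS: "S = w ` {1..p}"
    unfolding w0 w_def by (simp add: image_image)
  have w: "w j \<in> carrier R" if "j \<in> {1..p}" for j using S(1) wS that by auto
  have wq: "w j \<in> q" if "j \<in> {1..p}" for j using genideal_self[OF S(1)] S(3) wS that by auto
  have wK: "w j \<otimes> y \<in> T" if "j \<in> {1..p}" "y \<in> K" for j y
    using ideal_prod.prod[OF wq[OF that(1)] that(2)] qK by blast
  have coeffs: "\<exists>\<alpha>. (\<forall>v. \<alpha> v \<in> carrier R) \<and> (\<forall>i\<in>{1..t}. e i = specialize p w \<alpha> i)"
    if "\<forall>i\<in>{1..t}. e i \<in> q" for e
    using that unfolding S(3) wS by (intro combinations_are_specializations[OF w])
  have poly: "\<exists>s. s \<in> carrier (generic_poly_ring R t p) \<and> s \<notin> extended_M ({1..t} \<times> {1..p}) \<and>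
      (\<forall>x\<in>T. s \<otimes>\<^bsub>generic_poly_ring R t p\<^esub> indexed_const x \<in> generic_span t p w J K)"
    if e: "\<forall>i\<in>{1..t}. e i \<in> q" "T \<subseteq> J <+> (Idl (e ` {1..t})) \<cdot> K" and J: "ideal J R" for e J
  proof -
    obtain \<alpha> where \<alpha>: "\<And>v. \<alpha> v \<in> carrier R" "\<forall>i\<in>{1..t}. e i = specialize p w \<alpha> i"
      using coeffs[OF e(1)] by blast
    have "e ` {1..t} = specialize p w \<alpha> ` {1..t}" using \<alpha>(2) by (intro image_cong) auto
    then have "\<exists>s\<in>carrier (generic_poly_ring R t p). poly_eval \<alpha> s = \<one> \<and>
        (\<forall>x\<in>T. s \<otimes>\<^bsub>generic_poly_ring R t p\<^esub> indexed_const x \<in> generic_span t p w J K)"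
      using e(2) by (intro generic_span_if_specialization[OF w \<alpha>(1) J ideals(4,5) _ wK]) auto
    then show ?thesis using notin_extended_M[of \<alpha>, OF \<alpha>(1)] by blast
  qed
  obtain s where s: "s \<in> carrier (generic_poly_ring R t p)" "s \<notin> extended_M ({1..t} \<times> {1..p})"
    "\<forall>x\<in>T. s \<otimes>\<^bsub>generic_poly_ring R t p\<^esub> indexed_const x \<in> generic_span t p w J K"
    using poly[OF e ideals(2)] by blast
  obtain s' where s': "s' \<in> carrier (generic_poly_ring R t p)" "s' \<notin> extended_M ({1..t} \<times> {1..p})"
    "\<forall>x\<in>T. s' \<otimes>\<^bsub>generic_poly_ring R t p\<^esub> indexed_const x \<in> generic_span t p w J' K"
    using poly[OF e' ideals(3)] by blast
  have ps: "s \<in> pset ({1..t} \<times> {1..p})" "s' \<in> pset ({1..t} \<times> {1..p})"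
    using s(1) s'(1) by (simp_all add: generic_poly_ring_def mpoly_ring_simps)
  obtain \<beta> where \<beta>: "\<forall>v. \<beta> v \<in> carrier R" "poly_eval \<beta> s \<notin> M" "poly_eval \<beta> s' \<notin> M"
    using common_nonvanishing[OF inf _ ps(1) s(2) ps(2) s'(2)] by blast
  have \<beta>': "\<And>v. \<beta> v \<in> carrier R" using \<beta> by blast
  let ?f = "specialize p w \<beta>"
  have "T \<subseteq> J <+> (Idl (?f ` {1..t})) \<cdot> K"
  proof
    fix x assume x: "x \<in> T"
    show "x \<in> J <+> (Idl (?f ` {1..t})) \<cdot> K"
      by (rule specialization_if_generic_span[OF w \<beta>' ideals(2,4) ideal.Icarr[OF ideals(5) x] s(1) \<beta>(2)])
        (use s(3) x in auto)
  qed
  moreover have "T \<subseteq> J' <+> (Idl (?f ` {1..t})) \<cdot> K"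
  proof
    fix x assume x: "x \<in> T"
    show "x \<in> J' <+> (Idl (?f ` {1..t})) \<cdot> K"
      by (rule specialization_if_generic_span[OF w \<beta>' ideals(3,4) ideal.Icarr[OF ideals(5) x] s'(1) \<beta>(3)])
        (use s'(3) x in auto)
  qed
  moreover have "?f i \<in> q" for i
    unfolding specialize_def using \<beta>' wq
    by (intro finsum_mem_ideal[OF ideals(1)] ideal.I_l_closed[OF ideals(1)]) auto
  ultimately show ?thesis by blast
qed

context
  fixes I q :: "'a set"
  assumes I: "ideal I R" and q: "ideal q R" "q \<subseteq> I"
begin

abbreviation (input) Ip where "Ip \<equiv> ideal_pow R I"

lemma Ip_ideal: "ideal (Ip n) R"
  using I by simp

lemma Ip_carrier: "x \<in> Ip n \<Longrightarrow> x \<in> carrier R"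
  using ideal.Icarr[OF Ip_ideal] .

lemma graded_ideal_carrier: "graded_ideal I P \<Longrightarrow> y \<in> P j \<Longrightarrow> y \<in> carrier R"
  using ideal.Icarr[of "P j" R y] by (simp add: graded_ideal_def)

lemma graded_ideal_mult:
  assumes P: "graded_ideal I P" and x: "x \<in> Ip i" and y: "y \<in> P j"
  shows "x \<otimes> y \<in> P (i + j)"
proof -
  have "Ip i \<subseteq> {x \<in> carrier R. y \<otimes> x \<in> P (i + j)}"
  proof (induction i)
    case 0
    have "ideal (P j) R" using P by (simp add: graded_ideal_def)
    then show ?case using y by (auto intro: ideal.I_r_closed)
  next
    case (Suc i)
    have id: "ideal (P (Suc i + j)) R" using P by (simp add: graded_ideal_def)
    have yc: "y \<in> carrier R" using graded_ideal_carrier[OF P y] .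
    have "ideal {x \<in> carrier R. y \<otimes> x \<in> P (Suc i + j)} R"
      by (rule ideal.helper_max_prime[OF id is_cring yc])
    then show ?case
      unfolding ideal_pow_Suc[OF I]
    proof (rule ideal_prod_subset)
      fix u v assume uv: "u \<in> I" "v \<in> Ip i"
      have c: "u \<in> carrier R" "v \<in> carrier R"
        using uv ideal.Icarr[OF I] Ip_carrier by auto
      have "y \<otimes> v \<in> P (i + j)" using Suc uv by blast
      then have "u \<otimes> (y \<otimes> v) \<in> P (Suc (i + j))" using P uv unfolding graded_ideal_def by blast
      moreover have "u \<otimes> (y \<otimes> v) = y \<otimes> (u \<otimes> v)" using c yc by (simp add: m_lcomm)
      ultimately show "u \<otimes> v \<in> {x \<in> carrier R. y \<otimes> x \<in> P (Suc i + j)}" using c by simp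
    qed
  qed
  then have "y \<otimes> x \<in> P (i + j)" using x by blast
  moreover have "y \<in> carrier R" using graded_ideal_carrier[OF P y] .
  ultimately show ?thesis using Ip_carrier[OF x] by (simp add: m_comm)
qed

lemma pow_mult_ideal_prod:
  assumes "ideal E R" "u \<in> Ip k" "f \<in> E \<cdot> Ip n"
  shows "u \<otimes> f \<in> E \<cdot> Ip (k + n)"
proof -
  have "u \<otimes> f \<in> Ip k \<cdot> (E \<cdot> Ip n)" using assms by (intro ideal_prod.prod)
  also have "Ip k \<cdot> (E \<cdot> Ip n) = (Ip k \<cdot> E) \<cdot> Ip n"
    using ideal_prod_assoc[OF Ip_ideal assms(1) Ip_ideal] by simp
  also have "\<dots> = (E \<cdot> Ip k) \<cdot> Ip n"
    using ideal_prod_commute[OF Ip_ideal assms(1)] by simp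
  also have "\<dots> = E \<cdot> Ip (k + n)"
    using ideal_prod_assoc[OF assms(1) Ip_ideal Ip_ideal] ideal_pow_add[OF I] by simp
  finally show ?thesis .
qed

text \<open>
  The inclusion is multiplied with \<open>I\<close> to pass to the next degree.
\<close>

lemma covering_mono:
  assumes P: "graded_ideal I P" and E: "ideal E R"
    and cov: "Ip (Suc n) \<subseteq> P (Suc n) <+> E \<cdot> Ip n" and le: "n \<le> n'"
  shows "Ip (Suc n') \<subseteq> P (Suc n') <+> E \<cdot> Ip n'"
  using le
proof (induction n' rule: dec_induct)
  case base
  then show ?case by (rule cov)
next
  case (step k)
  have id: "ideal (P (Suc (Suc k)) <+> E \<cdot> Ip (Suc k)) R"
    using P E Ip_ideal by (intro add_ideals ideal_prod_is_ideal) (auto simp: graded_ideal_def)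
  show ?case
    unfolding ideal_pow_Suc[OF I, of "Suc k"]
  proof (rule ideal_prod_subset[OF id])
    fix x y assume xy: "x \<in> I" "y \<in> Ip (Suc k)"
    obtain u f where uf: "u \<in> P (Suc k)" "f \<in> E \<cdot> Ip k" "y = u \<oplus> f"
      using subsetD[OF step.IH xy(2)] unfolding ideal_sum_mem by blast
    have "x \<otimes> u \<in> P (Suc (Suc k))" using P xy uf unfolding graded_ideal_def by blast
    moreover have "x \<otimes> f \<in> E \<cdot> Ip (Suc k)"
      using pow_mult_ideal_prod[OF E, of x 1 f k] xy uf I by simp
    moreover have "x \<otimes> y = x \<otimes> u \<oplus> x \<otimes> f"
    proof -
      have "u \<in> carrier R" using graded_ideal_carrier[OF P uf(1)] .
      moreover have "f \<in> carrier R" using ideal_prod_in_carrier[OF E Ip_ideal] uf by blast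
      moreover have "x \<in> carrier R" using ideal.Icarr[OF I] xy by blast
      ultimately show ?thesis using uf by (simp add: r_distr)
    qed
    ultimately show "x \<otimes> y \<in> P (Suc (Suc k)) <+> E \<cdot> Ip (Suc k)"
      unfolding ideal_sum_mem by blast
  qed
qed

text \<open>The homogeneous ideal generated by \<open>P\<close> and an element \<open>x\<close> of degree \<open>i\<close>.\<close>

definition adjoin :: "(nat \<Rightarrow> 'a set) \<Rightarrow> nat \<Rightarrow> 'a \<Rightarrow> nat \<Rightarrow> 'a set" where
  "adjoin P i x n = (if i \<le> n then P n <+> (\<otimes>) x ` Ip (n - i) else P n)"

lemma graded_ideal_adjoin:
  assumes P: "graded_ideal I P" and x: "x \<in> Ip i"
  shows "graded_ideal I (adjoin P i x)" "P n \<subseteq> adjoin P i x n" "x \<in> adjoin P i x i"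
proof -
  have xc: "x \<in> carrier R" using x by (rule Ip_carrier)
  have Pid: "ideal (P n) R" for n using P by (simp add: graded_ideal_def)
  have xI: "ideal ((\<otimes>) x ` Ip n) R" for n by (rule mult_image_ideal[OF Ip_ideal xc])
  show sub: "P n \<subseteq> adjoin P i x n" for n
    unfolding adjoin_def using ideal_sum_upper(1)[OF Pid xI] by simp
  have "x = \<zero> \<oplus> x \<otimes> \<one>" using xc by simp
  then show "x \<in> adjoin P i x i"
    unfolding adjoin_def using ideal_zero_mem[OF Pid] by (auto simp: ideal_sum_mem)
  show "graded_ideal I (adjoin P i x)"
    unfolding graded_ideal_def
  proof (intro conjI allI ballI)
    fix n
    show "ideal (adjoin P i x n) R"
      unfolding adjoin_def using add_ideals[OF Pid xI] Pid by simp
    show "M \<cdot> ideal_pow R I n \<subseteq> adjoin P i x n"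
      using sub[of n] P unfolding graded_ideal_def by blast
    show "adjoin P i x n \<subseteq> ideal_pow R I n"
    proof (cases "i \<le> n")
      case True
      have "(\<otimes>) x ` Ip (n - i) \<subseteq> Ip n"
        using ideal_pow_mult_mem[OF I x, of _ "n - i"] True by auto
      moreover have "P n \<subseteq> Ip n" using P by (simp add: graded_ideal_def)
      ultimately show ?thesis
        unfolding adjoin_def using True ideal_sum_least[OF Ip_ideal] by simp
    qed (use P in \<open>simp add: adjoin_def graded_ideal_def\<close>)
  next
    fix n u v assume u: "u \<in> I" and v: "v \<in> adjoin P i x n"
    have uc: "u \<in> carrier R" using ideal.Icarr[OF I u] .
    show "u \<otimes> v \<in> adjoin P i x (Suc n)"
    proof (cases "i \<le> n")
      case True
      then obtain p z where pz: "p \<in> P n" "z \<in> Ip (n - i)" "v = p \<oplus> x \<otimes> z"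
        using v unfolding adjoin_def by (auto simp: ideal_sum_mem)
      have c: "p \<in> carrier R" "z \<in> carrier R"
        using graded_ideal_carrier[OF P pz(1)] Ip_carrier[OF pz(2)] by auto
      have "u \<otimes> v = u \<otimes> p \<oplus> x \<otimes> (u \<otimes> z)"
        unfolding pz(3) using c xc uc by (simp add: r_distr m_lcomm)
      moreover have "u \<otimes> p \<in> P (Suc n)" using P u pz unfolding graded_ideal_def by blast
      moreover have "u \<otimes> z \<in> Ip (Suc n - i)"
        using ideal_pow_mult_mem[OF I, of u 1 z "n - i"] u pz I True by (simp add: Suc_diff_le)
      ultimately show ?thesis
        unfolding adjoin_def using True by (auto simp: ideal_sum_mem)
    next
      case False
      then have "u \<otimes> v \<in> P (Suc n)" using P u v unfolding adjoin_def graded_ideal_def by auto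
      then show ?thesis using sub by blast
    qed
  qed
qed

text \<open>
  The union of a chain agrees with a member of the chain in every single degree, and being covered
  only concerns one degree.
\<close>

lemma maximal_uncovered:
  assumes P0: "graded_ideal I P0" and unc: "\<not> covered I q P0 t"
  obtains P where "graded_ideal I P" "\<And>n. P0 n \<subseteq> P n" "\<not> covered I q P t"
    "\<And>P'. graded_ideal I P' \<Longrightarrow> (\<And>n. P n \<subseteq> P' n) \<Longrightarrow> \<not> covered I q P' t \<Longrightarrow> P' = P"
proof -
  \<comment> \<open>families are encoded as sets of pairs, ordered by inclusion\<close>
  let ?A = "{Z. graded_ideal I (\<lambda>n. Z `` {n}) \<and> (\<forall>n. P0 n \<subseteq> Z `` {n}) \<and> \<not> covered I q (\<lambda>n. Z `` {n}) t}"
  have sig: "(\<lambda>n. Sigma UNIV P `` {n}) = P" for P :: "nat \<Rightarrow> 'a set" by auto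
  have "\<exists>Z\<in>?A. \<forall>Z'\<in>?A. Z \<subseteq> Z' \<longrightarrow> Z' = Z"
  proof (rule subset_Zorn_nonempty)
    have "Sigma UNIV P0 \<in> ?A" unfolding mem_Collect_eq sig using P0 unc by auto
    then show "?A \<noteq> {}" by blast
    fix C assume C: "C \<noteq> {}" "subset.chain ?A C"
    have CA: "Z \<in> ?A" if "Z \<in> C" for Z using C(2) that by (auto simp: subset.chain_def)
    have comp: "\<exists>Z\<in>C. \<Union>C `` {n} = Z `` {n}" for n
    proof -
      let ?D = "(\<lambda>Z. Z `` {n}) ` C"
      have "subset.chain {J. ideal J R} ?D"
      proof (rule subset.chainI)
        show "?D \<subseteq> {J. ideal J R}" using CA by (auto simp: graded_ideal_def)
        show "(\<subset>)\<^sup>=\<^sup>= J J' \<or> (\<subset>)\<^sup>=\<^sup>= J' J" if "J \<in> ?D" "J' \<in> ?D" for J J'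
          using that C(2) unfolding subset.chain_def by (auto; blast)
      qed
      then have "\<Union>?D \<in> ?D" using C(1) by (intro ideal_chain_is_trivial) auto
      moreover have "\<Union>?D = \<Union>C `` {n}" by blast
      ultimately show ?thesis by auto
    qed
    have "graded_ideal I (\<lambda>n. \<Union>C `` {n})"
      unfolding graded_ideal_def
    proof (intro conjI allI ballI)
      fix n
      obtain Z where Z: "Z \<in> C" "\<Union>C `` {n} = Z `` {n}" using comp by blast
      show "ideal (\<Union>C `` {n}) R" "M \<cdot> ideal_pow R I n \<subseteq> \<Union>C `` {n}" "\<Union>C `` {n} \<subseteq> ideal_pow R I n"
        unfolding Z(2) using CA[OF Z(1)] by (auto simp: graded_ideal_def)
      fix x y assume "x \<in> I" "y \<in> \<Union>C `` {n}"
      then have "x \<otimes> y \<in> Z `` {Suc n}"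
        unfolding Z(2) using CA[OF Z(1)] by (auto simp: graded_ideal_def)
      then show "x \<otimes> y \<in> \<Union>C `` {Suc n}" using Z(1) by blast
    qed
    moreover have "\<forall>n. P0 n \<subseteq> \<Union>C `` {n}"
      using C(1) CA by blast
    moreover have "\<not> covered I q (\<lambda>n. \<Union>C `` {n}) t"
    proof
      assume "covered I q (\<lambda>n. \<Union>C `` {n}) t"
      then obtain e n where en: "\<forall>i\<in>{1..t}. e i \<in> q"
        "Ip (Suc n) \<subseteq> \<Union>C `` {Suc n} <+> (Idl (e ` {1..t})) \<cdot> Ip n"
        unfolding covered_def by blast
      obtain Z where Z: "Z \<in> C" "\<Union>C `` {Suc n} = Z `` {Suc n}" using comp by blast
      then have "covered I q (\<lambda>n. Z `` {n}) t" using en unfolding covered_def by metis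
      then show False using CA[OF Z(1)] by blast
    qed
    ultimately show "\<Union>C \<in> ?A" by simp
  qed
  then obtain Z where ZA: "Z \<in> ?A" and max: "\<forall>Z'\<in>?A. Z \<subseteq> Z' \<longrightarrow> Z' = Z" ..
  show thesis
  proof (rule that[of "\<lambda>n. Z `` {n}"])
    show "graded_ideal I (\<lambda>n. Z `` {n})" "\<And>n. P0 n \<subseteq> Z `` {n}" "\<not> covered I q (\<lambda>n. Z `` {n}) t"
      using ZA by auto
    fix P' assume P': "graded_ideal I P'" "\<And>n. Z `` {n} \<subseteq> P' n" "\<not> covered I q P' t"
    have "Sigma UNIV P' \<in> ?A" unfolding mem_Collect_eq sig using P' ZA by blast
    moreover have "Z \<subseteq> Sigma UNIV P'" using P'(2) by auto
    ultimately have "Sigma UNIV P' = Z" using max by blast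
    then show "P' = (\<lambda>n. Z `` {n})" using sig[of P'] by simp
  qed
qed

lemma covered_if_contains_degree_one:
  assumes P: "graded_ideal I P" and "I \<subseteq> P (Suc 0)"
  shows "covered I q P t"
proof -
  have "ideal (P (Suc 0)) R" using P by (simp add: graded_ideal_def)
  moreover have "ideal ((Idl ((\<lambda>_. \<zero>) ` {1..t})) \<cdot> Ip 0) R"
    by (intro ideal_prod_is_ideal Ip_ideal genideal_ideal) auto
  ultimately have "Ip (Suc 0) \<subseteq> P (Suc 0) <+> (Idl ((\<lambda>_. \<zero>) ` {1..t})) \<cdot> Ip 0"
    using ideal_sum_upper(1) assms(2) I by fastforce
  then show ?thesis
    unfolding covered_def using ideal_zero_mem[OF q(1)] by (intro exI[of _ "\<lambda>_. \<zero>"]) blast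
qed

text \<open>
  A homogeneous ideal \<open>P\<close> that is maximal among those that are not covered by \<open>t\<close> elements is
  prime: if \<open>x y \<in> P\<close> for homogeneous \<open>x, y \<notin> P\<close>, then common elements \<open>e\<close> cover
  \<open>P + (x)\<close> and \<open>P + (y)\<close>, and the product of the two inclusions shows that they cover \<open>P\<close>.
\<close>

lemma exists_graded_prime:
  assumes inf: "infinite (carrier (R Quot M))"
    and P0: "graded_ideal I P0" and unc: "\<not> covered I q P0 t"
  obtains P where "graded_prime I P" "\<And>n. P0 n \<subseteq> P n" "\<not> covered I q P t"
proof -
  obtain P where P: "graded_ideal I P" "\<And>n. P0 n \<subseteq> P n" "\<not> covered I q P t"
    and max: "\<And>P'. graded_ideal I P' \<Longrightarrow> (\<And>n. P n \<subseteq> P' n) \<Longrightarrow> \<not> covered I q P' t \<Longrightarrow> P' = P"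
    using maximal_uncovered[OF P0 unc] by metis
  have Pid: "ideal (P n) R" for n using P(1) by (simp add: graded_ideal_def)
  have "graded_prime I P"
    unfolding graded_prime_def
  proof (intro conjI allI ballI impI P(1))
    show "\<one> \<notin> P 0"
    proof
      assume "\<one> \<in> P 0"
      then have "I \<subseteq> P (Suc 0)"
        using P(1) ideal.Icarr[OF I] unfolding graded_ideal_def by (metis r_one subsetI)
      then show False using covered_if_contains_degree_one[OF P(1)] P(3) by blast
    qed
    fix i j x y assume x: "x \<in> ideal_pow R I i" and y: "y \<in> ideal_pow R I j" and xy: "x \<otimes> y \<in> P (i + j)"
    show "x \<in> P i \<or> y \<in> P j"
    proof (rule ccontr)
      assume neg: "\<not> ?thesis"
      have cov: "\<exists>e n. (\<forall>i\<in>{1..t}. e i \<in> q) \<and>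
          (\<forall>n'\<ge>n. Ip (Suc n') \<subseteq> adjoin P k z (Suc n') <+> (Idl (e ` {1..t})) \<cdot> Ip n')"
        if z: "z \<in> Ip k" "z \<notin> P k" for z k
      proof -
        have "adjoin P k z \<noteq> P" using graded_ideal_adjoin(3)[OF P(1) z(1)] z(2) by metis
        then have "covered I q (adjoin P k z) t"
          using max[OF graded_ideal_adjoin(1,2)[OF P(1) z(1)]] by blast
        then obtain e n where en: "\<forall>i\<in>{1..t}. e i \<in> q"
          "Ip (Suc n) \<subseteq> adjoin P k z (Suc n) <+> (Idl (e ` {1..t})) \<cdot> Ip n"
          unfolding covered_def by blast
        have E: "ideal (Idl (e ` {1..t})) R"
          using en(1) ideal.Icarr[OF q(1)] by (intro genideal_ideal) auto
        show ?thesis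
          using covering_mono[OF graded_ideal_adjoin(1)[OF P(1) z(1)] E en(2)] en(1) by blast
      qed
      obtain e n where e: "\<forall>i\<in>{1..t}. e i \<in> q"
          "\<And>n'. n' \<ge> n \<Longrightarrow> Ip (Suc n') \<subseteq> adjoin P i x (Suc n') <+> (Idl (e ` {1..t})) \<cdot> Ip n'"
        using cov[OF x] neg by blast
      obtain e' n' where e': "\<forall>i\<in>{1..t}. e' i \<in> q"
          "\<And>k. k \<ge> n' \<Longrightarrow> Ip (Suc k) \<subseteq> adjoin P j y (Suc k) <+> (Idl (e' ` {1..t})) \<cdot> Ip k"
        using cov[OF y] neg by blast
      define N where "N = n + n' + i + j"
      have gid: "ideal (adjoin P i x (Suc N)) R" "ideal (adjoin P j y (Suc N)) R"
        using graded_ideal_adjoin(1)[OF P(1) x] graded_ideal_adjoin(1)[OF P(1) y]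
        by (auto simp: graded_ideal_def)
      have qI: "q \<cdot> Ip N \<subseteq> Ip (Suc N)"
        unfolding ideal_pow_Suc[OF I] using q(2) by (intro ideal_prod_mono) auto
      obtain f where f: "\<forall>i\<in>{1..t}. f i \<in> q"
        "Ip (Suc N) \<subseteq> adjoin P i x (Suc N) <+> (Idl (f ` {1..t})) \<cdot> Ip N"
        "Ip (Suc N) \<subseteq> adjoin P j y (Suc N) <+> (Idl (f ` {1..t})) \<cdot> Ip N"
        using common_combinations[OF inf q(1) gid Ip_ideal Ip_ideal qI e(1) e(2)[of N] e'(1) e'(2)[of N]]
        by (auto simp: N_def)
      let ?E = "Idl (f ` {1..t})"
      have E: "ideal ?E R"
        using f(1) ideal.Icarr[OF q(1)] by (intro genideal_ideal) auto
      let ?T = "P (Suc N + Suc N) <+> ?E \<cdot> Ip (Suc N + N)"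
      have EI: "ideal (?E \<cdot> Ip n) R" for n by (rule ideal_prod_is_ideal[OF E Ip_ideal])
      have T: "ideal ?T R" by (rule add_ideals[OF Pid EI])
      have "Ip (Suc N + Suc N) \<subseteq> ?T"
        unfolding ideal_pow_add[OF I]
      proof (rule ideal_prod_subset[OF T[unfolded ideal_pow_add[OF I]]], unfold ideal_pow_add[OF I, symmetric])
        fix z z' assume z: "z \<in> Ip (Suc N)" and z': "z' \<in> Ip (Suc N)"
        obtain p u g where 1: "p \<in> P (Suc N)" "u \<in> Ip (Suc N - i)" "g \<in> ?E \<cdot> Ip N"
          "z = (p \<oplus> x \<otimes> u) \<oplus> g"
          using subsetD[OF f(2) z] unfolding adjoin_def N_def by (auto simp: ideal_sum_mem)
        obtain p' u' g' where 2: "p' \<in> P (Suc N)" "u' \<in> Ip (Suc N - j)" "g' \<in> ?E \<cdot> Ip N"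
          "z' = (p' \<oplus> y \<otimes> u') \<oplus> g'"
          using subsetD[OF f(3) z'] unfolding adjoin_def N_def by (auto simp: ideal_sum_mem)
        have degs: "i + (Suc N - i) = Suc N" "j + (Suc N - j) = Suc N"
          "(Suc N - i) + (Suc N - j) + (i + j) = Suc N + Suc N"
          by (simp_all add: N_def)
        have PI: "P k \<subseteq> Ip k" for k using P(1) by (simp add: graded_ideal_def)
        have xu: "x \<otimes> u \<in> Ip (Suc N)"
          using ideal_pow_mult_mem[OF I x 1(2)] unfolding degs .
        have yu: "y \<otimes> u' \<in> Ip (Suc N)"
          using ideal_pow_mult_mem[OF I y 2(2)] unfolding degs .
        have c: "p \<in> carrier R" "u \<in> carrier R" "g \<in> carrier R" "x \<in> carrier R"
          "p' \<in> carrier R" "u' \<in> carrier R" "g' \<in> carrier R" "y \<in> carrier R" "z' \<in> carrier R"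
          using 1 2 x y z' ideal.Icarr[OF Pid] Ip_carrier ideal.Icarr[OF EI] by blast+
        have py: "p' \<oplus> y \<otimes> u' \<in> Ip (Suc N)"
          using 2(1) yu PI ideal_add_mem[OF Ip_ideal] by blast
        have px: "p \<oplus> x \<otimes> u \<in> Ip (Suc N)"
          using 1(1) xu PI ideal_add_mem[OF Ip_ideal] by blast
        have t1: "(p' \<oplus> y \<otimes> u') \<otimes> p \<in> P (Suc N + Suc N)"
          by (rule graded_ideal_mult[OF P(1) py 1(1)])
        have t2: "(x \<otimes> u) \<otimes> p' \<in> P (Suc N + Suc N)"
          by (rule graded_ideal_mult[OF P(1) xu 2(1)])
        have t3: "(u \<otimes> u') \<otimes> (x \<otimes> y) \<in> P (Suc N + Suc N)"
        proof -
          have "u \<otimes> u' \<in> Ip ((Suc N - i) + (Suc N - j))"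
            by (rule ideal_pow_mult_mem[OF I 1(2) 2(2)])
          from graded_ideal_mult[OF P(1) this xy] show ?thesis unfolding degs .
        qed
        have t4: "(p \<oplus> x \<otimes> u) \<otimes> g' \<in> ?E \<cdot> Ip (Suc N + N)" by (rule pow_mult_ideal_prod[OF E px 2(3)])
        have t5: "z' \<otimes> g \<in> ?E \<cdot> Ip (Suc N + N)" by (rule pow_mult_ideal_prod[OF E z' 1(3)])
        have "z \<otimes> z' = (p \<oplus> x \<otimes> u) \<otimes> z' \<oplus> z' \<otimes> g"
          unfolding 1(4) using c by algebra
        also have "(p \<oplus> x \<otimes> u) \<otimes> z'
            = ((p' \<oplus> y \<otimes> u') \<otimes> p \<oplus> (x \<otimes> u) \<otimes> p' \<oplus> (u \<otimes> u') \<otimes> (x \<otimes> y)) \<oplus> (p \<oplus> x \<otimes> u) \<otimes> g'"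
          unfolding 2(4) using c by algebra
        finally have eq: "z \<otimes> z' = ((p' \<oplus> y \<otimes> u') \<otimes> p \<oplus> (x \<otimes> u) \<otimes> p' \<oplus> (u \<otimes> u') \<otimes> (x \<otimes> y))
            \<oplus> (p \<oplus> x \<otimes> u) \<otimes> g' \<oplus> z' \<otimes> g" .
        have up: "P (Suc N + Suc N) \<subseteq> ?T" "?E \<cdot> Ip (Suc N + N) \<subseteq> ?T"
          using ideal_sum_upper[OF Pid EI] by auto
        show "z \<otimes> z' \<in> ?T"
          unfolding eq
          using t1 t2 t3 t4 t5 up by (intro ideal_add_mem[OF T]) blast+
      qed
      then have "covered I q P t"
        unfolding covered_def using f(1) by (intro exI[of _ f] conjI exI[of _ "Suc N + N"]) auto
      then show False using P(3) by blast
    qed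
  qed
  then show thesis using that P(2,3) by blast
qed

text \<open>The homogeneous maximal ideal of the fiber cone.\<close>

definition irrelevant :: "nat \<Rightarrow> 'a set" where
  "irrelevant n = (if n = 0 then M else Ip n)"

lemma graded_prime_irrelevant: "graded_prime I irrelevant"
  unfolding graded_prime_def graded_ideal_def
proof (intro conjI allI ballI impI)
  fix n
  show "ideal (irrelevant n) R" using M_ideal Ip_ideal by (simp add: irrelevant_def)
  show "M \<cdot> ideal_pow R I n \<subseteq> irrelevant n" "irrelevant n \<subseteq> ideal_pow R I n"
    using ideal_prod_inter[OF M_ideal Ip_ideal, of n] Icarr by (auto simp: irrelevant_def)
  fix x y assume xy: "x \<in> I" "y \<in> irrelevant n"
  have "y \<in> Ip n" using xy Icarr by (auto simp: irrelevant_def split: if_splits)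
  then show "x \<otimes> y \<in> irrelevant (Suc n)"
    unfolding irrelevant_def using xy(1) by (simp add: ideal_pow_Suc[OF I] ideal_prod.prod)
next
  show "\<one> \<notin> irrelevant 0" using one_notin_M by (simp add: irrelevant_def)
  fix i j x y
  assume "x \<in> ideal_pow R I i" "y \<in> ideal_pow R I j" "x \<otimes> y \<in> irrelevant (i + j)"
  then show "x \<in> irrelevant i \<or> y \<in> irrelevant j"
    using M_prime[of x y] Ip_carrier by (auto simp: irrelevant_def split: if_splits)
qed

text \<open>
  After \<open>P0\<close> has been enlarged to a prime \<open>P\<close>, some element of \<open>q\<close> lies outside of \<open>P\<close>, since
  otherwise \<open>P\<close> would contain all large degrees.  Adjoining this element lowers the number of
  further elements needed by one at most, so the chain continues above \<open>P\<close>.  It ends with the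
  homogeneous maximal ideal.
\<close>

lemma graded_prime_chain:
  assumes inf: "infinite (carrier (R Quot M))"
    and red: "Ip (Suc r) = q \<cdot> Ip r"
  shows "graded_ideal I P0 \<Longrightarrow> \<not> covered I q P0 t \<Longrightarrow>
    \<exists>P. (\<forall>k\<le>Suc t. graded_prime I (P k)) \<and> (\<forall>n. P0 n \<subseteq> P 0 n) \<and>
      (\<forall>k\<le>t. (\<forall>n. P k n \<subseteq> P (Suc k) n) \<and> P k \<noteq> P (Suc k))"
proof (induction t arbitrary: P0)
  case 0
  obtain P where P: "graded_prime I P" "\<And>n. P0 n \<subseteq> P n" "\<not> covered I q P 0"
    using exists_graded_prime[OF inf 0] by metis
  have gP: "graded_ideal I P" using P(1) by (simp add: graded_prime_def)
  have "P n \<subseteq> irrelevant n" for n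
  proof (cases n)
    case 0
    have "ideal (P 0) R" "\<one> \<notin> P 0" using P(1) by (auto simp: graded_prime_def graded_ideal_def)
    then show ?thesis using proper_ideal_le_M 0 by (simp add: irrelevant_def)
  next
    case (Suc k)
    then show ?thesis using gP by (simp add: irrelevant_def graded_ideal_def)
  qed
  moreover have "P \<noteq> irrelevant"
  proof
    assume "P = irrelevant"
    then have "I \<subseteq> P (Suc 0)" using I by (simp add: irrelevant_def)
    then show False using covered_if_contains_degree_one[OF gP] P(3) by blast
  qed
  ultimately show ?case
    using P graded_prime_irrelevant
    by (intro exI[of _ "\<lambda>k. if k = 0 then P else irrelevant"]) auto
next
  case (Suc t)
  obtain P where P: "graded_prime I P" "\<And>n. P0 n \<subseteq> P n" "\<not> covered I q P (Suc t)"
    using exists_graded_prime[OF inf Suc.prems] by metis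
  have gP: "graded_ideal I P" using P(1) by (simp add: graded_prime_def)
  have Pid: "ideal (P n) R" for n using gP by (simp add: graded_ideal_def)
  have "\<not> q \<subseteq> P (Suc 0)"
  proof
    assume *: "q \<subseteq> P (Suc 0)"
    have "Ip (Suc r) \<subseteq> P (Suc r)"
      unfolding red
    proof (rule ideal_prod_subset[OF Pid])
      fix x y assume "x \<in> q" "y \<in> Ip r"
      then have "y \<otimes> x \<in> P (r + Suc 0)" "x \<in> carrier R" "y \<in> carrier R"
        using graded_ideal_mult[OF gP, of y r x "Suc 0"] * ideal.Icarr[OF q(1)] Ip_carrier by auto
      then show "x \<otimes> y \<in> P (Suc r)" by (simp add: m_comm)
    qed
    moreover have "ideal ((Idl ((\<lambda>_. \<zero>) ` {1..Suc t})) \<cdot> Ip r) R"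
      by (intro ideal_prod_is_ideal Ip_ideal genideal_ideal) auto
    ultimately have "Ip (Suc r) \<subseteq> P (Suc r) <+> (Idl ((\<lambda>_. \<zero>) ` {1..Suc t})) \<cdot> Ip r"
      using ideal_sum_upper(1)[OF Pid] by fastforce
    then have "covered I q P (Suc t)"
      unfolding covered_def using ideal_zero_mem[OF q(1)] by (intro exI[of _ "\<lambda>_. \<zero>"]) blast
    then show False using P(3) by blast
  qed
  then obtain w where w: "w \<in> q" "w \<notin> P (Suc 0)" by blast
  have wI: "w \<in> Ip (Suc 0)" using w q(2) I by auto
  have wc: "w \<in> carrier R" using w ideal.Icarr[OF q(1)] by blast
  note adj = graded_ideal_adjoin[OF gP wI]
  have "\<not> covered I q (adjoin P (Suc 0) w) t"
  proof
    assume "covered I q (adjoin P (Suc 0) w) t"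
    then obtain e n where en: "\<forall>i\<in>{1..t}. e i \<in> q"
      "Ip (Suc n) \<subseteq> adjoin P (Suc 0) w (Suc n) <+> (Idl (e ` {1..t})) \<cdot> Ip n"
      unfolding covered_def by blast
    let ?e = "e(Suc t := w)"
    have eq: "?e ` {1..Suc t} = insert w (e ` {1..t})"
      by (auto simp: image_iff atLeastAtMostSuc_conv)
    have ec: "?e ` {1..Suc t} \<subseteq> carrier R" "e ` {1..t} \<subseteq> carrier R"
      unfolding eq using wc en(1) ideal.Icarr[OF q(1)] by auto
    let ?E = "Idl (?e ` {1..Suc t})"
    have E: "ideal ?E R" by (rule genideal_ideal[OF ec(1)])
    have EI: "ideal (?E \<cdot> Ip n) R" by (rule ideal_prod_is_ideal[OF E Ip_ideal])
    have T: "ideal (P (Suc n) <+> ?E \<cdot> Ip n) R" by (rule add_ideals[OF Pid EI])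
    have wE: "w \<in> ?E" using genideal_self[OF ec(1)] eq by blast
    have up: "P (Suc n) \<subseteq> P (Suc n) <+> ?E \<cdot> Ip n" "?E \<cdot> Ip n \<subseteq> P (Suc n) <+> ?E \<cdot> Ip n"
      using ideal_sum_upper[OF Pid EI] by blast+
    have wIp: "(\<otimes>) w ` Ip n \<subseteq> ?E \<cdot> Ip n"
      using ideal_prod.prod[OF wE, of _ "Ip n" R] by (intro image_subsetI)
    have eIp: "(Idl (e ` {1..t})) \<cdot> Ip n \<subseteq> ?E \<cdot> Ip n"
      using subset_Idl_subset[OF ec(1), of "e ` {1..t}"] unfolding eq by (intro ideal_prod_mono) auto
    have "adjoin P (Suc 0) w (Suc n) = P (Suc n) <+> (\<otimes>) w ` Ip n"
      by (simp add: adjoin_def)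
    moreover have "P (Suc n) <+> (\<otimes>) w ` Ip n \<subseteq> P (Suc n) <+> ?E \<cdot> Ip n"
      by (rule ideal_sum_least[OF T up(1) subset_trans[OF wIp up(2)]])
    ultimately have "adjoin P (Suc 0) w (Suc n) <+> (Idl (e ` {1..t})) \<cdot> Ip n
        \<subseteq> P (Suc n) <+> ?E \<cdot> Ip n"
      using ideal_sum_least[OF T _ subset_trans[OF eIp up(2)]] by simp
    then have "covered I q P (Suc t)"
      unfolding covered_def using en w(1)
      by (intro exI[of _ ?e] conjI exI[of _ n]) auto
    then show False using P(3) by blast
  qed
  then obtain Q where Q: "\<forall>k\<le>Suc t. graded_prime I (Q k)" "\<forall>n. adjoin P (Suc 0) w n \<subseteq> Q 0 n"
    "\<forall>k\<le>t. (\<forall>n. Q k n \<subseteq> Q (Suc k) n) \<and> Q k \<noteq> Q (Suc k)"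
    using Suc.IH[OF adj(1)] by blast
  let ?P = "\<lambda>k. case k of 0 \<Rightarrow> P | Suc k \<Rightarrow> Q k"
  have "P n \<subseteq> Q 0 n" for n using adj(2) Q(2) by blast
  moreover have "P \<noteq> Q 0" using adj(3) Q(2) w(2) by blast
  ultimately show ?case
    using P(1,2) Q by (intro exI[of _ ?P]) (auto split: nat.splits)
qed

text \<open>
  By Nakayama's lemma, a covering of the zero ideal of the fiber cone is a reduction equation.
\<close>

lemma reduction_if_covered:
  assumes "covered I q (\<lambda>n. M \<cdot> ideal_pow R I n) t"
  obtains e n where "\<forall>i\<in>{1..t}. e i \<in> q" "ideal_pow R I (Suc n) = (Idl (e ` {1..t})) \<cdot> ideal_pow R I n"
proof -
  obtain e n where en: "\<forall>i\<in>{1..t}. e i \<in> q"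
    "Ip (Suc n) \<subseteq> M \<cdot> Ip (Suc n) <+> (Idl (e ` {1..t})) \<cdot> Ip n"
    using assms unfolding covered_def by blast
  have ec: "e ` {1..t} \<subseteq> q" using en by auto
  have ec': "e ` {1..t} \<subseteq> carrier R" using ec ideal.Icarr[OF q(1)] by blast
  have EI: "ideal ((Idl (e ` {1..t})) \<cdot> Ip n) R"
    by (rule ideal_prod_is_ideal[OF genideal_ideal[OF ec'] Ip_ideal])
  have "Ip (Suc n) \<subseteq> (Idl (e ` {1..t})) \<cdot> Ip n <+> M \<cdot> Ip (Suc n)"
    using en(2) set_add_comm[of "M \<cdot> Ip (Suc n)" "(Idl (e ` {1..t})) \<cdot> Ip n"]
      ideal.Icarr[OF EI] ideal_prod_in_carrier[OF M_ideal Ip_ideal, of "Suc n"] by auto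
  then have "Ip (Suc n) \<subseteq> (Idl (e ` {1..t})) \<cdot> Ip n"
    by (rule nakayama_local[OF EI Ip_ideal])
  moreover have "(Idl (e ` {1..t})) \<cdot> Ip n \<subseteq> Ip (Suc n)"
    unfolding ideal_pow_Suc[OF I] using genideal_minimal[OF q(1) ec] q(2)
    by (intro ideal_prod_mono) auto
  ultimately show thesis using that en(1) by blast
qed

lemma graded_ideal_bottom: "graded_ideal I (\<lambda>n. M \<cdot> ideal_pow R I n)"
  unfolding graded_ideal_def
proof (intro conjI allI ballI)
  fix n
  show "ideal (M \<cdot> ideal_pow R I n) R" by (rule ideal_prod_is_ideal[OF M_ideal Ip_ideal])
  show "M \<cdot> ideal_pow R I n \<subseteq> ideal_pow R I n" using ideal_prod_inter[OF M_ideal Ip_ideal] by blast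
  fix x y assume "x \<in> I" "y \<in> M \<cdot> ideal_pow R I n"
  then show "x \<otimes> y \<in> M \<cdot> ideal_pow R I (Suc n)"
    using pow_mult_ideal_prod[OF M_ideal, of x 1 y n] I by simp
qed simp

end

end

section \<open>Dimension and growth of algebras over the residue field\<close>

text \<open>
  An algebra over the residue field is represented by a ring homomorphism from the local ring
  that annihilates the maximal ideal.
\<close>

locale residue_algebra = noetherian_local_ring R M + F: cring F
  for R (structure) and M and F (structure) +
  fixes \<iota> :: "'a \<Rightarrow> 'c"
  assumes scalar_hom: "\<iota> \<in> ring_hom R F"
    and scalar_M: "x \<in> M \<Longrightarrow> \<iota> x = \<zero>\<^bsub>F\<^esub>"
begin

sublocale h: ring_hom_cring R F \<iota>
  by (intro ring_hom_cring.intro ring_hom_cring_axioms.intro is_cring F.is_cring scalar_hom)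

inductive_set span :: "'c set \<Rightarrow> 'c set" for H where
  span_zero: "\<zero>\<^bsub>F\<^esub> \<in> span H"
| span_step: "c \<in> carrier R \<Longrightarrow> g \<in> H \<Longrightarrow> x \<in> span H \<Longrightarrow> \<iota> c \<otimes>\<^bsub>F\<^esub> g \<oplus>\<^bsub>F\<^esub> x \<in> span H"

lemma span_carrier: "x \<in> span H \<Longrightarrow> H \<subseteq> carrier F \<Longrightarrow> x \<in> carrier F"
  by (induction rule: span.induct) auto

lemma span_add:
  assumes "H \<subseteq> carrier F" "x \<in> span H" "y \<in> span H"
  shows "x \<oplus>\<^bsub>F\<^esub> y \<in> span H"
  using assms(2)
proof (induction rule: span.induct)
  case span_zero
  then show ?case using span_carrier[OF assms(3,1)] assms(3) by simp
next
  case (span_step c g x)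
  have "(\<iota> c \<otimes>\<^bsub>F\<^esub> g \<oplus>\<^bsub>F\<^esub> x) \<oplus>\<^bsub>F\<^esub> y = \<iota> c \<otimes>\<^bsub>F\<^esub> g \<oplus>\<^bsub>F\<^esub> (x \<oplus>\<^bsub>F\<^esub> y)"
    using span_step span_carrier[OF span_step(3) assms(1)] span_carrier[OF assms(3,1)] assms(1)
    by (intro F.a_assoc) auto
  then show ?case using span.span_step[OF span_step(1,2) span_step(4)] by simp
qed

lemma span_mono:
  assumes "H \<subseteq> H'" "x \<in> span H"
  shows "x \<in> span H'"
  using assms(2) by (induction rule: span.induct) (use assms(1) in \<open>auto intro: span.intros\<close>)

lemma span_gen: "H \<subseteq> carrier F \<Longrightarrow> g \<in> H \<Longrightarrow> c \<in> carrier R \<Longrightarrow> \<iota> c \<otimes>\<^bsub>F\<^esub> g \<in> span H"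
  using span.span_step[OF _ _ span.span_zero, of c g H] by (simp add: subset_iff)

lemma span_mult:
  assumes H: "H \<subseteq> carrier F" "H' \<subseteq> carrier F" and b: "b \<in> carrier F"
    and gens: "\<And>g. g \<in> H \<Longrightarrow> b \<otimes>\<^bsub>F\<^esub> g \<in> span H'" and x: "x \<in> span H"
    and scal: "\<And>c y. c \<in> carrier R \<Longrightarrow> y \<in> span H' \<Longrightarrow> \<iota> c \<otimes>\<^bsub>F\<^esub> y \<in> span H'"
  shows "b \<otimes>\<^bsub>F\<^esub> x \<in> span H'"
  using x
proof (induction rule: span.induct)
  case span_zero
  then show ?case using b by (simp add: span.span_zero)
next
  case (span_step c g x)
  have c: "g \<in> carrier F" "x \<in> carrier F" "\<iota> c \<in> carrier F"
    using span_step H span_carrier by auto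
  have "b \<otimes>\<^bsub>F\<^esub> (\<iota> c \<otimes>\<^bsub>F\<^esub> g \<oplus>\<^bsub>F\<^esub> x) = \<iota> c \<otimes>\<^bsub>F\<^esub> (b \<otimes>\<^bsub>F\<^esub> g) \<oplus>\<^bsub>F\<^esub> b \<otimes>\<^bsub>F\<^esub> x"
    using c b by (simp add: F.r_distr F.m_lcomm)
  then show ?case
    using span_add[OF H(2) scal[OF span_step(1) gens[OF span_step(2)]] span_step.IH] by simp
qed

lemma span_scalar:
  assumes H: "H \<subseteq> carrier F" and c: "c \<in> carrier R" and x: "x \<in> span H"
  shows "\<iota> c \<otimes>\<^bsub>F\<^esub> x \<in> span H"
  using x
proof (induction rule: span.induct)
  case span_zero
  then show ?case using c by (simp add: span.span_zero)
next
  case (span_step d g x)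
  have cc: "g \<in> carrier F" "x \<in> carrier F"
    using span_step H span_carrier by auto
  have "\<iota> c \<otimes>\<^bsub>F\<^esub> (\<iota> d \<otimes>\<^bsub>F\<^esub> g \<oplus>\<^bsub>F\<^esub> x) = \<iota> (c \<otimes> d) \<otimes>\<^bsub>F\<^esub> g \<oplus>\<^bsub>F\<^esub> \<iota> c \<otimes>\<^bsub>F\<^esub> x"
    using cc c span_step(1) by (simp add: F.r_distr F.m_assoc)
  then show ?case
    using span.span_step[OF _ span_step(2) span_step.IH, of "c \<otimes> d"] c span_step(1) by simp
qed

lemma span_insert:
  assumes H: "insert g H \<subseteq> carrier F" and x: "x \<in> span (insert g H)"
  shows "\<exists>t\<in>carrier R. \<exists>u\<in>span H. x = \<iota> t \<otimes>\<^bsub>F\<^esub> g \<oplus>\<^bsub>F\<^esub> u"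
  using x
proof (induction rule: span.induct)
  case span_zero
  show ?case using H by (intro bexI[of _ \<zero>] bexI[of _ "\<zero>\<^bsub>F\<^esub>"]) (auto intro: span.span_zero)
next
  case (span_step c g' x)
  then obtain t u where tu: "t \<in> carrier R" "u \<in> span H" "x = \<iota> t \<otimes>\<^bsub>F\<^esub> g \<oplus>\<^bsub>F\<^esub> u" by blast
  have cc: "g \<in> carrier F" "g' \<in> carrier F" "u \<in> carrier F"
    using span_step H tu span_carrier[of u H] by auto
  show ?case
  proof (cases "g' = g")
    case True
    have "\<iota> c \<otimes>\<^bsub>F\<^esub> g' \<oplus>\<^bsub>F\<^esub> x = \<iota> (c \<oplus> t) \<otimes>\<^bsub>F\<^esub> g \<oplus>\<^bsub>F\<^esub> u"
      unfolding tu(3) True using cc span_step(1) tu by (simp add: F.l_distr F.a_assoc)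
    then show ?thesis using tu span_step(1) by (intro bexI[of _ "c \<oplus> t"] bexI[of _ u]) auto
  next
    case False
    then have "\<iota> c \<otimes>\<^bsub>F\<^esub> g' \<oplus>\<^bsub>F\<^esub> u \<in> span H"
      using span_step tu by (intro span.span_step) auto
    moreover have "\<iota> c \<otimes>\<^bsub>F\<^esub> g' \<oplus>\<^bsub>F\<^esub> x = \<iota> t \<otimes>\<^bsub>F\<^esub> g \<oplus>\<^bsub>F\<^esub> (\<iota> c \<otimes>\<^bsub>F\<^esub> g' \<oplus>\<^bsub>F\<^esub> u)"
      unfolding tu(3) using cc span_step(1) tu by (simp add: F.a_lcomm)
    ultimately show ?thesis using tu(1) by blast
  qed
qed

text \<open>
  One generator after the other is eliminated; a coefficient outside of \<open>M\<close> is a unit and serves as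
  the pivot.
\<close>

lemma linear_dependence:
  assumes "finite H" "H \<subseteq> carrier F" "finite W" "card H < card W" "\<And>w. w \<in> W \<Longrightarrow> v w \<in> span H"
  shows "\<exists>c. (\<forall>w\<in>W. c w \<in> carrier R) \<and> (\<exists>w\<in>W. c w \<notin> M) \<and>
    (\<Oplus>\<^bsub>F\<^esub>w\<in>W. \<iota> (c w) \<otimes>\<^bsub>F\<^esub> v w) = \<zero>\<^bsub>F\<^esub>"
  using assms
proof (induction H arbitrary: W v rule: finite_induct)
  case empty
  have "v w = \<zero>\<^bsub>F\<^esub>" if "w \<in> W" for w
    using empty(4)[OF that] by (cases rule: span.cases) auto
  moreover have "W \<noteq> {}" using empty by auto
  ultimately show ?case
    using one_notin_M by (intro exI[of _ "\<lambda>_. \<one>"]) (auto intro: F.add.finprod_one_eqI)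
next
  case (insert g H)
  have H: "H \<subseteq> carrier F" and gc: "g \<in> carrier F" using insert by auto
  have "\<forall>w\<in>W. \<exists>t u. t \<in> carrier R \<and> u \<in> span H \<and> v w = \<iota> t \<otimes>\<^bsub>F\<^esub> g \<oplus>\<^bsub>F\<^esub> u"
    using span_insert[OF insert.prems(1)] insert.prems(4) by blast
  then obtain t u where tu: "\<And>w. w \<in> W \<Longrightarrow> t w \<in> carrier R" "\<And>w. w \<in> W \<Longrightarrow> u w \<in> span H"
    "\<And>w. w \<in> W \<Longrightarrow> v w = \<iota> (t w) \<otimes>\<^bsub>F\<^esub> g \<oplus>\<^bsub>F\<^esub> u w" by metis
  have uc: "u w \<in> carrier F" if "w \<in> W" for w using span_carrier[OF tu(2)[OF that] H] .
  have vc: "v w \<in> carrier F" if "w \<in> W" for w using tu(1,3)[OF that] uc[OF that] gc by simp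
  show ?case
  proof (cases "\<forall>w\<in>W. t w \<in> M")
    case True
    then have "v w \<in> span H" if "w \<in> W" for w
      using tu[OF that] uc[OF that] gc that by (simp add: scalar_M)
    then show ?thesis using insert.IH[OF H insert.prems(2)] insert.prems(3) insert.hyps by force
  next
    case False
    then obtain w0 where w0: "w0 \<in> W" "t w0 \<notin> M" by blast
    obtain y where y: "y \<in> carrier R" "y \<otimes> t w0 = \<one>"
      using unit_if_notin_M[OF tu(1)[OF w0(1)] w0(2)] .
    let ?W = "W - {w0}"
    define v' where "v' w = v w \<ominus>\<^bsub>F\<^esub> \<iota> (t w \<otimes> y) \<otimes>\<^bsub>F\<^esub> v w0" for w
    have v'_span: "v' w \<in> span H" if w: "w \<in> W" for w
    proof -
      have "\<iota> (t w \<otimes> y) \<otimes>\<^bsub>F\<^esub> (\<iota> (t w0) \<otimes>\<^bsub>F\<^esub> g) = \<iota> (t w) \<otimes>\<^bsub>F\<^esub> g"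
      proof -
        have "\<iota> (t w \<otimes> y) \<otimes>\<^bsub>F\<^esub> (\<iota> (t w0) \<otimes>\<^bsub>F\<^esub> g) = \<iota> (t w \<otimes> y \<otimes> t w0) \<otimes>\<^bsub>F\<^esub> g"
          using tu(1)[OF w] tu(1)[OF w0(1)] y(1) gc by (simp add: F.m_assoc)
        also have "t w \<otimes> y \<otimes> t w0 = t w"
          using tu(1)[OF w] tu(1)[OF w0(1)] y by (simp add: m_assoc)
        finally show ?thesis .
      qed
      then have "\<iota> (t w \<otimes> y) \<otimes>\<^bsub>F\<^esub> v w0 = \<iota> (t w) \<otimes>\<^bsub>F\<^esub> g \<oplus>\<^bsub>F\<^esub> \<iota> (t w \<otimes> y) \<otimes>\<^bsub>F\<^esub> u w0"
        using tu(1)[OF w] tu(1)[OF w0(1)] y(1) gc uc[OF w0(1)] tu(3)[OF w0(1)]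
        by (simp add: F.r_distr)
      then have "v' w = (\<iota> (t w) \<otimes>\<^bsub>F\<^esub> g \<oplus>\<^bsub>F\<^esub> u w) \<ominus>\<^bsub>F\<^esub> (\<iota> (t w) \<otimes>\<^bsub>F\<^esub> g \<oplus>\<^bsub>F\<^esub> \<iota> (t w \<otimes> y) \<otimes>\<^bsub>F\<^esub> u w0)"
        unfolding v'_def using tu(3)[OF w] by simp
      also have "\<dots> = \<iota> (\<ominus> (t w \<otimes> y)) \<otimes>\<^bsub>F\<^esub> u w0 \<oplus>\<^bsub>F\<^esub> u w"
      proof -
        define p q where "p = \<iota> (t w) \<otimes>\<^bsub>F\<^esub> g" and "q = \<iota> (t w \<otimes> y)"
        have "p \<in> carrier F" "q \<in> carrier F"
          unfolding p_def q_def using tu(1)[OF w] y(1) gc by auto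
        moreover have "\<iota> (\<ominus> (t w \<otimes> y)) = \<ominus>\<^bsub>F\<^esub> q"
          unfolding q_def using tu(1)[OF w] y(1) by (intro h.hom_a_inv) simp
        ultimately show ?thesis
          unfolding p_def[symmetric] q_def[symmetric] using uc[OF w] uc[OF w0(1)] by algebra
      qed
      also have "\<dots> \<in> span H"
        using tu(1)[OF w] y(1) by (intro span_add[OF H] span_scalar[OF H] tu(2) w w0(1)) auto
      finally show ?thesis .
    qed
    have "card H < card ?W"
      using insert.hyps insert.prems(2,3) w0(1) by (simp add: card_Diff_singleton_if)
    then obtain c where c: "\<forall>w\<in>?W. c w \<in> carrier R" "\<exists>w\<in>?W. c w \<notin> M"
      "(\<Oplus>\<^bsub>F\<^esub>w\<in>?W. \<iota> (c w) \<otimes>\<^bsub>F\<^esub> v' w) = \<zero>\<^bsub>F\<^esub>"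
      using insert.IH[OF H, of ?W v'] insert.prems(2) v'_span by blast
    define c0 where "c0 = (\<ominus> (\<Oplus>w\<in>?W. c w \<otimes> (t w \<otimes> y)))"
    have cty: "(\<lambda>w. c w \<otimes> (t w \<otimes> y)) \<in> ?W \<rightarrow> carrier R"
      using c(1) tu(1) y(1) by auto
    define c' where "c' = c(w0 := c0)"
    let ?s = "\<Oplus>\<^bsub>F\<^esub>w\<in>?W. \<iota> (c w \<otimes> (t w \<otimes> y)) \<otimes>\<^bsub>F\<^esub> v w0"
    have c0c: "c0 \<in> carrier R" unfolding c0_def using cty by simp
    have "(\<Oplus>\<^bsub>F\<^esub>w\<in>W. \<iota> (c' w) \<otimes>\<^bsub>F\<^esub> v w) = (\<Oplus>\<^bsub>F\<^esub>w\<in>insert w0 ?W. \<iota> (c' w) \<otimes>\<^bsub>F\<^esub> v w)"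
      using w0(1) by (simp add: insert_absorb)
    also have "\<dots> = \<iota> (c' w0) \<otimes>\<^bsub>F\<^esub> v w0 \<oplus>\<^bsub>F\<^esub> (\<Oplus>\<^bsub>F\<^esub>w\<in>?W. \<iota> (c' w) \<otimes>\<^bsub>F\<^esub> v w)"
      using insert.prems(2) c(1) c0c vc w0(1) by (intro F.add.finprod_insert) (auto simp: c'_def)
    also have "(\<Oplus>\<^bsub>F\<^esub>w\<in>?W. \<iota> (c' w) \<otimes>\<^bsub>F\<^esub> v w) = (\<Oplus>\<^bsub>F\<^esub>w\<in>?W. \<iota> (c w) \<otimes>\<^bsub>F\<^esub> v w)"
      using c(1) vc by (intro F.finsum_cong') (auto simp: c'_def)
    also have "\<iota> (c' w0) \<otimes>\<^bsub>F\<^esub> v w0 = \<ominus>\<^bsub>F\<^esub> ((\<Oplus>\<^bsub>F\<^esub>w\<in>?W. \<iota> (c w \<otimes> (t w \<otimes> y)) \<otimes>\<^bsub>F\<^esub> v w0))"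
    proof -
      have cty': "(\<lambda>w. \<iota> (c w \<otimes> (t w \<otimes> y))) \<in> ?W \<rightarrow> carrier F"
        using cty by (auto simp: Pi_iff)
      have "\<iota> (c' w0) = \<ominus>\<^bsub>F\<^esub> (\<Oplus>\<^bsub>F\<^esub>w\<in>?W. \<iota> (c w \<otimes> (t w \<otimes> y)))"
        unfolding c'_def c0_def using h.hom_finsum[OF cty] h.hom_a_inv[OF finsum_closed[OF cty]]
        by (simp add: comp_def)
      also have "\<dots> \<otimes>\<^bsub>F\<^esub> v w0 = \<ominus>\<^bsub>F\<^esub> ((\<Oplus>\<^bsub>F\<^esub>w\<in>?W. \<iota> (c w \<otimes> (t w \<otimes> y))) \<otimes>\<^bsub>F\<^esub> v w0)"
        using vc[OF w0(1)] F.finsum_closed[OF cty'] by (simp add: F.l_minus)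
      also have "(\<Oplus>\<^bsub>F\<^esub>w\<in>?W. \<iota> (c w \<otimes> (t w \<otimes> y))) \<otimes>\<^bsub>F\<^esub> v w0
          = (\<Oplus>\<^bsub>F\<^esub>w\<in>?W. \<iota> (c w \<otimes> (t w \<otimes> y)) \<otimes>\<^bsub>F\<^esub> v w0)"
        using vc[OF w0(1)] cty' insert.prems(2) by (intro F.finsum_ldistr) auto
      finally show ?thesis .
    qed
    also have "(\<Oplus>\<^bsub>F\<^esub>w\<in>?W. \<iota> (c w) \<otimes>\<^bsub>F\<^esub> v w)
        = (\<Oplus>\<^bsub>F\<^esub>w\<in>?W. \<iota> (c w) \<otimes>\<^bsub>F\<^esub> v' w \<oplus>\<^bsub>F\<^esub> \<iota> (c w \<otimes> (t w \<otimes> y)) \<otimes>\<^bsub>F\<^esub> v w0)"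
    proof (rule F.finsum_cong')
      fix w assume w: "w \<in> ?W"
      define p q where "p = \<iota> (c w)" and "q = \<iota> (t w \<otimes> y)"
      have pq: "p \<in> carrier F" "q \<in> carrier F"
        unfolding p_def q_def using c(1) tu(1) w y(1) by auto
      have "\<iota> (c w \<otimes> (t w \<otimes> y)) = p \<otimes>\<^bsub>F\<^esub> q"
        unfolding p_def q_def using c(1) tu(1) w y(1) by (intro h.hom_mult) auto
      then show "\<iota> (c w) \<otimes>\<^bsub>F\<^esub> v w = \<iota> (c w) \<otimes>\<^bsub>F\<^esub> v' w \<oplus>\<^bsub>F\<^esub> \<iota> (c w \<otimes> (t w \<otimes> y)) \<otimes>\<^bsub>F\<^esub> v w0"
        unfolding v'_def p_def[symmetric] q_def[symmetric]
        using pq vc[of w] vc[OF w0(1)] w by simp algebra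
    qed (use c(1) tu(1) y(1) vc w0(1) v'_span span_carrier[OF _ H] in \<open>auto simp del: h.hom_mult\<close>)
    also have "\<dots> = (\<Oplus>\<^bsub>F\<^esub>w\<in>?W. \<iota> (c w) \<otimes>\<^bsub>F\<^esub> v' w)
        \<oplus>\<^bsub>F\<^esub> (\<Oplus>\<^bsub>F\<^esub>w\<in>?W. \<iota> (c w \<otimes> (t w \<otimes> y)) \<otimes>\<^bsub>F\<^esub> v w0)"
      using c(1) tu(1) y(1) vc w0(1) v'_span span_carrier[OF _ H]
      by (intro F.finsum_addf) (auto simp del: h.hom_mult)
    finally have total: "(\<Oplus>\<^bsub>F\<^esub>w\<in>W. \<iota> (c' w) \<otimes>\<^bsub>F\<^esub> v w)
        = \<ominus>\<^bsub>F\<^esub> ?s \<oplus>\<^bsub>F\<^esub> ((\<Oplus>\<^bsub>F\<^esub>w\<in>?W. \<iota> (c w) \<otimes>\<^bsub>F\<^esub> v' w) \<oplus>\<^bsub>F\<^esub> ?s)" .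
    have "(\<Oplus>\<^bsub>F\<^esub>w\<in>W. \<iota> (c' w) \<otimes>\<^bsub>F\<^esub> v w) = \<zero>\<^bsub>F\<^esub>"
    proof -
      have "?s \<in> carrier F"
        using cty vc[OF w0(1)] by (intro F.finsum_closed) (auto simp del: h.hom_mult simp: Pi_iff)
      then show ?thesis
        unfolding total c(3) by (simp add: F.l_neg)
    qed
    moreover have "\<forall>w\<in>W. c' w \<in> carrier R" using c(1) c0c by (auto simp: c'_def)
    moreover have "\<exists>w\<in>W. c' w \<notin> M" using c(2) by (auto simp: c'_def)
    ultimately show ?thesis by blast
  qed
qed

text \<open>
  Monomials are given by the lists of their factors and exponents, so that a chain of primes can be
  treated by recursion on the list of its witnesses.
\<close>

fun mon :: "'c list \<Rightarrow> nat list \<Rightarrow> 'c" where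
  "mon (x # xs) (e # es) = x [^]\<^bsub>F\<^esub> e \<otimes>\<^bsub>F\<^esub> mon xs es"
| "mon _ _ = \<one>\<^bsub>F\<^esub>"

abbreviation exponents :: "nat \<Rightarrow> nat \<Rightarrow> nat list set" where
  "exponents t N \<equiv> {es. set es \<subseteq> {..N} \<and> length es = t}"

lemma card_exponents: "card (exponents t N) = (N + 1) ^ t"
  using card_lists_length_eq[of "{..N}" t] by simp

lemma finite_exponents: "finite (exponents t N)"
  using finite_lists_length_eq[of "{..N}" t] by simp

lemma mon_closed: "set xs \<subseteq> carrier F \<Longrightarrow> mon xs es \<in> carrier F"
  by (induction xs es rule: mon.induct) auto

lemma mon_update:
  "set xs \<subseteq> carrier F \<Longrightarrow> i < length xs \<Longrightarrow> length es = length xs \<Longrightarrow>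
    mon xs (es[i := Suc (es ! i)]) = xs ! i \<otimes>\<^bsub>F\<^esub> mon xs es"
proof (induction xs es arbitrary: i rule: mon.induct)
  case (1 x xs e es)
  then show ?case
    by (cases i) (auto simp: mon_closed F.m_ac subset_iff)
qed auto

text \<open>
  The value of a polynomial in \<open>x\<close> is its constant coefficient plus a multiple of \<open>x \<in> Q\<close>, so the
  constant coefficient lies in \<open>Q\<close>.  Once it is zero, a factor \<open>x \<notin> P\<close> can be cancelled.
\<close>

lemma power_sum_mem_prime:
  fixes N :: nat
  assumes P: "primeideal P F" and Q: "ideal Q F" "P \<subseteq> Q" and x: "x \<in> Q" "x \<notin> P"
  shows "(\<And>k. g k \<in> carrier F) \<Longrightarrow> (\<And>k. k \<le> N \<Longrightarrow> g k \<in> Q \<Longrightarrow> g k = \<zero>\<^bsub>F\<^esub>) \<Longrightarrow>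
    (\<Oplus>\<^bsub>F\<^esub>k\<in>{..N}. x [^]\<^bsub>F\<^esub> k \<otimes>\<^bsub>F\<^esub> g k) \<in> P \<Longrightarrow> k \<le> N \<Longrightarrow> g k \<in> Q"
proof (induction N arbitrary: g k)
  case 0
  then show ?case using Q(2) by auto
next
  case (Suc N)
  interpret P: primeideal P F by fact
  interpret Q: ideal Q F by fact
  have xc: "x \<in> carrier F" using x Q.Icarr by blast
  let ?h = "\<Oplus>\<^bsub>F\<^esub>k\<in>{..N}. x [^]\<^bsub>F\<^esub> k \<otimes>\<^bsub>F\<^esub> g (Suc k)"
  have hc: "?h \<in> carrier F" using xc Suc.prems(1) by (intro F.finsum_closed) auto
  have "(\<Oplus>\<^bsub>F\<^esub>k\<in>{..Suc N}. x [^]\<^bsub>F\<^esub> k \<otimes>\<^bsub>F\<^esub> g k)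
      = (\<Oplus>\<^bsub>F\<^esub>k\<in>{..N}. x [^]\<^bsub>F\<^esub> Suc k \<otimes>\<^bsub>F\<^esub> g (Suc k)) \<oplus>\<^bsub>F\<^esub> x [^]\<^bsub>F\<^esub> (0::nat) \<otimes>\<^bsub>F\<^esub> g 0"
    using xc Suc.prems(1) by (intro F.finsum_Suc2) auto
  also have "(\<Oplus>\<^bsub>F\<^esub>k\<in>{..N}. x [^]\<^bsub>F\<^esub> Suc k \<otimes>\<^bsub>F\<^esub> g (Suc k)) = (\<Oplus>\<^bsub>F\<^esub>k\<in>{..N}. x \<otimes>\<^bsub>F\<^esub> (x [^]\<^bsub>F\<^esub> k \<otimes>\<^bsub>F\<^esub> g (Suc k)))"
    using xc Suc.prems(1) by (intro F.finsum_cong') (auto simp: F.m_ac)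
  also have "\<dots> = x \<otimes>\<^bsub>F\<^esub> ?h"
    using xc Suc.prems(1) by (intro F.finsum_rdistr[symmetric]) auto
  finally have eq: "(\<Oplus>\<^bsub>F\<^esub>k\<in>{..Suc N}. x [^]\<^bsub>F\<^esub> k \<otimes>\<^bsub>F\<^esub> g k) = x \<otimes>\<^bsub>F\<^esub> ?h \<oplus>\<^bsub>F\<^esub> g 0"
    using Suc.prems(1) by simp
  have sum: "x \<otimes>\<^bsub>F\<^esub> ?h \<oplus>\<^bsub>F\<^esub> g 0 \<in> P" using Suc.prems(3) unfolding eq .
  have xh: "x \<otimes>\<^bsub>F\<^esub> ?h \<in> Q" by (rule Q.I_r_closed[OF x(1) hc])
  have "(x \<otimes>\<^bsub>F\<^esub> ?h \<oplus>\<^bsub>F\<^esub> g 0) \<ominus>\<^bsub>F\<^esub> x \<otimes>\<^bsub>F\<^esub> ?h \<in> Q"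
    using sum Q(2) xh by (intro ideal_minus_mem[OF Q(1)]) auto
  moreover have "(x \<otimes>\<^bsub>F\<^esub> ?h \<oplus>\<^bsub>F\<^esub> g 0) \<ominus>\<^bsub>F\<^esub> x \<otimes>\<^bsub>F\<^esub> ?h = g 0"
  proof -
    have "x \<otimes>\<^bsub>F\<^esub> ?h \<in> carrier F" "g 0 \<in> carrier F" using xc hc Suc.prems(1) by auto
    then show ?thesis by (simp add: a_minus_def F.a_ac F.r_neg1 F.r_neg2 F.r_neg)
  qed
  ultimately have g0: "g 0 \<in> Q" by simp
  then have "g 0 = \<zero>\<^bsub>F\<^esub>" using Suc.prems(2) by blast
  then have "x \<otimes>\<^bsub>F\<^esub> ?h \<in> P" using sum xc hc by simp
  then have "?h \<in> P" using P.I_prime[OF xc hc] x(2) by blast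
  then have "g (Suc j) \<in> Q" if "j \<le> N" for j
    using Suc.IH[of "\<lambda>k. g (Suc k)" j] Suc.prems(1,2) that by auto
  then show ?case using g0 Suc.prems(4) by (cases k) auto
qed

text \<open>
  A linear relation between the monomials is a polynomial in the first element \<open>x \<in> P 1 - P 0\<close>
  whose coefficients are combinations of the monomials in the other elements.  By the previous lemma,
  these coefficients lie in \<open>P 1\<close>, and the shorter chain above \<open>P 1\<close> shows that they are trivial.
\<close>

lemma chain_monomials_independent:
  "\<lbrakk>\<And>i. i \<le> length xs \<Longrightarrow> primeideal (P i) F;
    \<And>i. i < length xs \<Longrightarrow> P i \<subseteq> P (Suc i) \<and> xs ! i \<in> P (Suc i) \<and> xs ! i \<notin> P i;
    \<And>es. c es \<in> carrier R;
    (\<Oplus>\<^bsub>F\<^esub>es\<in>exponents (length xs) N. \<iota> (c es) \<otimes>\<^bsub>F\<^esub> mon xs es) \<in> P 0;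
    es \<in> exponents (length xs) N\<rbrakk> \<Longrightarrow> c es \<in> M"
proof (induction xs arbitrary: P c es)
  case Nil
  interpret P: primeideal "P 0" F using Nil by simp
  have "exponents 0 N = {[]}" by auto
  then have mem: "\<iota> (c []) \<in> P 0" using Nil(3,4) by simp
  show ?case
  proof (rule ccontr)
    assume "c es \<notin> M"
    moreover have "es = []" using Nil by simp
    ultimately obtain y where "y \<in> carrier R" "y \<otimes> c [] = \<one>"
      using unit_if_notin_M Nil(3) by metis
    then have "\<one>\<^bsub>F\<^esub> = \<iota> y \<otimes>\<^bsub>F\<^esub> \<iota> (c [])"
      using h.hom_mult[of y "c []"] Nil(3) h.hom_one by simp
    also have "\<dots> \<in> P 0" using mem \<open>y \<in> carrier R\<close> by (intro P.I_l_closed) auto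
    finally show False using P.one_imp_carrier P.I_notcarr by simp
  qed
next
  case (Cons x xs)
  let ?E = "exponents (length xs) N"
  have P0: "primeideal (P 0) F" using Cons.prems(1)[of 0] by simp
  have P1: "primeideal (P 1) F" using Cons.prems(1)[of 1] by simp
  interpret P1: primeideal "P 1" F by (rule P1)
  have x: "P 0 \<subseteq> P 1" "x \<in> P 1" "x \<notin> P 0" using Cons.prems(2)[of 0] by auto
  have xc: "x \<in> carrier F" using x P1.Icarr by blast
  have xsc: "set xs \<subseteq> carrier F"
  proof
    fix z assume "z \<in> set xs"
    then obtain i where i: "i < length xs" "z = xs ! i" by (metis in_set_conv_nth)
    then have "z \<in> P (Suc (Suc i))" "primeideal (P (Suc (Suc i))) F"
      using Cons.prems(1)[of "Suc (Suc i)"] Cons.prems(2)[of "Suc i"] by simp_all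
    then show "z \<in> carrier F" using ideal.Icarr[OF primeideal.axioms(1), of "P (Suc (Suc i))" F z] by simp
  qed
  define g where "g k = (\<Oplus>\<^bsub>F\<^esub>es\<in>?E. \<iota> (c (k # es)) \<otimes>\<^bsub>F\<^esub> mon xs es)" for k
  have mc: "mon xs es \<in> carrier F" for es by (rule mon_closed[OF xsc])
  have gc: "g k \<in> carrier F" for k
    unfolding g_def using Cons.prems(3) mc by (intro F.finsum_closed) auto
  have IH: "c (k # es) \<in> M" if "g k \<in> P 1" "es \<in> ?E" for k es
  proof (rule Cons.IH[of "\<lambda>i. P (Suc i)" "\<lambda>es. c (k # es)"])
    show "primeideal (P (Suc i)) F" if "i \<le> length xs" for i
      using Cons.prems(1)[of "Suc i"] that by simp
    show "P (Suc i) \<subseteq> P (Suc (Suc i)) \<and> xs ! i \<in> P (Suc (Suc i)) \<and> xs ! i \<notin> P (Suc i)"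
      if "i < length xs" for i
      using Cons.prems(2)[of "Suc i"] that by simp
  qed (use that Cons.prems(3) in \<open>simp_all add: g_def\<close>)
  have "exponents (length (x # xs)) N = (\<Union>k\<in>{..N}. (#) k ` ?E)"
    by (auto simp: length_Suc_conv image_iff)
  then have "(\<Oplus>\<^bsub>F\<^esub>es\<in>exponents (length (x # xs)) N. \<iota> (c es) \<otimes>\<^bsub>F\<^esub> mon (x # xs) es)
      = (\<Oplus>\<^bsub>F\<^esub>k\<in>{..N}. \<Oplus>\<^bsub>F\<^esub>es\<in>(#) k ` ?E. \<iota> (c es) \<otimes>\<^bsub>F\<^esub> mon (x # xs) es)"
    using Cons.prems(3) xc xsc finite_exponents
    by (simp only:) (intro F.add.finprod_UN_disjoint;
        auto simp: pairwise_def disjnt_def intro!: F.m_closed F.nat_pow_closed mc)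
  also have "\<dots> = (\<Oplus>\<^bsub>F\<^esub>k\<in>{..N}. x [^]\<^bsub>F\<^esub> k \<otimes>\<^bsub>F\<^esub> g k)"
  proof (rule F.finsum_cong')
    fix k
    have "(\<Oplus>\<^bsub>F\<^esub>es\<in>(#) k ` ?E. \<iota> (c es) \<otimes>\<^bsub>F\<^esub> mon (x # xs) es)
        = (\<Oplus>\<^bsub>F\<^esub>es\<in>?E. \<iota> (c (k # es)) \<otimes>\<^bsub>F\<^esub> mon (x # xs) (k # es))"
      using Cons.prems(3) xc mc by (intro F.add.finprod_reindex) (auto simp: inj_on_def)
    also have "\<dots> = (\<Oplus>\<^bsub>F\<^esub>es\<in>?E. x [^]\<^bsub>F\<^esub> k \<otimes>\<^bsub>F\<^esub> (\<iota> (c (k # es)) \<otimes>\<^bsub>F\<^esub> mon xs es))"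
      using Cons.prems(3) xc mc by (intro F.finsum_cong') (auto simp: F.m_lcomm)
    also have "\<dots> = x [^]\<^bsub>F\<^esub> k \<otimes>\<^bsub>F\<^esub> g k"
      unfolding g_def using Cons.prems(3) xc mc finite_exponents
      by (intro F.finsum_rdistr[symmetric]) auto
    finally show "(\<Oplus>\<^bsub>F\<^esub>es\<in>(#) k ` ?E. \<iota> (c es) \<otimes>\<^bsub>F\<^esub> mon (x # xs) es) = x [^]\<^bsub>F\<^esub> k \<otimes>\<^bsub>F\<^esub> g k" .
  qed (use xc gc in auto)
  finally have sum: "(\<Oplus>\<^bsub>F\<^esub>k\<in>{..N}. x [^]\<^bsub>F\<^esub> k \<otimes>\<^bsub>F\<^esub> g k) \<in> P 0"
    using Cons.prems(4) by simp
  have zero: "g k = \<zero>\<^bsub>F\<^esub>" if "g k \<in> P 1" for k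
    unfolding g_def using IH[OF that] mc
    by (intro F.add.finprod_one_eqI) (simp add: scalar_M)
  obtain k es' where es': "es = k # es'" "k \<le> N" "es' \<in> ?E"
    using Cons.prems(5) by (cases es) auto
  have "g k \<in> P 1"
    using power_sum_mem_prime[OF P0 P1.is_ideal x, of g N k] gc zero sum es'(2) by blast
  then show ?case using IH es' by blast
qed

text \<open>
  A chain with more than \<open>s\<close> steps would provide \<open>s + 1\<close> elements with independent monomials.
  There are \<open>(N + 1)\<^sup>s\<^sup>+\<^sup>1\<close> monomials with exponents up to \<open>N\<close>, but they lie in a space whose
  dimension grows with the exponent \<open>s\<close> only.
\<close>

theorem krull_dim_le_growth:
  fixes Fil :: "nat \<Rightarrow> 'c set"
  assumes exhaust: "\<And>x. x \<in> carrier F \<Longrightarrow> \<exists>D. x \<in> Fil D"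
    and mono: "\<And>D D'. D \<le> D' \<Longrightarrow> Fil D \<subseteq> Fil D'"
    and one: "\<one>\<^bsub>F\<^esub> \<in> Fil 0"
    and mult: "\<And>x y i j. x \<in> Fil i \<Longrightarrow> y \<in> Fil j \<Longrightarrow> x \<otimes>\<^bsub>F\<^esub> y \<in> Fil (i + j)"
    and growth: "\<And>N. \<exists>H. finite H \<and> H \<subseteq> carrier F \<and> card H \<le> C * (N + 1) ^ s \<and> Fil N \<subseteq> span H"
  shows "krull_dim F \<le> enat s"
  unfolding krull_dim_def
proof (rule Sup_least)
  fix z assume "z \<in> {enat n |n. \<exists>P. (\<forall>i\<le>n. primeideal (P i) F) \<and> (\<forall>i<n. P i \<subset> P (Suc i))}"
  then obtain n P where z: "z = enat n" and P: "\<And>i. i \<le> n \<Longrightarrow> primeideal (P i) F"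
    and chain: "\<And>i. i < n \<Longrightarrow> P i \<subset> P (Suc i)" by blast
  show "z \<le> enat s"
  proof (rule ccontr)
    assume "\<not> z \<le> enat s"
    then have n: "Suc s \<le> n" using z by simp
    have "\<forall>i<Suc s. \<exists>x. x \<in> P (Suc i) \<and> x \<notin> P i" using chain n by (metis less_le_trans psubsetE subsetI)
    then obtain x where x: "\<And>i. i < Suc s \<Longrightarrow> x i \<in> P (Suc i) \<and> x i \<notin> P i" by metis
    define xs where "xs = map x [0..<Suc s]"
    have len: "length xs = Suc s" by (simp add: xs_def)
    have nth: "xs ! i = x i" if "i < Suc s" for i
      unfolding xs_def using that by (metis add.left_neutral diff_zero length_upt nth_map_upt)
    have xs: "set xs \<subseteq> carrier F"
    proof
      fix y assume "y \<in> set xs"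
      then obtain i where i: "i < Suc s" "y = x i" 
        unfolding xs_def by (metis imageE set_map set_upt atLeastLessThan_iff)
      have "primeideal (P (Suc i)) F" using P i n by simp
      then show "y \<in> carrier F"
        using ideal.Icarr[OF primeideal.axioms(1), of "P (Suc i)" F y] x[OF i(1)] i(2) by simp
    qed
    obtain D where D: "set xs \<subseteq> Fil D"
    proof -
      have "\<exists>D. Y \<subseteq> Fil D" if "finite Y" "Y \<subseteq> carrier F" for Y
        using that
      proof (induction rule: finite_induct)
        case (insert y Y)
        then obtain D D' where "Y \<subseteq> Fil D" "y \<in> Fil D'"
          using exhaust[of y] insert by blast
        then have "insert y Y \<subseteq> Fil (max D D')"
          using mono[of D "max D D'"] mono[of D' "max D D'"] by auto
        then show ?case by blast
      qed auto
      then show thesis using that xs by blast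
    qed
    have pow: "y [^]\<^bsub>F\<^esub> k \<in> Fil (D * k)" if "y \<in> Fil D" for y and k :: nat
    proof (induction k)
      case (Suc k)
      then show ?case using mult[OF Suc that] by (simp add: add.commute)
    qed (simp add: one)
    have mon: "mon ys es \<in> Fil (D * N * length ys)"
      if "set ys \<subseteq> Fil D" "es \<in> exponents (length ys) N" for ys es N
      using that
    proof (induction ys es rule: mon.induct)
      case (1 y ys e es)
      have "y [^]\<^bsub>F\<^esub> e \<in> Fil (D * N)"
        using pow[of y e] mono[of "D * e" "D * N"] 1(2,3) by auto
      then show ?case using mult[OF _ 1(1)] 1(2,3) by (simp add: add.commute)
    qed (use one mono[of 0] in auto)
    define K where "K = D * Suc s + 1"
    define N where "N = C * K ^ s"
    obtain H where H: "finite H" "H \<subseteq> carrier F" "card H \<le> C * (D * N * Suc s + 1) ^ s"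
      "Fil (D * N * Suc s) \<subseteq> span H"
      using growth by blast
    have "D * N * Suc s + 1 \<le> K * (N + 1)"
      unfolding K_def by (simp add: algebra_simps)
    then have "C * (D * N * Suc s + 1) ^ s \<le> C * (K * (N + 1)) ^ s"
      by (intro mult_le_mono2 power_mono) auto
    also have "\<dots> = N * (N + 1) ^ s" by (simp only: N_def power_mult_distrib mult.assoc)
    also have "\<dots> < (N + 1) ^ Suc s" by simp
    finally have "card H < card (exponents (Suc s) N)"
      using H(3) card_exponents[of N "Suc s"] by simp
    moreover have "mon xs es \<in> span H" if "es \<in> exponents (Suc s) N" for es
      using mon[OF D, of es N] that len H(4) by auto
    ultimately obtain c where c: "\<forall>w\<in>exponents (Suc s) N. c w \<in> carrier R"
      "\<exists>w\<in>exponents (Suc s) N. c w \<notin> M"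
      "(\<Oplus>\<^bsub>F\<^esub>es\<in>exponents (Suc s) N. \<iota> (c es) \<otimes>\<^bsub>F\<^esub> mon xs es) = \<zero>\<^bsub>F\<^esub>"
      using linear_dependence[OF H(1,2) finite_exponents] by blast
    define c' where "c' es = (if es \<in> exponents (Suc s) N then c es else \<zero>)" for es
    have c'c: "c' es \<in> carrier R" for es using c(1) by (auto simp: c'_def)
    have "(\<Oplus>\<^bsub>F\<^esub>es\<in>exponents (Suc s) N. \<iota> (c' es) \<otimes>\<^bsub>F\<^esub> mon xs es)
        = (\<Oplus>\<^bsub>F\<^esub>es\<in>exponents (Suc s) N. \<iota> (c es) \<otimes>\<^bsub>F\<^esub> mon xs es)"
      using c(1) mon_closed[OF xs] by (intro F.finsum_cong') (auto simp: c'_def)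
    also have "\<dots> \<in> P 0"
      unfolding c(3) using ideal_zero_mem[OF primeideal.axioms(1)[OF P[of 0]]] by simp
    finally have mem: "(\<Oplus>\<^bsub>F\<^esub>es\<in>exponents (length xs) N. \<iota> (c' es) \<otimes>\<^bsub>F\<^esub> mon xs es) \<in> P 0"
      unfolding len .
    have "c' es \<in> M" if "es \<in> exponents (Suc s) N" for es
    proof (rule chain_monomials_independent[of xs P c' N, OF _ _ c'c mem])
      show "primeideal (P i) F" if "i \<le> length xs" for i using that P n len by simp
      show "P i \<subseteq> P (Suc i) \<and> xs ! i \<in> P (Suc i) \<and> xs ! i \<notin> P i" if "i < length xs" for i
        using that chain[of i] n x[of i] nth[of i] len by auto
    qed (use that len in simp)
    then show False using c(2) by (auto simp: c'_def)
  qed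
qed

end

section \<open>The dimension of the fiber cone\<close>

text \<open>
  The ring laws of the fiber cone are inherited from the Rees algebra along the surjection onto it.
\<close>

lemma cring_image:
  fixes A :: "('x, 'y) ring_scheme" and B :: "('z, 'w) ring_scheme"
  assumes "cring A" and carr: "p ` carrier A = carrier B"
    and mult: "\<And>x y. x \<in> carrier A \<Longrightarrow> y \<in> carrier A \<Longrightarrow> p (x \<otimes>\<^bsub>A\<^esub> y) = p x \<otimes>\<^bsub>B\<^esub> p y"
    and add: "\<And>x y. x \<in> carrier A \<Longrightarrow> y \<in> carrier A \<Longrightarrow> p (x \<oplus>\<^bsub>A\<^esub> y) = p x \<oplus>\<^bsub>B\<^esub> p y"
    and one: "p \<one>\<^bsub>A\<^esub> = \<one>\<^bsub>B\<^esub>" and zero: "p \<zero>\<^bsub>A\<^esub> = \<zero>\<^bsub>B\<^esub>"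
  shows "cring B"
proof -
  interpret A: cring A by fact
  have ex: "\<exists>x\<in>carrier A. z = p x" if "z \<in> carrier B" for z using that carr by blast
  have cl: "p x \<in> carrier B" if "x \<in> carrier A" for x using that carr by blast
  show ?thesis
  proof (rule cringI)
    show "abelian_group B"
    proof (rule abelian_groupI)
      fix x assume "x \<in> carrier B"
      then obtain u where u: "u \<in> carrier A" "x = p u" using ex by blast
      show "\<zero>\<^bsub>B\<^esub> \<oplus>\<^bsub>B\<^esub> x = x"
        unfolding u(2) zero[symmetric] using u(1) by (simp add: add[symmetric])
      show "\<exists>y\<in>carrier B. y \<oplus>\<^bsub>B\<^esub> x = \<zero>\<^bsub>B\<^esub>"
        unfolding u(2) zero[symmetric]
        using u(1) cl by (intro bexI[of _ "p (\<ominus>\<^bsub>A\<^esub> u)"]) (simp_all add: add[symmetric] A.l_neg)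
    next
      show "\<zero>\<^bsub>B\<^esub> \<in> carrier B" unfolding zero[symmetric] by (rule cl) simp
    next
      fix x y z assume "x \<in> carrier B" "y \<in> carrier B" "z \<in> carrier B"
      then obtain u v w where "u \<in> carrier A" "v \<in> carrier A" "w \<in> carrier A" "x = p u" "y = p v" "z = p w"
        using ex by metis
      then show "x \<oplus>\<^bsub>B\<^esub> y \<oplus>\<^bsub>B\<^esub> z = x \<oplus>\<^bsub>B\<^esub> (y \<oplus>\<^bsub>B\<^esub> z)"
        by (simp add: add[symmetric] A.a_assoc)
    next
      fix x y assume "x \<in> carrier B" "y \<in> carrier B"
      then obtain u v where "u \<in> carrier A" "v \<in> carrier A" "x = p u" "y = p v"
        using ex by metis
      then show "x \<oplus>\<^bsub>B\<^esub> y = y \<oplus>\<^bsub>B\<^esub> x" "x \<oplus>\<^bsub>B\<^esub> y \<in> carrier B"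
        by (simp_all add: add[symmetric] A.a_comm cl)
    qed
    show "comm_monoid B"
    proof (rule comm_monoidI)
      fix x assume "x \<in> carrier B"
      then obtain u where u: "u \<in> carrier A" "x = p u" using ex by blast
      show "\<one>\<^bsub>B\<^esub> \<otimes>\<^bsub>B\<^esub> x = x"
        unfolding u(2) one[symmetric] using u(1) by (simp add: mult[symmetric])
    next
      show "\<one>\<^bsub>B\<^esub> \<in> carrier B" unfolding one[symmetric] by (rule cl) simp
    next
      fix x y z assume "x \<in> carrier B" "y \<in> carrier B" "z \<in> carrier B"
      then obtain u v w where "u \<in> carrier A" "v \<in> carrier A" "w \<in> carrier A" "x = p u" "y = p v" "z = p w"
        using ex by metis
      then show "x \<otimes>\<^bsub>B\<^esub> y \<otimes>\<^bsub>B\<^esub> z = x \<otimes>\<^bsub>B\<^esub> (y \<otimes>\<^bsub>B\<^esub> z)"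
        by (simp add: mult[symmetric] A.m_assoc)
    next
      fix x y assume "x \<in> carrier B" "y \<in> carrier B"
      then obtain u v where "u \<in> carrier A" "v \<in> carrier A" "x = p u" "y = p v"
        using ex by metis
      then show "x \<otimes>\<^bsub>B\<^esub> y = y \<otimes>\<^bsub>B\<^esub> x" "x \<otimes>\<^bsub>B\<^esub> y \<in> carrier B"
        by (simp_all add: mult[symmetric] A.m_comm cl)
    qed
    fix x y z assume "x \<in> carrier B" "y \<in> carrier B" "z \<in> carrier B"
    then obtain u v w where "u \<in> carrier A" "v \<in> carrier A" "w \<in> carrier A" "x = p u" "y = p v" "z = p w"
      using ex by metis
    then show "(x \<oplus>\<^bsub>B\<^esub> y) \<otimes>\<^bsub>B\<^esub> z = x \<otimes>\<^bsub>B\<^esub> z \<oplus>\<^bsub>B\<^esub> y \<otimes>\<^bsub>B\<^esub> z"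
      by (simp add: mult[symmetric] add[symmetric] A.l_distr)
  qed
qed

context noetherian_local_ring
begin

text \<open>The elements of the Rees algebra of \<open>I\<close>, as polynomials with coefficients in the powers of \<open>I\<close>.\<close>

definition rees :: "'a set \<Rightarrow> (nat \<Rightarrow> 'a) set" where
  "rees I = {f. (\<forall>n. f n \<in> ideal_pow R I n) \<and> finite {n. f n \<noteq> \<zero>}}"

definition to_cone :: "'a set \<Rightarrow> (nat \<Rightarrow> 'a) \<Rightarrow> nat \<Rightarrow> 'a set" where
  "to_cone I f n = M \<cdot> ideal_pow R I n +> f n"

definition cauchy :: "(nat \<Rightarrow> 'a) \<Rightarrow> (nat \<Rightarrow> 'a) \<Rightarrow> nat \<Rightarrow> 'a" where
  "cauchy f g n = (\<Oplus>i\<in>{..n}. f i \<otimes> g (n - i))"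

context
  fixes I :: "'a set"
  assumes I: "ideal I R"
begin

abbreviation (input) Iq where "Iq \<equiv> ideal_pow R I"
abbreviation (input) MI where "MI n \<equiv> M \<cdot> ideal_pow R I n"
abbreviation (input) cone where "cone \<equiv> fiber_cone R M I"

lemma Iq_ideal: "ideal (Iq n) R" using I by simp

lemma Iq_carrier: "x \<in> Iq n \<Longrightarrow> x \<in> carrier R" using ideal.Icarr[OF Iq_ideal] .

lemma MI_ideal: "ideal (MI n) R" by (rule ideal_prod_is_ideal[OF M_ideal Iq_ideal])

lemma MI_subset: "MI n \<subseteq> Iq n" using ideal_prod_inter[OF M_ideal Iq_ideal] by blast

lemma MI_mult:
  assumes "x \<in> Iq i" "y \<in> MI j"
  shows "x \<otimes> y \<in> MI (i + j)"
  by (rule pow_mult_ideal_prod[OF I I subset_refl M_ideal assms])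

lemma rees_carrier: "f \<in> rees I \<Longrightarrow> f n \<in> carrier R"
  using Iq_carrier by (auto simp: rees_def)

lemma rees_mem: "f \<in> rees I \<Longrightarrow> f n \<in> Iq n" by (simp add: rees_def)

lemma rees_up: "f \<in> rees I \<Longrightarrow> f \<in> up R"
proof -
  assume f: "f \<in> rees I"
  then have "finite {n. f n \<noteq> \<zero>}" by (simp add: rees_def)
  then obtain N where "\<forall>n\<in>{n. f n \<noteq> \<zero>}. n \<le> N" using finite_nat_set_iff_bounded_le by blast
  then have "bound \<zero> N f" by (auto intro!: bound.intro simp: not_less[symmetric])
  then show ?thesis using rees_carrier[OF f] by blast
qed

lemma rees_cauchy: "f \<in> rees I \<Longrightarrow> g \<in> rees I \<Longrightarrow> cauchy f g \<in> rees I"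
proof -
  assume f: "f \<in> rees I" and g: "g \<in> rees I"
  have "cauchy f g n \<in> Iq n" for n
    unfolding cauchy_def
  proof (rule finsum_mem_ideal[OF Iq_ideal])
    fix i assume "i \<in> {..n}"
    then show "f i \<otimes> g (n - i) \<in> Iq n"
      using ideal_pow_mult_mem[OF I rees_mem[OF f] rees_mem[OF g], of i "n - i"] by simp
  qed
  moreover have "finite {n. cauchy f g n \<noteq> \<zero>}"
  proof (rule finite_subset)
    show "{n. cauchy f g n \<noteq> \<zero>} \<subseteq> (\<lambda>(i, j). i + j) ` ({n. f n \<noteq> \<zero>} \<times> {n. g n \<noteq> \<zero>})"
    proof
      fix n assume n: "n \<in> {n. cauchy f g n \<noteq> \<zero>}"
      have "\<exists>i\<le>n. f i \<noteq> \<zero> \<and> g (n - i) \<noteq> \<zero>"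
      proof (rule ccontr)
        assume "\<not> ?thesis"
        then have "f i \<otimes> g (n - i) = \<zero>" if "i \<in> {..n}" for i
          using that rees_carrier[OF f] rees_carrier[OF g] by (metis atMost_iff l_null r_null)
        then have "cauchy f g n = \<zero>" unfolding cauchy_def by (rule add.finprod_one_eqI)
        then show False using n by simp
      qed
      then obtain i where "i \<le> n" "f i \<noteq> \<zero>" "g (n - i) \<noteq> \<zero>" by blast
      then show "n \<in> (\<lambda>(i, j). i + j) ` ({n. f n \<noteq> \<zero>} \<times> {n. g n \<noteq> \<zero>})"
        by (intro image_eqI[of _ _ "(i, n - i)"]) auto
    qed
    show "finite ((\<lambda>(i, j). i + j) ` ({n. f n \<noteq> \<zero>} \<times> {n. g n \<noteq> \<zero>}))"
      using f g by (simp add: rees_def)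
  qed
  ultimately show ?thesis by (simp add: rees_def)
qed

lemma rees_add: "f \<in> rees I \<Longrightarrow> g \<in> rees I \<Longrightarrow> (\<lambda>n. f n \<oplus> g n) \<in> rees I"
proof -
  assume f: "f \<in> rees I" and g: "g \<in> rees I"
  have "{n. f n \<oplus> g n \<noteq> \<zero>} \<subseteq> {n. f n \<noteq> \<zero>} \<union> {n. g n \<noteq> \<zero>}" by auto
  then have "finite {n. f n \<oplus> g n \<noteq> \<zero>}"
    using f g unfolding rees_def by (metis (no_types, lifting) finite_UnI finite_subset mem_Collect_eq)
  then show ?thesis using f g ideal_add_mem[OF Iq_ideal] by (simp add: rees_def)
qed

definition homogeneous :: "nat \<Rightarrow> 'a \<Rightarrow> nat \<Rightarrow> 'a" where
  "homogeneous n x k = (if k = n then x else \<zero>)"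

lemma homogeneous_rees: "x \<in> Iq n \<Longrightarrow> homogeneous n x \<in> rees I"
proof -
  assume x: "x \<in> Iq n"
  have "{k. homogeneous n x k \<noteq> \<zero>} \<subseteq> {n}" by (auto simp: homogeneous_def)
  then have "finite {k. homogeneous n x k \<noteq> \<zero>}" by (rule finite_subset) simp
  then show ?thesis using x ideal_zero_mem[OF Iq_ideal] by (simp add: rees_def homogeneous_def)
qed

definition rees_ring where "rees_ring = (UP R)\<lparr>carrier := rees I\<rparr>"

text \<open>
  The Rees algebra is a subring of the ring of univariate polynomials.
\<close>

lemma rees_ring_cring: "cring rees_ring"
proof -
  have sub: "rees I \<subseteq> carrier (UP R)" using rees_up by (auto simp: UP_def)
  have cf: "up_ring.coeff (UP R) p n = p n" if "p \<in> carrier (UP R)" for p n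
    using that by (simp add: UP_def)
  have one: "\<one>\<^bsub>UP R\<^esub> \<in> rees I"
    using homogeneous_rees[of \<one> 0] by (simp add: UP_def homogeneous_def[abs_def])
  have mult: "f \<otimes>\<^bsub>UP R\<^esub> g \<in> rees I" if "f \<in> rees I" "g \<in> rees I" for f g
    using rees_cauchy[OF that] rees_up that by (simp add: UP_def cauchy_def[abs_def])
  have add: "f \<oplus>\<^bsub>UP R\<^esub> g \<in> rees I" if "f \<in> rees I" "g \<in> rees I" for f g
    using rees_add[OF that] rees_up that by (simp add: UP_def)
  interpret U: UP_cring R "UP R" by (intro UP_cring.intro is_cring)
  have "subring (rees I) (UP R)"
  proof (rule U.P.subringI[OF sub])
    fix f assume f: "f \<in> rees I"
    have fU: "f \<in> carrier (UP R)" using f sub by blast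
    have "(\<ominus>\<^bsub>UP R\<^esub> f) n = \<ominus> f n" for n
      using U.coeff_a_inv[OF fU, of n] unfolding cf[OF fU] cf[OF U.P.a_inv_closed[OF fU]] .
    moreover have "{n. \<ominus> f n \<noteq> \<zero>} \<subseteq> {n. f n \<noteq> \<zero>}" by auto
    then have "finite {n. \<ominus> f n \<noteq> \<zero>}" using f by (simp add: rees_def finite_subset)
    moreover have "\<ominus> f n \<in> Iq n" for n
      using additive_subgroup.a_inv_closed[OF ideal.axioms(1)[OF Iq_ideal] rees_mem[OF f]] .
    ultimately show "\<ominus>\<^bsub>UP R\<^esub> f \<in> rees I" by (simp add: rees_def)
  qed (use one mult add in auto)
  then show ?thesis
    unfolding rees_ring_def
    using U.P.subcringI'[of "rees I"] U.P.subcring_iff[OF sub] by blast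
qed

lemma rees_ring_simps:
  "carrier rees_ring = rees I"
  "f \<in> rees I \<Longrightarrow> g \<in> rees I \<Longrightarrow> f \<otimes>\<^bsub>rees_ring\<^esub> g = cauchy f g"
  "f \<in> rees I \<Longrightarrow> g \<in> rees I \<Longrightarrow> f \<oplus>\<^bsub>rees_ring\<^esub> g = (\<lambda>n. f n \<oplus> g n)"
  "\<one>\<^bsub>rees_ring\<^esub> = homogeneous 0 \<one>"
  "\<zero>\<^bsub>rees_ring\<^esub> = (\<lambda>_. \<zero>)"
  using rees_up by (simp_all add: rees_ring_def UP_def cauchy_def[abs_def] homogeneous_def[abs_def])

lemma coset_eq_iff:
  "x \<in> carrier R \<Longrightarrow> y \<in> carrier R \<Longrightarrow> MI n +> x = MI n +> y \<longleftrightarrow> x \<ominus> y \<in> MI n"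
  using quotient_eq_iff_same_a_r_cos[OF MI_ideal] by simp

lemma coset_zero: "MI n +> \<zero> = MI n"
  using ideal.Icarr[OF MI_ideal] by (intro a_coset_add_zero) auto

lemma coset_mult:
  assumes x: "x \<in> Iq i" and y: "y \<in> Iq j"
  shows "[mod MI (i + j):] (MI i +> x) \<Otimes>\<^bsub>R\<^esub> (MI j +> y) = MI (i + j) +> x \<otimes> y"
proof -
  have "MI (i + j) +> a \<otimes> b = MI (i + j) +> x \<otimes> y" if a: "a \<in> MI i +> x" and b: "b \<in> MI j +> y" for a b
  proof -
    obtain h where h: "h \<in> MI i" "a = h \<oplus> x" using a by (auto simp: a_r_coset_def')
    obtain k where k: "k \<in> MI j" "b = k \<oplus> y" using b by (auto simp: a_r_coset_def')
    have c: "x \<in> carrier R" "y \<in> carrier R" "h \<in> carrier R" "k \<in> carrier R"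
      using Iq_carrier[OF x] Iq_carrier[OF y] ideal.Icarr[OF MI_ideal h(1)] ideal.Icarr[OF MI_ideal k(1)]
      by auto
    have "k \<oplus> y \<in> Iq j" using k(1) MI_subset y ideal_add_mem[OF Iq_ideal] by blast
    then have "(k \<oplus> y) \<otimes> h \<in> MI (j + i)" by (rule MI_mult[OF _ h(1)])
    then have 1: "(k \<oplus> y) \<otimes> h \<in> MI (i + j)" by (simp add: add.commute)
    have 2: "x \<otimes> k \<in> MI (i + j)" by (rule MI_mult[OF x k(1)])
    have "a \<otimes> b \<ominus> x \<otimes> y = (k \<oplus> y) \<otimes> h \<oplus> x \<otimes> k"
      unfolding h(2) k(2) using c by algebra
    then have "a \<otimes> b \<ominus> x \<otimes> y \<in> MI (i + j)" using ideal_add_mem[OF MI_ideal 1 2] by simp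
    moreover have "a \<in> carrier R" "b \<in> carrier R" using h k c by auto
    ultimately show ?thesis using coset_eq_iff c by simp
  qed
  moreover have "x \<in> MI i +> x" "y \<in> MI j +> y"
    using Iq_carrier[OF x] Iq_carrier[OF y] ideal_zero_mem[OF MI_ideal]
    by (force simp: a_r_coset_def')+
  ultimately show ?thesis unfolding rcoset_mult_def by blast
qed

lemma cone_carrier: "carrier cone = to_cone I ` rees I"
proof (intro subset_antisym subsetI)
  fix f assume "f \<in> carrier cone"
  then have f: "\<And>n. \<exists>x\<in>Iq n. f n = MI n +> x" "finite {n. f n \<noteq> MI n}"
    by (simp_all add: fiber_cone_def Let_def)
  then obtain x where x: "\<And>n. x n \<in> Iq n" "\<And>n. f n = MI n +> x n" by metis
  define y where "y n = (if f n = MI n then \<zero> else x n)" for n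
  have "{n. y n \<noteq> \<zero>} \<subseteq> {n. f n \<noteq> MI n}" by (auto simp: y_def)
  then have "finite {n. y n \<noteq> \<zero>}" using f(2) by (rule finite_subset)
  moreover have "y n \<in> Iq n" for n using x ideal_zero_mem[OF Iq_ideal] by (simp add: y_def)
  ultimately have "y \<in> rees I" by (simp add: rees_def)
  moreover have "f n = to_cone I y n" for n
  proof (cases "f n = MI n")
    case True
    then show ?thesis by (simp add: to_cone_def y_def coset_zero)
  next
    case False
    then show ?thesis using x(2)[of n] unfolding to_cone_def y_def by simp
  qed
  ultimately show "f \<in> to_cone I ` rees I" by (intro image_eqI[of f _ y] ext)
next
  fix f assume "f \<in> to_cone I ` rees I"
  then obtain y where y: "y \<in> rees I" "f = to_cone I y" by blast
  have "{n. f n \<noteq> MI n} \<subseteq> {n. y n \<noteq> \<zero>}" using y coset_zero by (auto simp: to_cone_def)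
  then have "finite {n. f n \<noteq> MI n}" using y by (simp add: rees_def finite_subset)
  then show "f \<in> carrier cone"
    using y by (auto simp: fiber_cone_def Let_def to_cone_def rees_def)
qed

lemma to_cone_mult:
  assumes f: "f \<in> rees I" and g: "g \<in> rees I"
  shows "to_cone I (cauchy f g) = to_cone I f \<otimes>\<^bsub>cone\<^esub> to_cone I g"
proof
  fix n
  interpret h: ring_hom_cring R "R Quot MI n" "(+>) (MI n)"
    by (rule ideal.rcos_ring_hom_cring[OF MI_ideal is_cring])
  have c: "(\<lambda>i. f i \<otimes> g (n - i)) \<in> {..n} \<rightarrow> carrier R"
    using rees_carrier[OF f] rees_carrier[OF g] by auto
  have "(to_cone I f \<otimes>\<^bsub>cone\<^esub> to_cone I g) n
      = (\<Oplus>\<^bsub>R Quot MI n\<^esub>i\<in>{..n}. [mod MI n:] (MI i +> f i) \<Otimes>\<^bsub>R\<^esub> (MI (n - i) +> g (n - i)))"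
    by (simp add: fiber_cone_def Let_def to_cone_def)
  also have "\<dots> = (\<Oplus>\<^bsub>R Quot MI n\<^esub>i\<in>{..n}. MI n +> f i \<otimes> g (n - i))"
  proof (rule h.S.finsum_cong')
    fix i assume "i \<in> {..n}"
    then show "[mod MI n:] (MI i +> f i) \<Otimes>\<^bsub>R\<^esub> (MI (n - i) +> g (n - i)) = MI n +> f i \<otimes> g (n - i)"
      using coset_mult[OF rees_mem[OF f] rees_mem[OF g], of i "n - i"] by simp
  qed (use c h.hom_closed in \<open>auto simp: Pi_iff\<close>)
  also have "\<dots> = MI n +> cauchy f g n"
    unfolding cauchy_def using h.hom_finsum[OF c] by (simp add: comp_def)
  finally show "to_cone I (cauchy f g) n = (to_cone I f \<otimes>\<^bsub>cone\<^esub> to_cone I g) n"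
    by (simp add: to_cone_def)
qed

lemma to_cone_add:
  assumes f: "f \<in> rees I" and g: "g \<in> rees I"
  shows "to_cone I (\<lambda>n. f n \<oplus> g n) = to_cone I f \<oplus>\<^bsub>cone\<^esub> to_cone I g"
  using ideal.a_rcos_sum[OF MI_ideal rees_carrier[OF f] rees_carrier[OF g]]
  by (auto simp: fiber_cone_def Let_def to_cone_def)

lemma to_cone_one: "to_cone I (homogeneous 0 \<one>) = \<one>\<^bsub>cone\<^esub>"
  by (rule ext) (simp add: fiber_cone_def Let_def to_cone_def homogeneous_def coset_zero)

lemma to_cone_zero: "to_cone I (\<lambda>_. \<zero>) = \<zero>\<^bsub>cone\<^esub>"
  by (rule ext) (simp add: fiber_cone_def Let_def to_cone_def coset_zero)

lemma cone_cring: "cring cone"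
  by (rule cring_image[OF rees_ring_cring, of "to_cone I"])
    (simp_all add: rees_ring_simps cone_carrier to_cone_mult to_cone_add to_cone_one to_cone_zero)

text \<open>
  The homogeneous element of degree \<open>n\<close> of the fiber cone that is represented by \<open>x\<close>.
  In degree \<open>0\<close>, this is the structure map of the algebra over the residue field.
\<close>

definition form :: "nat \<Rightarrow> 'a \<Rightarrow> nat \<Rightarrow> 'a set" where
  "form n x = to_cone I (homogeneous n x)"

lemma form_closed: "x \<in> Iq n \<Longrightarrow> form n x \<in> carrier cone"
  unfolding form_def cone_carrier using homogeneous_rees by blast

lemma form_add:
  assumes x: "x \<in> Iq n" and y: "y \<in> Iq n"
  shows "form n (x \<oplus> y) = form n x \<oplus>\<^bsub>cone\<^esub> form n y"
proof -
  have "homogeneous n (x \<oplus> y) = (\<lambda>k. homogeneous n x k \<oplus> homogeneous n y k)"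
    by (auto simp: homogeneous_def)
  then show ?thesis
    unfolding form_def using to_cone_add[OF homogeneous_rees[OF x] homogeneous_rees[OF y]] by simp
qed

lemma form_mult:
  assumes x: "x \<in> Iq i" and y: "y \<in> Iq j"
  shows "form i x \<otimes>\<^bsub>cone\<^esub> form j y = form (i + j) (x \<otimes> y)"
proof -
  have c: "x \<in> carrier R" "y \<in> carrier R" using Iq_carrier x y by auto
  have "cauchy (homogeneous i x) (homogeneous j y) n = homogeneous (i + j) (x \<otimes> y) n" for n
  proof (cases "n = i + j")
    case True
    have "cauchy (homogeneous i x) (homogeneous j y) n = (\<Oplus>k\<in>{..n}. if i = k then x \<otimes> y else \<zero>)"
      unfolding cauchy_def using c True by (intro finsum_cong') (auto simp: homogeneous_def)
    also have "\<dots> = x \<otimes> y" using c True by (intro add.finprod_singleton) auto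
    finally show ?thesis using True by (simp add: homogeneous_def)
  next
    case False
    then show ?thesis
      unfolding cauchy_def using c
      by (subst add.finprod_one_eqI) (auto simp: homogeneous_def)
  qed
  then have "cauchy (homogeneous i x) (homogeneous j y) = homogeneous (i + j) (x \<otimes> y)" by blast
  then show ?thesis
    unfolding form_def using to_cone_mult[OF homogeneous_rees[OF x] homogeneous_rees[OF y]] by simp
qed

lemma form_M:
  assumes "x \<in> MI n"
  shows "form n x = \<zero>\<^bsub>cone\<^esub>"
proof -
  have "to_cone I (homogeneous n x) = to_cone I (\<lambda>_. \<zero>)"
    by (rule ext) (simp add: to_cone_def homogeneous_def a_rcos_zero[OF MI_ideal assms] coset_zero)
  then show ?thesis by (simp add: form_def to_cone_zero)
qed

lemma cone_residue_algebra: "residue_algebra R M cone (form 0)"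
proof (intro residue_algebra.intro residue_algebra_axioms.intro)
  show "noetherian_local_ring R M" by unfold_locales
  show "cring cone" by (rule cone_cring)
  show "form 0 \<in> ring_hom R cone"
  proof (rule ring_hom_memI)
    show "form 0 \<one> = \<one>\<^bsub>cone\<^esub>" by (simp add: form_def to_cone_one)
  qed (use form_closed[of _ 0] form_add[of _ 0] form_mult[of _ 0 _ 0] in auto)
  show "form 0 x = \<zero>\<^bsub>cone\<^esub>" if "x \<in> M" for x
    using form_M[of x 0] that ideal_prod_one[OF M_ideal] by simp
qed

interpretation RA: residue_algebra R M cone "form 0"
  by (rule cone_residue_algebra)

definition cone_ideal :: "(nat \<Rightarrow> 'a set) \<Rightarrow> (nat \<Rightarrow> 'a set) set" where
  "cone_ideal P = to_cone I ` {f \<in> rees I. \<forall>n. f n \<in> P n}"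

lemma to_cone_mem_iff:
  assumes P: "graded_ideal I P" and f: "f \<in> rees I"
  shows "to_cone I f \<in> cone_ideal P \<longleftrightarrow> (\<forall>n. f n \<in> P n)"
proof
  assume "to_cone I f \<in> cone_ideal P"
  then obtain g where g: "g \<in> rees I" "\<And>n. g n \<in> P n" "to_cone I f = to_cone I g"
    unfolding cone_ideal_def by blast
  show "\<forall>n. f n \<in> P n"
  proof
    fix n
    have Pid: "ideal (P n) R" "MI n \<subseteq> P n" using P by (auto simp: graded_ideal_def)
    have "MI n +> f n = MI n +> g n" using g(3) unfolding to_cone_def by metis
    then have "f n \<ominus> g n \<in> P n"
      using coset_eq_iff[OF rees_carrier[OF f] rees_carrier[OF g(1)]] Pid(2) by blast
    then have "(f n \<ominus> g n) \<oplus> g n \<in> P n" using g(2) by (intro ideal_add_mem[OF Pid(1)])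
    moreover have "(f n \<ominus> g n) \<oplus> g n = f n"
      using rees_carrier[OF f, of n] rees_carrier[OF g(1), of n] by algebra
    ultimately show "f n \<in> P n" by simp
  qed
qed (use f in \<open>auto simp: cone_ideal_def\<close>)

text \<open>
  Let \<open>i\<close> and \<open>j\<close> be the lowest degrees in which two elements have components outside of \<open>P\<close>.
  All other terms of the component of degree \<open>i + j\<close> of their product lie in \<open>P\<close>.
\<close>

lemma cone_ideal_prime:
  assumes "graded_prime I P"
  shows "primeideal (cone_ideal P) cone"
proof -
  have P: "graded_ideal I P" and one: "\<one> \<notin> P 0"
    and prime: "\<And>i j x y. x \<in> Iq i \<Longrightarrow> y \<in> Iq j \<Longrightarrow> x \<otimes> y \<in> P (i + j) \<Longrightarrow> x \<in> P i \<or> y \<in> P j"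
    using assms unfolding graded_prime_def by blast+
  have Pid: "ideal (P n) R" for n using P by (simp add: graded_ideal_def)
  note mem = to_cone_mem_iff[OF P]
  have mult: "x \<otimes> y \<in> P (i + j)" if "x \<in> Iq i" "y \<in> P j" for x y i j
    by (rule graded_ideal_mult[OF I I subset_refl P that])
  have sub: "cone_ideal P \<subseteq> carrier cone" by (auto simp: cone_ideal_def cone_carrier)
  have cauchy_mem: "cauchy f g n \<in> P n" if f: "f \<in> rees I" and g: "g \<in> rees I" "\<forall>n. g n \<in> P n" for f g n
    unfolding cauchy_def
  proof (rule finsum_mem_ideal[OF Pid])
    fix i assume "i \<in> {..n}"
    then show "f i \<otimes> g (n - i) \<in> P n"
      using mult[OF rees_mem[OF f], of "g (n - i)" "n - i" i] g(2) by simp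
  qed
  have l_closed: "x \<otimes>\<^bsub>cone\<^esub> a \<in> cone_ideal P" if "a \<in> cone_ideal P" "x \<in> carrier cone" for a x
  proof -
    obtain g where g: "g \<in> rees I" "\<forall>n. g n \<in> P n" "a = to_cone I g"
      using \<open>a \<in> cone_ideal P\<close> by (auto simp: cone_ideal_def)
    obtain f where f: "f \<in> rees I" "x = to_cone I f"
      using \<open>x \<in> carrier cone\<close> by (auto simp: cone_carrier)
    show ?thesis
      unfolding f(2) g(3) to_cone_mult[OF f(1) g(1), symmetric]
      using mem[OF rees_cauchy[OF f(1) g(1)]] cauchy_mem[OF f(1) g(1,2)] by blast
  qed
  have add_closed: "a \<oplus>\<^bsub>cone\<^esub> c \<in> cone_ideal P" if "a \<in> cone_ideal P" "c \<in> cone_ideal P" for a c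
  proof -
    obtain g where g: "g \<in> rees I" "\<forall>n. g n \<in> P n" "a = to_cone I g"
      using \<open>a \<in> cone_ideal P\<close> by (auto simp: cone_ideal_def)
    obtain f where f: "f \<in> rees I" "\<forall>n. f n \<in> P n" "c = to_cone I f"
      using \<open>c \<in> cone_ideal P\<close> by (auto simp: cone_ideal_def)
    show ?thesis
      unfolding f(3) g(3) to_cone_add[OF g(1) f(1), symmetric]
      using mem[OF rees_add[OF g(1) f(1)]] ideal_add_mem[OF Pid] f(2) g(2) by blast
  qed
  have ideal: "ideal (cone_ideal P) cone"
  proof (rule idealI)
    show "ring cone" by (rule RA.F.ring_axioms)
    show "subgroup (cone_ideal P) (add_monoid cone)"
    proof (rule RA.F.add.subgroupI)
      show "cone_ideal P \<subseteq> carrier cone" by (rule sub)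
      have "(\<lambda>_. \<zero>) \<in> rees I" using ideal_zero_mem[OF Iq_ideal] by (simp add: rees_def)
      then show "cone_ideal P \<noteq> {}"
        using ideal_zero_mem[OF Pid] unfolding cone_ideal_def by blast
      show "\<ominus>\<^bsub>cone\<^esub> a \<in> cone_ideal P" if a: "a \<in> cone_ideal P" for a
      proof -
        have "\<ominus>\<^bsub>cone\<^esub> a = (\<ominus>\<^bsub>cone\<^esub> \<one>\<^bsub>cone\<^esub>) \<otimes>\<^bsub>cone\<^esub> a"
          using a sub by (simp add: RA.F.l_minus subset_iff)
        then show ?thesis using l_closed[OF a, of "\<ominus>\<^bsub>cone\<^esub> \<one>\<^bsub>cone\<^esub>"] by simp
      qed
      show "a \<oplus>\<^bsub>cone\<^esub> c \<in> cone_ideal P" if "a \<in> cone_ideal P" "c \<in> cone_ideal P" for a c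
        using that by (rule add_closed)
    qed
    fix a x assume ax: "a \<in> cone_ideal P" "x \<in> carrier cone"
    show "x \<otimes>\<^bsub>cone\<^esub> a \<in> cone_ideal P" using ax by (rule l_closed)
    moreover have "a \<otimes>\<^bsub>cone\<^esub> x = x \<otimes>\<^bsub>cone\<^esub> a" using ax sub by (intro RA.F.m_comm) auto
    ultimately show "a \<otimes>\<^bsub>cone\<^esub> x \<in> cone_ideal P" by simp
  qed
  show ?thesis
  proof (rule primeidealI[OF ideal cone_cring])
    have "homogeneous 0 \<one> \<in> rees I" using homogeneous_rees[of \<one> 0] by simp
    then have "\<one>\<^bsub>cone\<^esub> \<notin> cone_ideal P"
      using mem one unfolding to_cone_one[symmetric] by (metis homogeneous_def)
    then show "carrier cone \<noteq> cone_ideal P" using RA.F.one_closed by blast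
    fix x y assume x: "x \<in> carrier cone" and y: "y \<in> carrier cone" and xy: "x \<otimes>\<^bsub>cone\<^esub> y \<in> cone_ideal P"
    obtain f where f: "f \<in> rees I" "x = to_cone I f" using x by (auto simp: cone_carrier)
    obtain g where g: "g \<in> rees I" "y = to_cone I g" using y by (auto simp: cone_carrier)
    have fg: "cauchy f g n \<in> P n" for n
      using xy mem[OF rees_cauchy[OF f(1) g(1)]]
      unfolding f(2) g(2) to_cone_mult[OF f(1) g(1), symmetric] by blast
    show "x \<in> cone_ideal P \<or> y \<in> cone_ideal P"
    proof (rule ccontr)
      assume "\<not> ?thesis"
      then have ex: "\<exists>n. f n \<notin> P n" "\<exists>n. g n \<notin> P n"
        unfolding f(2) g(2) using mem[OF f(1)] mem[OF g(1)] by auto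
      obtain i where i: "f i \<notin> P i" "\<And>k. k < i \<Longrightarrow> f k \<in> P k"
        using iffD1[OF exists_least_iff ex(1)] by blast
      obtain j where j: "g j \<notin> P j" "\<And>k. k < j \<Longrightarrow> g k \<in> P k"
        using iffD1[OF exists_least_iff ex(2)] by blast
      let ?n = "i + j"
      let ?t = "\<lambda>k. f k \<otimes> g (?n - k)"
      have tc: "?t k \<in> carrier R" for k using rees_carrier[OF f(1)] rees_carrier[OF g(1)] by simp
      have rest: "(\<Oplus>k\<in>{..?n} - {i}. ?t k) \<in> P ?n"
      proof (rule finsum_mem_ideal[OF Pid])
        fix k assume k: "k \<in> {..?n} - {i}"
        show "?t k \<in> P ?n"
        proof (cases "k < i")
          case True
          have "g (?n - k) \<otimes> f k \<in> P (?n - k + k)"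
            by (rule mult[OF rees_mem[OF g(1)] i(2)[OF True]])
          then show ?thesis
            using k m_comm[OF rees_carrier[OF f(1)] rees_carrier[OF g(1)], of k "?n - k"] by simp
        next
          case False
          then have "g (?n - k) \<in> P (?n - k)" using k by (intro j(2)) auto
          then show ?thesis using mult[OF rees_mem[OF f(1)], of "g (?n - k)" "?n - k" k] k by simp
        qed
      qed
      have "cauchy f g ?n = (\<Oplus>k\<in>insert i ({..?n} - {i}). ?t k)"
        unfolding cauchy_def by (simp add: insert_absorb)
      also have "\<dots> = ?t i \<oplus> (\<Oplus>k\<in>{..?n} - {i}. ?t k)"
        using tc tc[of i] by (intro add.finprod_insert) auto
      finally have eq: "cauchy f g ?n = ?t i \<oplus> (\<Oplus>k\<in>{..?n} - {i}. ?t k)" .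
      have "cauchy f g ?n \<ominus> (\<Oplus>k\<in>{..?n} - {i}. ?t k) \<in> P ?n"
        by (rule ideal_minus_mem[OF Pid fg rest])
      moreover have "cauchy f g ?n \<ominus> (\<Oplus>k\<in>{..?n} - {i}. ?t k) = ?t i"
        unfolding eq using tc[of i] ideal.Icarr[OF Pid rest]
        by (simp add: a_minus_def a_assoc r_neg)
      ultimately have "f i \<otimes> g j \<in> P (i + j)" by simp
      then show False using prime[OF rees_mem[OF f(1)] rees_mem[OF g(1)]] i(1) j(1) by blast
    qed
  qed
qed

theorem krull_dim_cone_ge:
  assumes prime: "\<And>k. k \<le> n \<Longrightarrow> graded_prime I (P k)"
    and chain: "\<And>k. k < n \<Longrightarrow> (\<forall>i. P k i \<subseteq> P (Suc k) i) \<and> P k \<noteq> P (Suc k)"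
  shows "enat n \<le> krull_dim cone"
  unfolding krull_dim_def
proof (rule Sup_upper)
  have "cone_ideal (P k) \<subset> cone_ideal (P (Suc k))" if k: "k < n" for k
  proof -
    have g: "graded_ideal I (P k)" "graded_ideal I (P (Suc k))"
      using prime[of k] prime[of "Suc k"] k by (auto simp: graded_prime_def)
    have "cone_ideal (P k) \<subseteq> cone_ideal (P (Suc k))"
      using chain[OF k] unfolding cone_ideal_def by blast
    moreover obtain i x where x: "x \<in> P (Suc k) i" "x \<notin> P k i"
      using chain[OF k] by blast
    have xI: "x \<in> Iq i" using g(2) x(1) unfolding graded_ideal_def by blast
    have "to_cone I (homogeneous i x) \<in> cone_ideal (P (Suc k))"
      using to_cone_mem_iff[OF g(2) homogeneous_rees[OF xI]] x(1) g(2) ideal_zero_mem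
      by (auto simp: homogeneous_def graded_ideal_def)
    moreover have "to_cone I (homogeneous i x) \<notin> cone_ideal (P k)"
      using to_cone_mem_iff[OF g(1) homogeneous_rees[OF xI]] x(2) by (auto simp: homogeneous_def)
    ultimately show ?thesis by blast
  qed
  then show "enat n \<in> {enat n |n. \<exists>P. (\<forall>i\<le>n. primeideal (P i) cone) \<and> (\<forall>i<n. P i \<subset> P (Suc i))}"
    using cone_ideal_prime[OF prime] by (auto intro!: exI[of _ "\<lambda>k. cone_ideal (P k)"])
qed

text \<open>
  In the degrees above \<open>r\<close>, the fiber cone is spanned by the products of monomials in \<open>s\<close> elements
  with finitely many elements of degree at most \<open>r\<close>.  So its growth has the exponent \<open>s\<close>.
\<close>

theorem krull_dim_cone_le:
  assumes e: "\<forall>i\<in>{1..s}. e i \<in> I"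
    and red: "Iq (Suc r) = (Idl (e ` {1..s})) \<cdot> Iq r"
  shows "krull_dim cone \<le> enat s"
proof -
  have "\<forall>n. \<exists>S. S \<subseteq> carrier R \<and> finite S \<and> Iq n = Idl S" using finetely_gen[OF Iq_ideal] by blast
  then obtain S where S: "\<And>n. S n \<subseteq> carrier R" "\<And>n. finite (S n)" "\<And>n. Iq n = Idl (S n)" by metis
  have SI: "S n \<subseteq> Iq n" for n using genideal_self[OF S(1)] S(3) by simp
  define G where "G = (\<Union>n\<le>r. form n ` S n)"
  have G: "finite G" "G \<subseteq> carrier cone"
    unfolding G_def using S(2) by (auto intro!: form_closed subsetD[OF SI])
  define bs where "bs = map (\<lambda>i. form 1 (e (Suc i))) [0..<s]"
  have eI: "e i \<in> Iq 1" if "i \<in> {1..s}" for i using e that I by simp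
  have len: "length bs = s" by (simp add: bs_def)
  have bs: "set bs \<subseteq> carrier cone"
    unfolding bs_def using form_closed eI by auto
  define H where "H N = (\<lambda>(es, g). RA.mon bs es \<otimes>\<^bsub>cone\<^esub> g) ` (RA.exponents s N \<times> G)" for N
  have Hfin: "finite (H N)" for N
    unfolding H_def using RA.finite_exponents[of N s] G by simp
  have Hc: "H N \<subseteq> carrier cone" for N
    unfolding H_def using RA.mon_closed[OF bs] G by auto
  have Hcard: "card (H N) \<le> card G * (N + 1) ^ s" for N
  proof -
    have "card (H N) \<le> card (RA.exponents s N \<times> G)"
      unfolding H_def using RA.finite_exponents[of N s] G by (intro card_image_le) simp
    then show ?thesis
      unfolding card_cartesian_product RA.card_exponents by (simp add: mult.commute)
  qed
  have Hmono: "H N \<subseteq> H N'" if "N \<le> N'" for N N'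
    unfolding H_def using that by (intro image_mono Sigma_mono) auto
  have E: "e ` {1..s} \<subseteq> carrier R" using e ideal.Icarr[OF I] by auto
  have form_span: "form n x \<in> RA.span (H n)" if "x \<in> Iq n" for n x
    using that
  proof (induction n arbitrary: x)
    note scalar = RA.span_scalar[OF Hc]
    have base: "form n x \<in> RA.span (H n)" if n: "n \<le> r" and x: "x \<in> Iq n" for n x
    proof -
      have "x \<in> Idl (S n)" using x S(3) by simp
      with S(1)[of n] show ?thesis
      proof (induction rule: Idl_induct)
        case zero
        have "form n \<zero> = \<zero>\<^bsub>cone\<^esub>" by (rule form_M[OF ideal_zero_mem[OF MI_ideal]])
        then show ?case by (simp add: RA.span.span_zero)
      next
        case (gen c y)
        have yG: "form n y \<in> G" unfolding G_def using n gen(2) by blast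
        have rep: "replicate s 0 \<in> RA.exponents s n" by auto
        have "RA.mon zs (replicate (length zs) 0) = \<one>\<^bsub>cone\<^esub>" for zs
          by (induction zs) auto
        then have "RA.mon bs (replicate s 0) = \<one>\<^bsub>cone\<^esub>" using len by metis
        moreover have "form n y \<in> carrier cone" using yG G by blast
        ultimately have "form n y = RA.mon bs (replicate s 0) \<otimes>\<^bsub>cone\<^esub> form n y" by simp
        then have "form n y \<in> H n"
          unfolding H_def using rep yG by (intro image_eqI[of _ _ "(replicate s 0, form n y)"]) auto
        then have "form 0 c \<otimes>\<^bsub>cone\<^esub> form n y \<in> RA.span (H n)"
          using gen(1) by (intro RA.span_gen[OF Hc])
        then show ?case using form_mult[of c 0 y n] gen(1) subsetD[OF SI gen(2)] by simp
      next
        case (add y z)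
        then show ?case
          using form_add[of y n z] RA.span_add[OF Hc] S(3)[of n] by simp
      qed
    qed
    {
      case 0
      then show ?case using base by simp
    next
      case (Suc k)
      show ?case
      proof (cases "Suc k \<le> r")
        case True
        then show ?thesis using base Suc.prems by blast
      next
        case False
        then have k: "r \<le> k" by simp
        have "Iq (Suc k) = (Idl (e ` {1..s})) \<cdot> Iq k"
        proof -
          have "Iq (Suc k) = Iq (Suc r) \<cdot> Iq (k - r)"
            using ideal_pow_add[OF I, of "Suc r" "k - r"] k by simp
          also have "\<dots> = (Idl (e ` {1..s})) \<cdot> (Iq r \<cdot> Iq (k - r))"
            unfolding red using ideal_prod_assoc[OF genideal_ideal[OF E] Iq_ideal Iq_ideal] .
          also have "Iq r \<cdot> Iq (k - r) = Iq k"
            using ideal_pow_add[OF I, of r "k - r"] k by simp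
          finally show ?thesis .
        qed
        then have "x \<in> (Idl (e ` {1..s})) \<cdot> Iq k" using Suc.prems by simp
        then show ?thesis
        proof (induction rule: ideal_prod.induct)
          case (prod u y)
          have step: "form 1 (e i) \<otimes>\<^bsub>cone\<^esub> z \<in> RA.span (H (Suc k))"
            if i: "i \<in> {1..s}" and z: "z \<in> RA.span (H k)" for i z
          proof (rule RA.span_mult[OF Hc[of k] Hc[of "Suc k"] form_closed[OF eI[OF i]] _ z])
            fix g assume "g \<in> H k"
            then obtain es g' where g: "es \<in> RA.exponents s k" "g' \<in> G" "g = RA.mon bs es \<otimes>\<^bsub>cone\<^esub> g'"
              unfolding H_def by auto
            have i': "i - 1 < s" "bs ! (i - 1) = form 1 (e i)" using i by (auto simp: bs_def)
            let ?es = "es[i - 1 := Suc (es ! (i - 1))]"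
            have "es ! (i - 1) \<in> {..k}" using g(1) i' by (auto dest: nth_mem)
            then have es': "?es \<in> RA.exponents s (Suc k)"
              using g(1) set_update_subset_insert[of es "i - 1" "Suc (es ! (i - 1))"]
              by fastforce
            have "RA.mon bs ?es = form 1 (e i) \<otimes>\<^bsub>cone\<^esub> RA.mon bs es"
              using RA.mon_update[OF bs, of "i - 1" es] g(1) i' len by simp
            then have "form 1 (e i) \<otimes>\<^bsub>cone\<^esub> g = RA.mon bs ?es \<otimes>\<^bsub>cone\<^esub> g'"
              unfolding g(3) using RA.mon_closed[OF bs] form_closed[OF eI[OF i]] g(2) G(2)
              by (simp add: RA.F.m_assoc subset_iff)
            then have gH: "form 1 (e i) \<otimes>\<^bsub>cone\<^esub> g \<in> H (Suc k)"
              unfolding H_def using es' g(2) by (intro image_eqI[of _ _ "(?es, g')"]) auto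
            then have "form 0 \<one> \<otimes>\<^bsub>cone\<^esub> (form 1 (e i) \<otimes>\<^bsub>cone\<^esub> g) \<in> RA.span (H (Suc k))"
              by (intro RA.span_gen[OF Hc]) auto
            moreover have "form 1 (e i) \<otimes>\<^bsub>cone\<^esub> g \<in> carrier cone" using gH Hc by blast
            ultimately show "form 1 (e i) \<otimes>\<^bsub>cone\<^esub> g \<in> RA.span (H (Suc k))"
              using RA.h.hom_one by simp
          qed (rule scalar)
          have yc: "y \<in> carrier R" using Iq_carrier[OF prod(2)] .
          from E prod(1) show ?case
          proof (induction rule: Idl_induct)
            case zero
            have "form (Suc k) \<zero> = \<zero>\<^bsub>cone\<^esub>" by (rule form_M[OF ideal_zero_mem[OF MI_ideal]])
            then show ?case using yc by (simp add: RA.span.span_zero)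
          next
            case (gen c v)
            then obtain i where i: "i \<in> {1..s}" "v = e i" by blast
            have "form 0 c \<otimes>\<^bsub>cone\<^esub> (form 1 (e i) \<otimes>\<^bsub>cone\<^esub> form k y) \<in> RA.span (H (Suc k))"
              using scalar[OF gen(1) step[OF i(1) Suc.IH[OF prod(2)]]] .
            moreover have "e i \<otimes> y \<in> Iq (Suc k)"
              using ideal_pow_mult_mem[OF I eI[OF i(1)] prod(2)] by simp
            ultimately have "form (Suc k) (c \<otimes> (e i \<otimes> y)) \<in> RA.span (H (Suc k))"
              using form_mult[OF eI[OF i(1)] prod(2)] form_mult[of c 0 "e i \<otimes> y" "Suc k"] gen(1) by simp
            moreover have "c \<otimes> (e i \<otimes> y) = c \<otimes> v \<otimes> y"
              using gen(1) yc Iq_carrier[OF eI[OF i(1)]] i(2) by (simp add: m_assoc)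
            ultimately show ?case by simp
          next
            case (add v v')
            have vI: "z \<otimes> y \<in> Iq (Suc k)" "z \<in> carrier R" if "z \<in> Idl (e ` {1..s})" for z
            proof -
              have "z \<in> I" using genideal_minimal[OF I] e that by blast
              then show "z \<otimes> y \<in> Iq (Suc k)"
                unfolding ideal_pow_Suc[OF I] using prod(2) by (rule ideal_prod.prod)
              show "z \<in> carrier R" using \<open>z \<in> I\<close> ideal.Icarr[OF I] by blast
            qed
            have "(v \<oplus> v') \<otimes> y = v \<otimes> y \<oplus> v' \<otimes> y"
              using vI(2)[OF add(1)] vI(2)[OF add(2)] yc by (rule l_distr)
            then show ?case
              using form_add[OF vI(1)[OF add(1)] vI(1)[OF add(2)]] RA.span_add[OF Hc add(3,4)] by simp
          qed
        next
          case (sum x1 x2)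
          have "x1 \<in> Iq (Suc k)" "x2 \<in> Iq (Suc k)"
            using sum(1,2) \<open>Iq (Suc k) = (Idl (e ` {1..s})) \<cdot> Iq k\<close> by auto
          then show ?case
            using form_add[of x1 "Suc k" x2] RA.span_add[OF Hc sum(3,4)] by simp
        qed
      qed
    }
  qed
  define Fil where "Fil N = to_cone I ` {f \<in> rees I. \<forall>n>N. f n = \<zero>}" for N
  have Fil_span: "to_cone I f \<in> RA.span (H N)" if "f \<in> rees I" "\<forall>n>K. f n = \<zero>" "K \<le> N" for f K N
    using that
  proof (induction K arbitrary: f)
    case 0
    have "f = homogeneous 0 (f 0)" using 0(2) by (auto simp: homogeneous_def)
    then have "to_cone I f = form 0 (f 0)" unfolding form_def by simp
    then show ?case
      using form_span[OF rees_mem[OF 0(1)], of 0] RA.span_mono[OF Hmono[OF 0(3)]] by simp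
  next
    case (Suc K)
    define g where "g n = (if n = Suc K then \<zero> else f n)" for n
    have "{n. g n \<noteq> \<zero>} \<subseteq> {n. f n \<noteq> \<zero>}" by (auto simp: g_def)
    then have "finite {n. g n \<noteq> \<zero>}" using Suc(2) by (simp add: rees_def finite_subset)
    then have gr: "g \<in> rees I"
      using rees_mem[OF Suc(2)] ideal_zero_mem[OF Iq_ideal] by (simp add: rees_def g_def)
    have g0: "\<forall>n>K. g n = \<zero>" using Suc(3) by (auto simp: g_def)
    have "f = (\<lambda>n. g n \<oplus> homogeneous (Suc K) (f (Suc K)) n)"
      using rees_carrier[OF Suc(2)] by (auto simp: g_def homogeneous_def)
    then have "to_cone I f = to_cone I g \<oplus>\<^bsub>cone\<^esub> form (Suc K) (f (Suc K))"
      unfolding form_def using to_cone_add[OF gr homogeneous_rees[OF rees_mem[OF Suc(2)]]] by metis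
    moreover have "form (Suc K) (f (Suc K)) \<in> RA.span (H N)"
      using form_span[OF rees_mem[OF Suc(2)]] RA.span_mono[OF Hmono[OF Suc(4)]] by blast
    moreover have "to_cone I g \<in> RA.span (H N)" using Suc.IH[OF gr g0] Suc(4) by simp
    ultimately show ?case using RA.span_add[OF Hc] by simp
  qed
  show ?thesis
  proof (rule RA.krull_dim_le_growth[of Fil "card G" s])
    show "\<exists>D. x \<in> Fil D" if x: "x \<in> carrier cone" for x
    proof -
      obtain f where f: "f \<in> rees I" "x = to_cone I f" using x by (auto simp: cone_carrier)
      obtain N where "\<forall>n\<in>{n. f n \<noteq> \<zero>}. n \<le> N"
        using f(1) finite_nat_set_iff_bounded_le unfolding rees_def by blast
      then have "\<forall>n>N. f n = \<zero>" by (auto simp: not_less[symmetric])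
      then show ?thesis using f unfolding Fil_def by blast
    qed
    show "Fil D \<subseteq> Fil D'" if "D \<le> D'" for D D'
      unfolding Fil_def using that by auto
    have "homogeneous 0 \<one> \<in> rees I" using homogeneous_rees[of \<one> 0] by simp
    moreover have "\<forall>n>0. homogeneous 0 \<one> n = \<zero>" by (simp add: homogeneous_def)
    ultimately show "\<one>\<^bsub>cone\<^esub> \<in> Fil 0"
      unfolding Fil_def to_cone_one[symmetric] by blast
    show "x \<otimes>\<^bsub>cone\<^esub> y \<in> Fil (i + j)" if xy: "x \<in> Fil i" "y \<in> Fil j" for x y i j
    proof -
      obtain f where f: "f \<in> rees I" "\<forall>n>i. f n = \<zero>" "x = to_cone I f"
        using xy(1) by (auto simp: Fil_def)
      obtain g where g: "g \<in> rees I" "\<forall>n>j. g n = \<zero>" "y = to_cone I g"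
        using xy(2) by (auto simp: Fil_def)
      have "cauchy f g n = \<zero>" if n: "n > i + j" for n
        unfolding cauchy_def
      proof (rule add.finprod_one_eqI)
        fix k assume "k \<in> {..n}"
        have "f k = \<zero> \<or> g (n - k) = \<zero>" using f(2) g(2) n by (cases "k > i") auto
        then show "f k \<otimes> g (n - k) = \<zero>" using rees_carrier[OF f(1)] rees_carrier[OF g(1)] by auto
      qed
      then show ?thesis
        unfolding f(3) g(3) to_cone_mult[OF f(1) g(1), symmetric] Fil_def
        using rees_cauchy[OF f(1) g(1)] by blast
    qed
    show "\<exists>H. finite H \<and> H \<subseteq> carrier cone \<and> card H \<le> card G * (N + 1) ^ s \<and> Fil N \<subseteq> RA.span H" for N
      using Hfin[of N] Hc[of N] Hcard[of N] Fil_span[of _ N N]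
      by (intro exI[of _ "H N"]) (auto simp: Fil_def)
  qed
qed

end

end

section \<open>Minimal reductions\<close>

context noetherian_local_ring
begin

text \<open>
  The ideal is a reduction of itself with \<open>m\<close> generators, so the dimension is at most \<open>m\<close>, and
  \<^const>\<open>analytic_spread\<close> is its value rather than an arbitrary number.
\<close>

lemma krull_dim_cone_finite:
  fixes a :: "nat \<Rightarrow> 'a"
  assumes a: "\<And>j. j \<in> {1..m} \<Longrightarrow> a j \<in> carrier R" and I: "I = Idl (a ` {1..m})"
  shows "krull_dim (fiber_cone R M I) = enat (analytic_spread R M I)"
proof -
  have ac: "a ` {1..m} \<subseteq> carrier R" using a by auto
  have ideal_I: "ideal I R" unfolding I by (rule genideal_ideal[OF ac])
  have "\<forall>j\<in>{1..m}. a j \<in> I" using genideal_self[OF ac] unfolding I by blast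
  moreover have "ideal_pow R I (Suc 0) = (Idl (a ` {1..m})) \<cdot> ideal_pow R I 0"
    using ideal_I ideal_prod_one[OF ideal_I] unfolding I by simp
  ultimately have "krull_dim (fiber_cone R M I) \<le> enat m"
    by (rule krull_dim_cone_le[OF ideal_I])
  then obtain k where "krull_dim (fiber_cone R M I) = enat k" using enat_ile by blast
  then show ?thesis by (simp add: analytic_spread_def)
qed

lemma analytic_spread_le:
  assumes "ideal I R" and "krull_dim (fiber_cone R M I) = enat d"
    and "\<forall>i\<in>{1..s}. e i \<in> I" "ideal_pow R I (Suc n) = (Idl (e ` {1..s})) \<cdot> ideal_pow R I n"
  shows "d \<le> s"
  using krull_dim_cone_le[OF assms(1,3,4)] unfolding assms(2) by simp

text \<open>
  If the fiber cone were not covered by \<open>d\<close> elements of \<open>q\<close>, it would have a chain of primes with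
  \<open>d + 1\<close> steps.
\<close>

lemma reduction_contains_generated_reduction:
  assumes inf: "infinite (carrier (R Quot M))"
    and "ideal I R" and dim: "krull_dim (fiber_cone R M I) = enat d"
    and q: "ideal q R" "q \<subseteq> I" and red: "ideal_pow R I (Suc r) = q \<cdot> ideal_pow R I r"
  obtains e n where "\<forall>i\<in>{1..d}. e i \<in> q" "ideal_pow R I (Suc n) = (Idl (e ` {1..d})) \<cdot> ideal_pow R I n"
proof (cases "covered I q (\<lambda>n. M \<cdot> ideal_pow R I n) d")
  case True
  then show thesis using reduction_if_covered[OF assms(2) q] that by blast
next
  case False
  obtain P where P: "\<forall>k\<le>Suc d. graded_prime I (P k)"
    "\<forall>k\<le>d. (\<forall>n. P k n \<subseteq> P (Suc k) n) \<and> P k \<noteq> P (Suc k)"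
    using graded_prime_chain[OF assms(2) q inf red graded_ideal_bottom[OF assms(2) q] False] by blast
  have "enat (Suc d) \<le> krull_dim (fiber_cone R M I)"
    using P by (intro krull_dim_cone_ge[OF assms(2), of "Suc d" P]) auto
  then show thesis unfolding dim by simp
qed

text \<open>
  This is the exchange lemma in the vector space \<open>B/MB\<close>: a subspace that does not contain the span
  of \<open>Y\<close> meets it in a space of smaller dimension.  If \<open>w\<close> in the subspace involves \<open>g \<in> Y\<close>,
  it can replace \<open>g\<close>, and the other elements of the subspace are reduced by multiples of \<open>w\<close>.
\<close>

lemma fewer_generators_of_proper_subspace:
  assumes B: "ideal B R" and W: "ideal W R" "M \<cdot> B \<subseteq> W"
  shows "finite Y \<Longrightarrow> Y \<subseteq> B \<Longrightarrow> \<not> Idl Y \<subseteq> W \<Longrightarrow>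
    \<exists>Z\<subseteq>B. finite Z \<and> card Z < card Y \<and> W \<inter> Idl Y \<subseteq> Idl Z <+> M \<cdot> B"
proof (induction Y rule: finite_induct)
  case empty
  have "Idl {} \<subseteq> {\<zero>}" by (rule genideal_minimal[OF zeroideal]) simp
  then show ?case using empty(2) ideal_zero_mem[OF W(1)] by auto
next
  case (insert g Y)
  have Bc: "B \<subseteq> carrier R" using ideal.Icarr[OF B] by blast
  have Y: "Y \<subseteq> B" "Y \<subseteq> carrier R" and g: "g \<in> B" "g \<in> carrier R" using insert.prems(1) Bc by auto
  have gY: "insert g Y \<subseteq> carrier R" using Y g by auto
  have MB: "ideal (M \<cdot> B) R" by (rule ideal_prod_is_ideal[OF M_ideal B])
  have IY: "ideal (Idl Y) R" by (rule genideal_ideal[OF Y(2)])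
  have sum: "ideal (Idl Y <+> M \<cdot> B) R" by (rule add_ideals[OF IY MB])
  show ?case
  proof (cases "W \<inter> Idl (insert g Y) \<subseteq> Idl Y <+> M \<cdot> B")
    case True
    then show ?thesis using insert.hyps Y(1) by (intro exI[of _ Y]) auto
  next
    case False
    then obtain w where w: "w \<in> W" "w \<in> Idl (insert g Y)" "w \<notin> Idl Y <+> M \<cdot> B" by blast
    obtain r y where ry: "r \<in> carrier R" "y \<in> Idl Y" "w = r \<otimes> g \<oplus> y"
      using Idl_insert[OF Y(2) g(2) w(2)] .
    have yc: "y \<in> carrier R" using ideal.Icarr[OF IY ry(2)] .
    have wB: "w \<in> B" using genideal_minimal[OF B insert.prems(1)] w(2) by blast
    have wc: "w \<in> carrier R" using wB Bc by blast
    have "r \<notin> M"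
    proof
      assume "r \<in> M"
      then have "y \<oplus> r \<otimes> g \<in> Idl Y <+> M \<cdot> B"
        using ry(2) ideal_prod.prod[of r M g B R] g(1) unfolding ideal_sum_mem by blast
      then show False using w(3) ry yc g(2) by (simp add: a_comm)
    qed
    then obtain s where s: "s \<in> carrier R" "s \<otimes> r = \<one>" using unit_if_notin_M[OF ry(1)] by blast
    have "s \<otimes> w \<ominus> s \<otimes> y = (s \<otimes> r) \<otimes> g"
      unfolding ry(3) using s(1) ry(1) g(2) yc by algebra
    then have geq: "g = s \<otimes> w \<ominus> s \<otimes> y" using s(2) g(2) by simp
    have "\<not> Idl Y \<subseteq> W"
    proof
      assume YW: "Idl Y \<subseteq> W"
      have "s \<otimes> w \<ominus> s \<otimes> y \<in> W"
        using ideal_minus_mem[OF W(1)] ideal.I_l_closed[OF W(1) _ s(1)] w(1) ry(2) YW by blast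
      then have "insert g Y \<subseteq> W" using geq YW genideal_self[OF Y(2)] by auto
      then show False using insert.prems(2) genideal_minimal[OF W(1)] by blast
    qed
    then obtain Z where Z: "Z \<subseteq> B" "finite Z" "card Z < card Y" "W \<inter> Idl Y \<subseteq> Idl Z <+> M \<cdot> B"
      using insert.IH Y(1) by blast
    have Zc: "Z \<subseteq> carrier R" "insert w Z \<subseteq> carrier R" using Z(1) Bc wc by auto
    have IwZ: "ideal (Idl (insert w Z)) R" by (rule genideal_ideal[OF Zc(2)])
    have T: "ideal (Idl (insert w Z) <+> M \<cdot> B) R" by (rule add_ideals[OF IwZ MB])
    have sub: "Idl Z <+> M \<cdot> B \<subseteq> Idl (insert w Z) <+> M \<cdot> B"
      by (intro ideal_sum_mono subset_Idl_subset[OF Zc(2)]) auto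
    have "v \<in> Idl (insert w Z) <+> M \<cdot> B" if v: "v \<in> W" "v \<in> Idl (insert g Y)" for v
    proof -
      obtain c z where cz: "c \<in> carrier R" "z \<in> Idl Y" "v = c \<otimes> g \<oplus> z"
        using Idl_insert[OF Y(2) g(2) v(2)] .
      have zc: "z \<in> carrier R" using ideal.Icarr[OF IY cz(2)] .
      have csw: "(c \<otimes> s) \<otimes> w \<in> W" using ideal.I_l_closed[OF W(1) w(1)] cz(1) s(1) by simp
      have "z \<ominus> (c \<otimes> s) \<otimes> y \<in> Idl Y"
        using ideal_minus_mem[OF IY cz(2) ideal.I_l_closed[OF IY ry(2)]] cz(1) s(1) by simp
      moreover have zeq: "z \<ominus> (c \<otimes> s) \<otimes> y = v \<ominus> (c \<otimes> s) \<otimes> w"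
      proof -
        have "v = c \<otimes> (s \<otimes> w \<ominus> s \<otimes> y) \<oplus> z" using cz(3) geq by simp
        then show ?thesis using cz(1) s(1) wc yc zc by simp algebra
      qed
      moreover have "v \<ominus> (c \<otimes> s) \<otimes> w \<in> W" using ideal_minus_mem[OF W(1) v(1) csw] .
      ultimately have "v \<ominus> (c \<otimes> s) \<otimes> w \<in> Idl (insert w Z) <+> M \<cdot> B" using Z(4) sub by auto
      moreover have "(c \<otimes> s) \<otimes> w \<in> Idl (insert w Z) <+> M \<cdot> B"
        using ideal.I_l_closed[OF IwZ, of w "c \<otimes> s"] genideal_self[OF Zc(2)] cz(1) s(1)
          ideal_sum_upper(1)[OF IwZ MB] by auto
      ultimately have "(v \<ominus> (c \<otimes> s) \<otimes> w) \<oplus> (c \<otimes> s) \<otimes> w \<in> Idl (insert w Z) <+> M \<cdot> B"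
        by (rule ideal_add_mem[OF T])
      moreover have "(v \<ominus> (c \<otimes> s) \<otimes> w) \<oplus> (c \<otimes> s) \<otimes> w = v"
        using ideal.Icarr[OF W(1) v(1)] cz(1) s(1) wc by algebra
      ultimately show ?thesis by simp
    qed
    moreover have "card (insert w Z) < card (insert g Y)"
      using Z(2,3) insert.hyps by (simp add: card_insert_if)
    ultimately show ?thesis
      using Z(1,2) wB by (intro exI[of _ "insert w Z"]) auto
  qed
qed

text \<open>
  Up to \<open>MI\<close>, a properly contained reduction would be generated by fewer than \<open>d\<close> elements, which
  then generate a reduction by Nakayama's lemma.  This contradicts the bound on the dimension.
\<close>

lemma generated_reduction_is_minimal:
  assumes "ideal I R" and dim: "krull_dim (fiber_cone R M I) = enat d"
    and e: "\<forall>i\<in>{1..d}. e i \<in> I" and red: "ideal_pow R I (Suc n) = (Idl (e ` {1..d})) \<cdot> ideal_pow R I n"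
  shows "minimal_reduction R (Idl (e ` {1..d})) I"
proof -
  let ?Q = "Idl (e ` {1..d})"
  have Ic: "I \<subseteq> carrier R" using ideal.Icarr[OF assms(1)] by blast
  have ec: "e ` {1..d} \<subseteq> carrier R" using e Ic by auto
  have Q: "ideal ?Q R" by (rule genideal_ideal[OF ec])
  have QI: "?Q \<subseteq> I" using e by (intro genideal_minimal[OF assms(1)]) auto
  have "Q' = ?Q" if Q': "reduction R Q' I" "Q' \<subseteq> ?Q" for Q'
  proof (rule ccontr)
    assume ne: "Q' \<noteq> ?Q"
    have idQ': "ideal Q' R" using Q'(1) by (simp add: reduction_def)
    obtain k where k: "ideal_pow R I (Suc k) = Q' \<cdot> ideal_pow R I k"
      using Q'(1) by (auto simp: reduction_def)
    have MQ: "ideal (M \<cdot> ?Q) R" by (rule ideal_prod_is_ideal[OF M_ideal Q])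
    let ?W = "Q' <+> M \<cdot> ?Q"
    have W: "ideal ?W R" by (rule add_ideals[OF idQ' MQ])
    have "\<not> ?Q \<subseteq> ?W"
      using nakayama_local[OF idQ' Q] ne Q'(2) by blast
    then obtain Z where Z: "Z \<subseteq> ?Q" "finite Z" "card Z < card (e ` {1..d})"
      "?W \<inter> ?Q \<subseteq> Idl Z <+> M \<cdot> ?Q"
      using fewer_generators_of_proper_subspace[OF Q W ideal_sum_upper(2)[OF idQ' MQ], of "e ` {1..d}"]
        genideal_self[OF ec] by blast
    have cardZ: "card Z < d" using Z(3) card_image_le[of "{1..d}" e] by simp
    have Zc: "Z \<subseteq> carrier R" using Z(1) ideal.Icarr[OF Q] by blast
    have IZ: "ideal (Idl Z) R" by (rule genideal_ideal[OF Zc])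
    have Ip: "ideal (ideal_pow R I j) R" for j using assms(1) by simp
    have ZI: "ideal ((Idl Z) \<cdot> ideal_pow R I k) R" by (rule ideal_prod_is_ideal[OF IZ Ip])
    have MI: "ideal (M \<cdot> ideal_pow R I (Suc k)) R" by (rule ideal_prod_is_ideal[OF M_ideal Ip])
    have T: "ideal ((Idl Z) \<cdot> ideal_pow R I k <+> M \<cdot> ideal_pow R I (Suc k)) R"
      by (rule add_ideals[OF ZI MI])
    have "ideal_pow R I (Suc k) \<subseteq> (Idl Z) \<cdot> ideal_pow R I k <+> M \<cdot> ideal_pow R I (Suc k)"
      unfolding k
    proof (rule ideal_prod_subset[OF T[unfolded k]], unfold k[symmetric])
      fix x y assume xy: "x \<in> Q'" "y \<in> ideal_pow R I k"
      have xW: "x \<in> ?W \<inter> ?Q" using xy(1) Q'(2) ideal_sum_upper(1)[OF idQ' MQ] by blast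
      obtain z u where zu: "z \<in> Idl Z" "u \<in> M \<cdot> ?Q" "x = z \<oplus> u"
        using subsetD[OF Z(4) xW] unfolding ideal_sum_mem by blast
      have c: "z \<in> carrier R" "u \<in> carrier R" "y \<in> carrier R"
        using ideal.Icarr[OF IZ zu(1)] ideal.Icarr[OF MQ zu(2)] ideal.Icarr[OF Ip xy(2)] by auto
      have "u \<otimes> y \<in> (M \<cdot> ?Q) \<cdot> ideal_pow R I k" using zu(2) xy(2) by (rule ideal_prod.prod)
      also have "(M \<cdot> ?Q) \<cdot> ideal_pow R I k = M \<cdot> (?Q \<cdot> ideal_pow R I k)"
        by (rule ideal_prod_assoc[OF M_ideal Q Ip])
      also have "\<dots> \<subseteq> M \<cdot> ideal_pow R I (Suc k)"
        unfolding ideal_pow_Suc[OF assms(1)] using QI by (intro ideal_prod_mono) auto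
      finally have "u \<otimes> y \<in> M \<cdot> ideal_pow R I (Suc k)" .
      moreover have "z \<otimes> y \<in> (Idl Z) \<cdot> ideal_pow R I k" using zu(1) xy(2) by (rule ideal_prod.prod)
      moreover have "x \<otimes> y = z \<otimes> y \<oplus> u \<otimes> y" unfolding zu(3) using c by (simp add: l_distr)
      ultimately show "x \<otimes> y \<in> (Idl Z) \<cdot> ideal_pow R I k <+> M \<cdot> ideal_pow R I (Suc k)"
        unfolding ideal_sum_mem by blast
    qed
    then have "ideal_pow R I (Suc k) \<subseteq> (Idl Z) \<cdot> ideal_pow R I k"
      by (rule nakayama_local[OF ZI Ip])
    moreover have "Idl Z \<subseteq> I" using genideal_minimal[OF Q Z(1)] QI by blast
    then have "(Idl Z) \<cdot> ideal_pow R I k \<subseteq> ideal_pow R I (Suc k)"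
      unfolding ideal_pow_Suc[OF assms(1)] by (intro ideal_prod_mono) auto
    ultimately have redZ: "ideal_pow R I (Suc k) = (Idl Z) \<cdot> ideal_pow R I k" by blast
    obtain f where f: "bij_betw f {1..card Z} Z"
      using ex_bij_betw_nat_finite_1[OF Z(2)] by blast
    then have fZ: "f ` {1..card Z} = Z" by (simp add: bij_betw_def)
    have "\<forall>i\<in>{1..card Z}. f i \<in> I" using fZ Z(1) QI by blast
    then have "d \<le> card Z"
      using analytic_spread_le[OF assms(1) dim, of "card Z" f k] redZ fZ by simp
    then show False using cardZ by simp
  qed
  moreover have "reduction R ?Q I"
    unfolding reduction_def using Q assms(1) QI red by blast
  ultimately show ?thesis unfolding minimal_reduction_def by blast
qed

end

theorem theorem4p2:
  fixes L :: "('a, 'b) ring_scheme" and \<mm> :: "'a set" and a :: "nat \<Rightarrow> 'a" and m d :: nat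
    and \<aa> :: "'a set"
  assumes "local_ring L \<mm>" and "noetherian_ring L" and "infinite (carrier (L Quot \<mm>))"
    and "\<And>j. j \<in> {1..m} \<Longrightarrow> a j \<in> carrier L"
    and "\<aa> = Idl\<^bsub>L\<^esub> (a ` {1..m})"
    and "d = analytic_spread L \<mm> \<aa>"
  shows "reduction_number L \<aa> =
    reduction_number_wrt (generic_ring L \<mm> d m)
      (generic_minimal_reduction L \<mm> d m a) (generic_extension L \<mm> d m \<aa>)"
proof -
  interpret noetherian_local_ring L \<mm>
    using assms(1,2) by (rule noetherian_local_ring.intro)
  have ac: "a ` {1..m} \<subseteq> carrier L" using assms(4) by auto
  have ideal: "ideal \<aa> L" unfolding assms(5) by (rule genideal_ideal[OF ac])
  have dim: "krull_dim (fiber_cone L \<mm> \<aa>) = enat d"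
    unfolding assms(6) by (rule krull_dim_cone_finite[OF assms(4,5)])
  define red where
    "red Q n \<longleftrightarrow> ideal_pow L \<aa> (Suc n) = Q \<cdot>\<^bsub>L\<^esub> ideal_pow L \<aa> n" for Q n
  define special where "special \<alpha> = Idl\<^bsub>L\<^esub> (specialize m a \<alpha> ` {1..d})" for \<alpha>
  have generic: "reduction_number_wrt (generic_ring L \<mm> d m)
      (generic_minimal_reduction L \<mm> d m a) (generic_extension L \<mm> d m \<aa>)
    = Inf {enat n | n. \<exists>\<alpha>. (\<forall>v. \<alpha> v \<in> carrier L) \<and> red (special \<alpha>) n}"
    unfolding reduction_number_wrt_def red_def special_def
    using generic_reduction_iff[OF assms(3,4,5)] by simp
  \<comment> \<open>the minimal reductions are the specializations of the generic one that are reductions\<close>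
  have special_minimal: "minimal_reduction L (special \<alpha>) \<aa>"
    if "\<forall>v. \<alpha> v \<in> carrier L" "red (special \<alpha>) n" for \<alpha> n
  proof -
    have "specialize m a \<alpha> i \<in> \<aa>" for i
      unfolding specialize_def assms(5)
      using that(1) genideal_self[OF ac]
      by (intro finsum_mem_ideal genideal_ideal[OF ac] ideal.I_l_closed) auto
    then show ?thesis
      using generated_reduction_is_minimal[OF ideal dim] that(2) unfolding red_def special_def by blast
  qed
  have minimal_special: "\<exists>\<alpha>. (\<forall>v. \<alpha> v \<in> carrier L) \<and> Q = special \<alpha>"
    if Q: "minimal_reduction L Q \<aa>" for Q
  proof -
    have Q': "ideal Q L" "Q \<subseteq> \<aa>" using Q by (auto simp: minimal_reduction_def reduction_def)
    obtain r where r: "ideal_pow L \<aa> (Suc r) = Q \<cdot>\<^bsub>L\<^esub> ideal_pow L \<aa> r"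
      using Q by (auto simp: minimal_reduction_def reduction_def)
    obtain e n where e: "\<forall>i\<in>{1..d}. e i \<in> Q"
      "ideal_pow L \<aa> (Suc n) = (Idl\<^bsub>L\<^esub> (e ` {1..d})) \<cdot>\<^bsub>L\<^esub> ideal_pow L \<aa> n"
      using reduction_contains_generated_reduction[OF assms(3) ideal dim Q' r] .
    have eQ: "e ` {1..d} \<subseteq> Q" using e(1) by auto
    then have ec: "e ` {1..d} \<subseteq> carrier L" using ideal.Icarr[OF Q'(1)] by blast
    have EQ: "Idl\<^bsub>L\<^esub> (e ` {1..d}) \<subseteq> Q" by (rule genideal_minimal[OF Q'(1) eQ])
    then have "reduction L (Idl\<^bsub>L\<^esub> (e ` {1..d})) \<aa>"
      unfolding reduction_def using genideal_ideal[OF ec] ideal Q'(2) e(2) by blast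
    then have "Idl\<^bsub>L\<^esub> (e ` {1..d}) = Q" using Q EQ by (simp add: minimal_reduction_def)
    moreover obtain \<alpha> where \<alpha>: "\<forall>v. \<alpha> v \<in> carrier L" "\<forall>i\<in>{1..d}. e i = specialize m a \<alpha> i"
      using combinations_are_specializations[of m a d e] assms(4,5) e(1) Q'(2) by blast
    moreover have "e ` {1..d} = specialize m a \<alpha> ` {1..d}" using \<alpha>(2) by (intro image_cong) auto
    ultimately show ?thesis unfolding special_def by metis
  qed
  have "reduction_number L \<aa>
      = Inf {Inf {enat n | n. red Q n} | Q. minimal_reduction L Q \<aa>}"
    unfolding reduction_number_def reduction_number_wrt_def red_def ..
  also have "\<dots> = Inf {enat n | n. \<exists>\<alpha>. (\<forall>v. \<alpha> v \<in> carrier L) \<and> red (special \<alpha>) n}"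
  proof (rule antisym)
    show "Inf {Inf {enat n | n. red Q n} | Q. minimal_reduction L Q \<aa>}
        \<le> Inf {enat n | n. \<exists>\<alpha>. (\<forall>v. \<alpha> v \<in> carrier L) \<and> red (special \<alpha>) n}"
    proof (rule Inf_greatest)
      fix z assume "z \<in> {enat n | n. \<exists>\<alpha>. (\<forall>v. \<alpha> v \<in> carrier L) \<and> red (special \<alpha>) n}"
      then obtain n \<alpha> where n: "z = enat n" "\<forall>v. \<alpha> v \<in> carrier L" "red (special \<alpha>) n" by blast
      have "Inf {Inf {enat n | n. red Q n} | Q. minimal_reduction L Q \<aa>}
          \<le> Inf {enat n | n. red (special \<alpha>) n}"
        by (rule Inf_lower) (use special_minimal[OF n(2,3)] in blast)
      also have "\<dots> \<le> z" by (rule Inf_lower) (use n in blast)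
      finally show "Inf {Inf {enat n | n. red Q n} | Q. minimal_reduction L Q \<aa>} \<le> z" .
    qed
    show "Inf {enat n | n. \<exists>\<alpha>. (\<forall>v. \<alpha> v \<in> carrier L) \<and> red (special \<alpha>) n}
        \<le> Inf {Inf {enat n | n. red Q n} | Q. minimal_reduction L Q \<aa>}"
    proof (rule Inf_greatest)
      fix z assume "z \<in> {Inf {enat n | n. red Q n} | Q. minimal_reduction L Q \<aa>}"
      then obtain Q where Q: "z = Inf {enat n | n. red Q n}" "minimal_reduction L Q \<aa>" by blast
      obtain \<alpha> where \<alpha>: "\<forall>v. \<alpha> v \<in> carrier L" "Q = special \<alpha>"
        using minimal_special[OF Q(2)] by blast
      show "Inf {enat n | n. \<exists>\<alpha>. (\<forall>v. \<alpha> v \<in> carrier L) \<and> red (special \<alpha>) n} \<le> z"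
        unfolding Q(1) using \<alpha> by (intro Inf_superset_mono) blast
    qed
  qed
  finally show ?thesis unfolding generic .
qed

end
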